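(* Let $X$ be a Hausdorff, path-connected, locally path-connected and semilocally simply connected space. If $\pi_1(X)$ is a torsion group (not necessarily finite), then $\Pi^{\mathrm{ST}}(X)=1$ and $H^n_{\mathrm{ST}}(X,A)=0$ for all $n>0$ and all discrete $\Pi^{\mathrm{ST}}(X)$-modules $A$.
   Context: $C(X)$ is the ring of continuous functions $X\to\mathbb{C}$. A Weierstrass polynomial of degree $n$ on $X$ is a monic $f(z)=z^n+a_{n-1}z^{n-1}+\cdots+a_0\in C(X)[z]$ such that for each $x\in X$ the specialization $f_x(z)\in\mathbb{C}[z]$ has $n$ distinct complex roots. For a path-connected covering $p:Y\to X$, $f$ splits in $Y$ if $p^*f\in C(Y)[z]$ (coefficients composed with $p$) has $n$ distinct roots in $C(Y)$. A splitting covering of $f$ is a path-connected covering $q:E_f\to X$ in which $f$ splits and which is minimal: whenever $f$ splits in a covering $p:Y\to X$, there is a covering map $Y\to E_f$ over $X$. Known: a splitting covering exists, is unique up to isomorphism over $X$, and is finite and Galois (regular). $\mathrm{Deck}(Y/X)$ denotes the group of homeomorphisms of $Y$ over $X$. $E_f$ dominates $E_g$ if there is a covering map $E_f\to E_g$ over $X$. Fix $x\in X$ and a point $e_f\in E_f$ over $x$ for each $f$; if $E_f$ dominates $E_g$ there is a unique covering map $\phi:E_f\to E_g$ over $X$ with $\phi(e_f)=e_g$, and a homomorphism $\mathrm{res}:\mathrm{Deck}(E_f/X)\to\mathrm{Deck}(E_g/X)$ determined by $\mathrm{res}(\sigma)\circ\phi=\phi\circ\sigma$. The absolute semi-topological Galois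 group is the profinite group $\Pi^{\mathrm{ST}}(X)=\Pi^{\mathrm{ST}}(X,x):=\varprojlim_f\mathrm{Deck}(E_f/X)$, over all Weierstrass polynomials $f$ on $X$ with these transition maps. The basepoint is often suppressed. For a profinite group $G$, a discrete $G$-module is an abelian group with $G$-action such that all stabilizers are open; $H^n_{\mathrm{cont}}(G,A)$ is the cohomology of the inhomogeneous complex of continuous functions $G^n\to A$. $H^n_{\mathrm{ST}}(X,A):=H^n_{\mathrm{cont}}(\Pi^{\mathrm{ST}}(X),A)$. *)

theory Defs
  imports
    "HOL-Analysis.Analysis"
    "HOL-Computational_Algebra.Polynomial"
    "HOL-Library.Function_Algebras"
    "HOL-Algebra.FiniteProduct"
    "HOL-Algebra.Product_Groups"
    "HOL-Algebra.Group_Action"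
begin

section \<open>Fundamental groups\<close>

definition loops_at :: "'a::topological_space set \<Rightarrow> 'a \<Rightarrow> (real \<Rightarrow> 'a) set" where
  "loops_at S x = {p. path p \<and> path_image p \<subseteq> S \<and> pathstart p = x \<and> pathfinish p = x}"

definition fundamental_group :: "'a::topological_space set \<Rightarrow> 'a \<Rightarrow> (real \<Rightarrow> 'a) set monoid" where
  "fundamental_group S x =
    \<lparr>carrier = loops_at S x // {(p, q). homotopic_paths S p q},
     monoid.mult = (\<lambda>P Q. {r. \<exists>p\<in>P. \<exists>q\<in>Q. homotopic_paths S (p +++ q) r}),
     one = {r. homotopic_paths S (\<lambda>_. x) r}\<rparr>"

definition torsion_group :: "('g, 'b) monoid_scheme \<Rightarrow> bool" where
  "torsion_group G \<longleftrightarrow>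
    (\<forall>g\<in>carrier G. \<exists>n::nat. n > 0 \<and> g [^]\<^bsub>G\<^esub> n = \<one>\<^bsub>G\<^esub>)"

definition semilocally_simply_connected :: "'a::topological_space set \<Rightarrow> bool" where
  "semilocally_simply_connected S \<longleftrightarrow>
    (\<forall>x\<in>S. \<exists>U. openin (top_of_set S) U \<and> x \<in> U \<and>
       (\<forall>p\<in>loops_at U x. homotopic_paths S p (\<lambda>_. x)))"

section \<open>Coverings\<close>

text \<open>
  The analogue of \<^const>\<open>covering_space\<close> for abstract topologies; these are used for total
  spaces, so that one can quantify over all topologies on a given type.
\<close>

definition covering_map :: "'c topology \<Rightarrow> ('c \<Rightarrow> 'b) \<Rightarrow> 'b topology \<Rightarrow> bool" where
  "covering_map Y p X \<longleftrightarrow>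
    continuous_map Y X p \<and> p ` topspace Y = topspace X \<and>
    (\<forall>x\<in>topspace X. \<exists>T. x \<in> T \<and> openin X T \<and>
       (\<exists>\<V>. \<Union>\<V> = {y \<in> topspace Y. p y \<in> T} \<and> (\<forall>U\<in>\<V>. openin Y U) \<and> pairwise disjnt \<V> \<and>
            (\<forall>U\<in>\<V>. homeomorphic_map (subtopology Y U) (subtopology X T) p)))"

definition path_connected_covering :: "'c topology \<Rightarrow> ('c \<Rightarrow> 'a::topological_space) \<Rightarrow> bool" where
  "path_connected_covering Y p \<longleftrightarrow> path_connected_space Y \<and> covering_map Y p euclidean"

definition covering_map_over ::
    "'c topology \<Rightarrow> ('c \<Rightarrow> 'a) \<Rightarrow> 'd topology \<Rightarrow> ('d \<Rightarrow> 'a) \<Rightarrow> ('c \<Rightarrow> 'd) \<Rightarrow> bool" where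
  "covering_map_over Y p Z q \<phi> \<longleftrightarrow>
    covering_map Y \<phi> Z \<and> (\<forall>y\<in>topspace Y. q (\<phi> y) = p y)"

definition deck_group :: "'c topology \<Rightarrow> ('c \<Rightarrow> 'a) \<Rightarrow> ('c \<Rightarrow> 'c) monoid" where
  "deck_group Y p = BijGroup (topspace Y)
    \<lparr>carrier := {\<sigma> \<in> Bij (topspace Y).
        homeomorphic_map Y Y \<sigma> \<and> (\<forall>y\<in>topspace Y. p (\<sigma> y) = p y)}\<rparr>"

section \<open>Weierstrass polynomials and splitting coverings\<close>

definition continuous_functions :: "'c topology \<Rightarrow> ('c \<Rightarrow> complex) set" where
  "continuous_functions Y = {r \<in> extensional (topspace Y). continuous_map Y euclidean r}"

text \<open>
  The base space is a whole type \<open>'a\<close>.  Polynomials over its ring of continuous functions are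
  polynomials over the pointwise function ring \<open>'a \<Rightarrow> complex\<close> whose coefficients are continuous.
\<close>

definition specialize :: "('a \<Rightarrow> complex) poly \<Rightarrow> 'a \<Rightarrow> complex poly" where
  "specialize f x = map_poly (\<lambda>a. a x) f"

definition pullback :: "('c \<Rightarrow> 'a) \<Rightarrow> ('a \<Rightarrow> complex) poly \<Rightarrow> ('c \<Rightarrow> complex) poly" where
  "pullback p f = map_poly (\<lambda>a. a \<circ> p) f"

definition weierstrass_polys :: "('a::topological_space \<Rightarrow> complex) poly set" where
  "weierstrass_polys = {f. lead_coeff f = 1 \<and>
     (\<forall>i. coeff f i \<in> continuous_functions euclidean) \<and>
     (\<forall>x. card {z. poly (specialize f x) z = 0} = degree f)}"

text \<open>
  Equality in the ring of continuous functions on \<open>Y\<close> means equality on \<open>topspace Y\<close>.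
\<close>

definition splits_in ::
    "('a \<Rightarrow> complex) poly \<Rightarrow> 'c topology \<Rightarrow> ('c \<Rightarrow> 'a) \<Rightarrow> bool" where
  "splits_in f Y p \<longleftrightarrow>
    (\<exists>R \<subseteq> continuous_functions Y. finite R \<and> card R = degree f \<and>
       (\<forall>r\<in>R. \<forall>y\<in>topspace Y. poly (pullback p f) r y = 0))"

text \<open>
  Minimality is tested against coverings \<open>Y\<close> whose points are functions \<open>real \<Rightarrow> 'a\<close>.  Up to
  isomorphism these are all path-connected coverings of \<open>'a\<close>: fix \<open>y\<^sub>0\<close> in such a covering
  and send \<open>y\<close> to the projection of a chosen path from \<open>y\<^sub>0\<close> to \<open>y\<close>; by unique path lifting
  this is injective, so the topology of the covering can be transported to its image.
\<close>

definition splitting_covering ::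
    "('a::topological_space \<Rightarrow> complex) poly \<Rightarrow> 'e topology \<Rightarrow> ('e \<Rightarrow> 'a) \<Rightarrow> bool" where
  "splitting_covering f E q \<longleftrightarrow>
    path_connected_covering E q \<and> splits_in f E q \<and>
    (\<forall>(Y :: (real \<Rightarrow> 'a) topology) p. path_connected_covering Y p \<and> splits_in f Y p
       \<longrightarrow> (\<exists>\<phi>. covering_map_over Y p E q \<phi>))"

definition pointed_splitting_coverings ::
    "'a::topological_space \<Rightarrow> (('a \<Rightarrow> complex) poly \<Rightarrow> 'e topology) \<Rightarrow>
      (('a \<Rightarrow> complex) poly \<Rightarrow> 'e \<Rightarrow> 'a) \<Rightarrow> (('a \<Rightarrow> complex) poly \<Rightarrow> 'e) \<Rightarrow> bool" where
  "pointed_splitting_coverings x E q e \<longleftrightarrow>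
    (\<forall>f\<in>weierstrass_polys. splitting_covering f (E f) (q f) \<and>
       e f \<in> topspace (E f) \<and> q f (e f) = x)"

section \<open>The absolute semi-topological Galois group\<close>

definition dominates ::
    "('i \<Rightarrow> 'e topology) \<Rightarrow> ('i \<Rightarrow> 'e \<Rightarrow> 'a) \<Rightarrow> 'i \<Rightarrow> 'i \<Rightarrow> bool" where
  "dominates E q f g \<longleftrightarrow> (\<exists>\<phi>. covering_map_over (E f) (q f) (E g) (q g) \<phi>)"

definition transition_map ::
    "('i \<Rightarrow> 'e topology) \<Rightarrow> ('i \<Rightarrow> 'e \<Rightarrow> 'a) \<Rightarrow> ('i \<Rightarrow> 'e) \<Rightarrow> 'i \<Rightarrow> 'i \<Rightarrow> 'e \<Rightarrow> 'e" where
  "transition_map E q e f g =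
    (THE \<phi>. \<phi> \<in> extensional (topspace (E f)) \<and>
       covering_map_over (E f) (q f) (E g) (q g) \<phi> \<and> \<phi> (e f) = e g)"

definition deck_res ::
    "('i \<Rightarrow> 'e topology) \<Rightarrow> ('i \<Rightarrow> 'e \<Rightarrow> 'a) \<Rightarrow> ('i \<Rightarrow> 'e) \<Rightarrow> 'i \<Rightarrow> 'i \<Rightarrow> ('e \<Rightarrow> 'e) \<Rightarrow> 'e \<Rightarrow> 'e" where
  "deck_res E q e f g \<sigma> =
    (THE \<tau>. \<tau> \<in> carrier (deck_group (E g) (q g)) \<and>
       (\<forall>y\<in>topspace (E f). \<tau> (transition_map E q e f g y) = transition_map E q e f g (\<sigma> y)))"

definition Pi_ST ::
    "(('a::topological_space \<Rightarrow> complex) poly \<Rightarrow> 'e topology) \<Rightarrow>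
      (('a \<Rightarrow> complex) poly \<Rightarrow> 'e \<Rightarrow> 'a) \<Rightarrow> (('a \<Rightarrow> complex) poly \<Rightarrow> 'e) \<Rightarrow>
      (('a \<Rightarrow> complex) poly \<Rightarrow> 'e \<Rightarrow> 'e) monoid" where
  "Pi_ST E q e = product_group weierstrass_polys (\<lambda>f. deck_group (E f) (q f))
    \<lparr>carrier := {s \<in> (\<Pi>\<^sub>E f\<in>weierstrass_polys. carrier (deck_group (E f) (q f))).
        \<forall>f\<in>weierstrass_polys. \<forall>g\<in>weierstrass_polys. dominates E q f g \<longrightarrow>
          deck_res E q e f g (s f) = s g}\<rparr>"

definition Pi_ST_topology ::
    "(('a::topological_space \<Rightarrow> complex) poly \<Rightarrow> 'e topology) \<Rightarrow>
      (('a \<Rightarrow> complex) poly \<Rightarrow> 'e \<Rightarrow> 'a) \<Rightarrow> (('a \<Rightarrow> complex) poly \<Rightarrow> 'e) \<Rightarrow>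
      (('a \<Rightarrow> complex) poly \<Rightarrow> 'e \<Rightarrow> 'e) topology" where
  "Pi_ST_topology E q e = subtopology
    (product_topology (\<lambda>f. discrete_topology (carrier (deck_group (E f) (q f)))) weierstrass_polys)
    (carrier (Pi_ST E q e))"

section \<open>Continuous cohomology\<close>

text \<open>
  A topological group is given by a group \<open>G\<close> and a topology \<open>T\<close> with
  \<open>topspace T = carrier G\<close>.  The coefficient group \<open>A\<close> is written multiplicatively.
\<close>

definition discrete_module ::
    "('g, 'b) monoid_scheme \<Rightarrow> 'g topology \<Rightarrow> ('m, 'd) monoid_scheme \<Rightarrow> ('g \<Rightarrow> 'm \<Rightarrow> 'm) \<Rightarrow> bool" where
  "discrete_module G T A act \<longleftrightarrow>
    comm_group A \<and> group_action G (carrier A) act \<and> (\<forall>g\<in>carrier G. act g \<in> hom A A) \<and>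
    (\<forall>a\<in>carrier A. openin T (stabilizer G act a))"

definition tuples :: "('g, 'b) monoid_scheme \<Rightarrow> nat \<Rightarrow> (nat \<Rightarrow> 'g) set" where
  "tuples G n = (\<Pi>\<^sub>E i\<in>{..<n}. carrier G)"

definition cochains ::
    "('g, 'b) monoid_scheme \<Rightarrow> 'g topology \<Rightarrow> ('m, 'd) monoid_scheme \<Rightarrow> nat \<Rightarrow>
      ((nat \<Rightarrow> 'g) \<Rightarrow> 'm) monoid" where
  "cochains G T A n = product_group (tuples G n) (\<lambda>_. A)
    \<lparr>carrier := {c \<in> (\<Pi>\<^sub>E s\<in>tuples G n. carrier A).
        continuous_map (product_topology (\<lambda>_. T) {..<n}) (discrete_topology (carrier A)) c}\<rparr>"

definition contract :: "('g, 'b) monoid_scheme \<Rightarrow> nat \<Rightarrow> nat \<Rightarrow> (nat \<Rightarrow> 'g) \<Rightarrow> nat \<Rightarrow> 'g" where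
  "contract G n i s = (\<lambda>j\<in>{..<n}.
     if j < i then s j else if j = i then s i \<otimes>\<^bsub>G\<^esub> s (Suc i) else s (Suc j))"

text \<open>
  With arguments numbered from 0 and \<open>A\<close> written additively, this is
  \<open>(dc)(s\<^sub>0, \<dots>, s\<^sub>n) = s\<^sub>0 c(s\<^sub>1, \<dots>, s\<^sub>n)
     + (\<Sum>i<n. (-1)^(i+1) c(s\<^sub>0, \<dots>, s\<^sub>i s\<^sub>i\<^sub>+\<^sub>1, \<dots>, s\<^sub>n)) + (-1)^(n+1) c(s\<^sub>0, \<dots>, s\<^sub>n\<^sub>-\<^sub>1)\<close>.
\<close>

definition coboundary ::
    "('g, 'b) monoid_scheme \<Rightarrow> ('m, 'd) monoid_scheme \<Rightarrow> ('g \<Rightarrow> 'm \<Rightarrow> 'm) \<Rightarrow> nat \<Rightarrow>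
      ((nat \<Rightarrow> 'g) \<Rightarrow> 'm) \<Rightarrow> (nat \<Rightarrow> 'g) \<Rightarrow> 'm" where
  "coboundary G A act n c = (\<lambda>s\<in>tuples G (Suc n).
     act (s 0) (c (\<lambda>j\<in>{..<n}. s (Suc j)))
     \<otimes>\<^bsub>A\<^esub> finprod A (\<lambda>i. c (contract G n i s) [^]\<^bsub>A\<^esub> ((-1) ^ (i + 1) :: int)) {..<n}
     \<otimes>\<^bsub>A\<^esub> c (restrict s {..<n}) [^]\<^bsub>A\<^esub> ((-1) ^ (n + 1) :: int))"

definition cocycles ::
    "('g, 'b) monoid_scheme \<Rightarrow> 'g topology \<Rightarrow> ('m, 'd) monoid_scheme \<Rightarrow> ('g \<Rightarrow> 'm \<Rightarrow> 'm) \<Rightarrow> nat \<Rightarrow>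
      ((nat \<Rightarrow> 'g) \<Rightarrow> 'm) set" where
  "cocycles G T A act n =
    kernel (cochains G T A n) (cochains G T A (Suc n)) (coboundary G A act n)"

definition coboundaries ::
    "('g, 'b) monoid_scheme \<Rightarrow> 'g topology \<Rightarrow> ('m, 'd) monoid_scheme \<Rightarrow> ('g \<Rightarrow> 'm \<Rightarrow> 'm) \<Rightarrow> nat \<Rightarrow>
      ((nat \<Rightarrow> 'g) \<Rightarrow> 'm) set" where
  "coboundaries G T A act n =
    (case n of 0 \<Rightarrow> {\<one>\<^bsub>cochains G T A 0\<^esub>}
     | Suc m \<Rightarrow> coboundary G A act m ` carrier (cochains G T A m))"

definition H_cont ::
    "('g, 'b) monoid_scheme \<Rightarrow> 'g topology \<Rightarrow> ('m, 'd) monoid_scheme \<Rightarrow> ('g \<Rightarrow> 'm \<Rightarrow> 'm) \<Rightarrow> nat \<Rightarrow>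
      ((nat \<Rightarrow> 'g) \<Rightarrow> 'm) set monoid" where
  "H_cont G T A act n =
    (cochains G T A n\<lparr>carrier := cocycles G T A act n\<rparr>) Mod coboundaries G T A act n"

definition H_ST ::
    "(('a::topological_space \<Rightarrow> complex) poly \<Rightarrow> 'e topology) \<Rightarrow>
      (('a \<Rightarrow> complex) poly \<Rightarrow> 'e \<Rightarrow> 'a) \<Rightarrow> (('a \<Rightarrow> complex) poly \<Rightarrow> 'e) \<Rightarrow>
      ('m, 'd) monoid_scheme \<Rightarrow>
      ((('a \<Rightarrow> complex) poly \<Rightarrow> 'e \<Rightarrow> 'e) \<Rightarrow> 'm \<Rightarrow> 'm) \<Rightarrow> nat \<Rightarrow>
      ((nat \<Rightarrow> ('a \<Rightarrow> complex) poly \<Rightarrow> 'e \<Rightarrow> 'e) \<Rightarrow> 'm) set monoid" where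
  "H_ST E q e A act n = H_cont (Pi_ST E q e) (Pi_ST_topology E q e) A act n"

end

theory Submission
  imports
    Defs
    "HOL-Combinatorics.Permutations"
    "HOL-Computational_Algebra.Fundamental_Theorem_Algebra"
begin

text \<open>
  Every Weierstrass polynomial already splits over \<open>X\<close> itself; then minimality of \<open>E\<^sub>f\<close>
  makes \<open>E\<^sub>f \<rightarrow> X\<close> injective, all deck groups are trivial, and the cohomology is that of the
  trivial group.  Splitting amounts to trivial monodromy of the roots along each loop \<open>\<gamma>\<close>, and
  since some power \<open>\<gamma>\<^sup>m\<close> is null-homotopic this follows from the braid group being torsion-free,
  in the following form: a braid of finite order permutes its strands trivially.

  Otherwise restrict to a cycle of \<open>n \<ge> 2\<close> strands and let \<open>S(t)\<close>, \<open>\<bar>t\<bar> = 1\<close>, be the Burau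
  matrix of \<open>\<gamma>\<close>.  Since \<open>S(t)\<^sup>m = 1\<close>, the projections \<open>(1/m) (\<Sum>j<m. S(t)\<^sup>j)\<close> onto the invariants
  have constant rank along the circle; at \<open>t = 1\<close> the matrix is that of an \<open>n\<close>-cycle, so the
  invariants are always the multiples of the fixed vector \<open>v = (1, \<dots>, 1)\<close>.  But the
  functional \<open>w = (1, t, \<dots>, t\<^sup>n\<^sup>-\<^sup>1)\<close> is invariant as well, and at \<open>t = exp (2 \<pi> i / n)\<close> one has
  \<open>w v = 0\<close>, so \<open>w\<close> would vanish.
\<close>

section \<open>Colourings of moving points\<close>

text \<open>Strands are arbitrary continuous paths, so there need not be a diagram with finitely
  many transversal crossings from which a braid word could be read. The Burau matrix is therefore
  never assembled from crossings. For a fixed vertical order a colouring is put into a normal form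
  that ignores the horizontal order, and a small move re-expands this normal form at the new
  positions. What has to be proved is that, for well separated points and small moves, the vertical
  order used is immaterial; homotopy invariance then follows by filling a fine grid with commuting
  squares.

  Passing to one cycle serves two purposes: at \<open>t = 1\<close> it leaves only the constant
  colourings invariant, and since every remaining strand takes part in the cycle, the root of unity
  can be matched to the number of strands. Connectedness of the parameter space is what carries the
  information from \<open>t = 1\<close> to that root of unity.\<close>

text \<open>
  Points moving in the plane, seen from far below, are the strands of a braid diagram in which
  the lower point passes in front.  A colouring \<open>k\<close> assigns a complex number to each
  strand; a point passing behind \<open>a\<close> from right to left changes its colour from
  \<open>z\<close> to \<open>t z + (1 - t) k a\<close>, which gives the Burau representation.

  In \<open>frame t R h d\<close>, \<open>h\<close> lists the points from bottom to top, \<open>R i j\<close> means that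
  \<open>i\<close> is to the left of \<open>j\<close>, and \<open>d i\<close> is the colour which \<open>i\<close> would show if it
  were to the right of all lower points.
\<close>

definition slide :: "complex \<Rightarrow> 'l set \<Rightarrow> 'l \<Rightarrow> ('l \<Rightarrow> complex) \<Rightarrow> 'l \<Rightarrow> complex" where
  "slide t U a k = (\<lambda>i. if i \<in> U then t * k i + (1 - t) * k a else k i)"

primrec frame :: "complex \<Rightarrow> ('l \<Rightarrow> 'l \<Rightarrow> bool) \<Rightarrow> 'l list \<Rightarrow> ('l \<Rightarrow> complex) \<Rightarrow> 'l \<Rightarrow> complex" where
  "frame t R [] d = d"
| "frame t R (a # h) d = slide t {i \<in> set h. R i a} a (frame t R h d)"

primrec unframe :: "complex \<Rightarrow> ('l \<Rightarrow> 'l \<Rightarrow> bool) \<Rightarrow> 'l list \<Rightarrow> ('l \<Rightarrow> complex) \<Rightarrow> 'l \<Rightarrow> complex" where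
  "unframe t R [] k = k"
| "unframe t R (a # h) k = unframe t R h (slide (1 / t) {i \<in> set h. R i a} a k)"

text \<open>The heights \<open>h\<close> are held fixed during the move, so the normalized colouring
  is unchanged; moves then compose without any case distinction on crossings.\<close>

definition transport ::
    "complex \<Rightarrow> ('l \<Rightarrow> 'l \<Rightarrow> bool) \<Rightarrow> ('l \<Rightarrow> 'l \<Rightarrow> bool) \<Rightarrow> 'l list \<Rightarrow> ('l \<Rightarrow> complex) \<Rightarrow> 'l \<Rightarrow> complex" where
  "transport t R S h k = frame t S h (unframe t R h k)"

lemma slide_inverse:
  assumes "t \<noteq> 0" "a \<notin> U"
  shows "slide (1 / t) U a (slide t U a k) = k" "slide t U a (slide (1 / t) U a k) = k"
  using assms by (auto simp: slide_def fun_eq_iff field_simps)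

lemma frame_outside: "i \<notin> set h \<Longrightarrow> frame t R h d i = d i"
  by (induction h) (auto simp: slide_def)

lemma unframe_frame:
  assumes "t \<noteq> 0" "distinct h"
  shows "unframe t R h (frame t R h d) = d"
  using assms(2) by (induction h) (auto simp: slide_inverse assms(1))

lemma frame_unframe:
  assumes "t \<noteq> 0" "distinct h"
  shows "frame t R h (unframe t R h k) = k"
  using assms(2) by (induction h arbitrary: k) (auto simp: slide_inverse assms(1))

lemma transport_refl: "t \<noteq> 0 \<Longrightarrow> distinct h \<Longrightarrow> transport t R R h k = k"
  by (simp add: transport_def frame_unframe)

lemma transport_trans:
  "t \<noteq> 0 \<Longrightarrow> distinct h \<Longrightarrow> transport t S Q h (transport t R S h k) = transport t R Q h k"
  by (simp add: transport_def unframe_frame)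

text \<open>Since \<open>t z + (1 - t) z = z\<close>, a strand is not recoloured by one of its own
  colour. This provides the invariant vector for every \<open>t\<close>.\<close>

lemma frame_const: "frame t R h (\<lambda>_. c) = (\<lambda>_. c)"
  by (induction h) (auto simp: slide_def algebra_simps)

lemma unframe_const: "t \<noteq> 0 \<Longrightarrow> unframe t R h (\<lambda>_. c) = (\<lambda>_. c)"
proof (induction h)
  case (Cons a h)
  have "slide (1 / t) U a (\<lambda>_. c) = (\<lambda>_. c)" for U
    using Cons.prems by (auto simp: slide_def field_simps)
  with Cons show ?case by simp
qed auto

lemma transport_const: "t \<noteq> 0 \<Longrightarrow> transport t R S h (\<lambda>_. c) = (\<lambda>_. c)"
  by (simp add: transport_def frame_const unframe_const)

lemma slide_1: "slide 1 U a k = k"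
  by (auto simp: slide_def)

text \<open>At \<open>t = 1\<close> passing behind a strand has no effect, so only the permutation
  of the strands survives. This is the starting point of the deformation in
  \<open>t\<close>.\<close>

lemma transport_1: "transport 1 R S h k = k"
proof -
  have "frame 1 R h d = d" "unframe 1 R h d = d" for R d
    by (induction h arbitrary: d) (auto simp: slide_1)
  then show ?thesis by (simp add: transport_def)
qed

subsection \<open>Changing the order of the heights\<close>

lemma frame_fun_upd:
  assumes "a \<notin> set h"
  shows "frame t R h (d(a := z)) = (frame t R h d)(a := z)"
  using assms by (induction h) (auto simp: slide_def fun_eq_iff)

text \<open>The new normalized colour \<open>z\<close> of \<open>a\<close> solves
  \<open>t z + (1 - t) d b = d a\<close>, because \<open>a\<close> is to the left of
  \<open>b\<close> and now counts as passing behind it. For a third point to the left of both, the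
  two orders agree by self-distributivity of \<open>t x + (1 - t) y\<close>, the algebraic form of
  the third Reidemeister move.\<close>

lemma frame_swap:
  assumes "t \<noteq> 0" "R a b" "\<not> R b a" "a \<noteq> b" "a \<notin> set h" "b \<notin> set h"
    and tr: "\<And>i. i \<in> set h \<Longrightarrow> R i a \<Longrightarrow> R i b"
  shows "frame t R (a # b # h) d = frame t R (b # a # h) (d(a := (d a - (1 - t) * d b) / t))"
proof
  fix i
  have *: "frame t R h d a = d a" "frame t R h d b = d b"
    using assms by (auto simp: frame_outside)
  show "frame t R (a # b # h) d i = frame t R (b # a # h) (d(a := (d a - (1 - t) * d b) / t)) i"
    using assms * by (auto simp: frame_fun_upd slide_def field_simps)
qed

definition strict_linear_on :: "'l set \<Rightarrow> ('l \<Rightarrow> 'l \<Rightarrow> bool) \<Rightarrow> bool" where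
  "strict_linear_on I R \<longleftrightarrow>
    (\<forall>i\<in>I. \<not> R i i) \<and> (\<forall>i\<in>I. \<forall>j\<in>I. i \<noteq> j \<longrightarrow> R i j \<or> R j i) \<and>
    (\<forall>i\<in>I. \<forall>j\<in>I. \<forall>k\<in>I. R i j \<longrightarrow> R j k \<longrightarrow> R i k)"

lemma strict_linear_on_irrefl: "strict_linear_on I R \<Longrightarrow> i \<in> I \<Longrightarrow> \<not> R i i"
  by (simp add: strict_linear_on_def)

lemma strict_linear_on_total:
  "strict_linear_on I R \<Longrightarrow> i \<in> I \<Longrightarrow> j \<in> I \<Longrightarrow> i \<noteq> j \<Longrightarrow> R i j \<or> R j i"
  by (simp add: strict_linear_on_def)

lemma strict_linear_on_trans:
  "strict_linear_on I R \<Longrightarrow> R i j \<Longrightarrow> R j k \<Longrightarrow> i \<in> I \<Longrightarrow> j \<in> I \<Longrightarrow> k \<in> I \<Longrightarrow> R i k"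
  unfolding strict_linear_on_def by blast

lemma strict_linear_on_subset: "strict_linear_on I R \<Longrightarrow> J \<subseteq> I \<Longrightarrow> strict_linear_on J R"
  unfolding strict_linear_on_def by (meson subsetD)

text \<open>The same \<open>d'\<close> serves \<open>R\<close> and \<open>S\<close>: the change of
  normalized colours depends only on the relative position of \<open>a\<close> and \<open>b\<close>,
  on which the two orders agree. This is what lets a transport from \<open>R\<close> to
  \<open>S\<close> be rewritten with another height order.\<close>

lemma frames_swap:
  assumes t: "t \<noteq> 0" and d: "distinct (a # b # h)"
    and R: "strict_linear_on (set (a # b # h)) R" and S: "strict_linear_on (set (a # b # h)) S"
    and RS: "R a b = S a b" "R b a = S b a"
  shows "\<exists>d'. (\<forall>i. i \<notin> set (a # b # h) \<longrightarrow> d' i = d i) \<and>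
    frame t R (a # b # h) d = frame t R (b # a # h) d' \<and>
    frame t S (a # b # h) d = frame t S (b # a # h) d'"
proof (cases "R a b")
  case True
  then have n: "\<not> R b a" "\<not> S b a" "S a b"
    using R RS unfolding strict_linear_on_def by (metis list.set_intros)+
  have "frame t Q (a # b # h) d = frame t Q (b # a # h) (d(a := (d a - (1 - t) * d b) / t))"
    if "strict_linear_on (set (a # b # h)) Q" "Q a b" "\<not> Q b a" for Q
  proof (rule frame_swap)
    show "Q i b" if "i \<in> set h" "Q i a" for i
      using \<open>strict_linear_on (set (a # b # h)) Q\<close> that \<open>Q a b\<close>
      unfolding strict_linear_on_def by (metis list.set_intros)
  qed (use t d that in auto)
  with True n R S show ?thesis
    by (intro exI[of _ "d(a := (d a - (1 - t) * d b) / t)"]) auto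
next
  case False
  then have n: "R b a" "S b a" "\<not> S a b"
    using R RS d unfolding strict_linear_on_def by (auto dest: bspec)
  \<comment> \<open>Inverse of the substitution in \<open>frame_swap\<close>, with the roles of
    \<open>a\<close> and \<open>b\<close> exchanged.\<close>
  define d' where "d' = d(b := t * d b + (1 - t) * d a)"
  have d: "d'(b := (d' b - (1 - t) * d' a) / t) = d"
    using t d by (auto simp: d'_def fun_eq_iff field_simps)
  have "frame t Q (b # a # h) d' = frame t Q (a # b # h) d"
    if "strict_linear_on (set (a # b # h)) Q" "Q b a" "\<not> Q a b" for Q
  proof -
    have "Q i a" if "i \<in> set h" "Q i b" for i
      using \<open>strict_linear_on (set (a # b # h)) Q\<close> that \<open>Q b a\<close>
      unfolding strict_linear_on_def by (metis list.set_intros)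
    then show ?thesis
      using frame_swap[of t Q b a h d'] t \<open>distinct (a # b # h)\<close> that d by auto
  qed
  with False n R S show ?thesis
    by (intro exI[of _ d']) (auto simp: d'_def)
qed

lemma frames_rotate:
  assumes t: "t \<noteq> 0" and d: "distinct (u @ a # v)"
    and R: "strict_linear_on (set (u @ a # v)) R" and S: "strict_linear_on (set (u @ a # v)) S"
    and RS: "\<And>l. l \<in> set u \<Longrightarrow> R a l = S a l \<and> R l a = S l a"
  shows "\<exists>d'. (\<forall>i. i \<notin> set (u @ a # v) \<longrightarrow> d' i = d i) \<and>
    frame t R (u @ a # v) d = frame t R (a # u @ v) d' \<and>
    frame t S (u @ a # v) d = frame t S (a # u @ v) d'"
  using d R S RS
proof (induction u)
  case (Cons b u)
  have "strict_linear_on (set (u @ a # v)) R" "strict_linear_on (set (u @ a # v)) S"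
    using Cons.prems(2,3) by (auto elim!: strict_linear_on_subset)
  with Cons obtain d1 where d1: "\<forall>i. i \<notin> set (u @ a # v) \<longrightarrow> d1 i = d i"
    "frame t R (u @ a # v) d = frame t R (a # u @ v) d1"
    "frame t S (u @ a # v) d = frame t S (a # u @ v) d1"
    by (metis distinct.simps(2) append_Cons list.set_intros(2))
  have eq: "frame t Q (b # u @ a # v) d = frame t Q (b # a # u @ v) d1"
    if "frame t Q (u @ a # v) d = frame t Q (a # u @ v) d1" for Q
  proof -
    have "{i \<in> set (u @ a # v). Q i b} = {i \<in> set (a # u @ v). Q i b}" by auto
    with that show ?thesis by (simp only: frame.simps)
  qed
  have set: "set (b # a # u @ v) = set ((b # u) @ a # v)" by auto
  from frames_swap[of t b a "u @ v" R S d1]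
  obtain d2 where "\<forall>i. i \<notin> set (b # a # u @ v) \<longrightarrow> d2 i = d1 i"
    "frame t R (b # a # u @ v) d1 = frame t R (a # b # u @ v) d2"
    "frame t S (b # a # u @ v) d1 = frame t S (a # b # u @ v) d2"
    using Cons.prems t unfolding set by (auto simp del: frame.simps)
  with d1 eq show ?case
    by (intro exI[of _ d2]) (auto simp del: frame.simps)
qed auto

text \<open>The head of \<open>h'\<close> is moved to the front of \<open>h\<close> by adjacent
  swaps. It passes only points that precede it in \<open>h\<close> and follow it in
  \<open>h'\<close>, so \<open>R\<close> and \<open>S\<close> have to agree only on pairs whose two
  height orders conflict. The orders may be weak, in which case ties count as conflicts.\<close>

lemma frames_reorder:
  assumes t: "t \<noteq> 0" and "distinct h" "distinct h'" "set h = set h'"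
    and "strict_linear_on (set h) R" "strict_linear_on (set h) S"
    and "sorted_wrt P h" "sorted_wrt P' h'"
    and "\<And>i j. i \<in> set h \<Longrightarrow> j \<in> set h \<Longrightarrow> P i j \<Longrightarrow> P' j i \<Longrightarrow> R i j = S i j \<and> R j i = S j i"
  shows "\<exists>d'. (\<forall>i. i \<notin> set h \<longrightarrow> d' i = d i) \<and>
    frame t R h d = frame t R h' d' \<and> frame t S h d = frame t S h' d'"
  using assms(2-)
proof (induction h' arbitrary: h d)
  case (Cons a h')
  then obtain u v where h: "h = u @ a # v" by (metis list.set_intros(1) split_list)
  have sets: "set (u @ v) = set h'"
    using Cons.prems(1-3) h by auto
  have RS: "R a l = S a l \<and> R l a = S l a" if "l \<in> set u" for l
  proof -
    have "P l a" using that Cons.prems(6) by (auto simp: h sorted_wrt_append)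
    moreover have "P' a l" using that Cons.prems(7) sets by auto
    ultimately show ?thesis using Cons.prems(8)[of l a] that h by auto
  qed
  obtain d1 where d1: "\<forall>i. i \<notin> set h \<longrightarrow> d1 i = d i"
    "frame t R h d = frame t R (a # u @ v) d1" "frame t S h d = frame t S (a # u @ v) d1"
    using frames_rotate[OF t, of u a v R S d] Cons.prems RS unfolding h by blast
  have "\<exists>d'. (\<forall>i. i \<notin> set (u @ v) \<longrightarrow> d' i = d1 i) \<and>
    frame t R (u @ v) d1 = frame t R h' d' \<and> frame t S (u @ v) d1 = frame t S h' d'"
  proof (rule Cons.IH)
    show "strict_linear_on (set (u @ v)) R" "strict_linear_on (set (u @ v)) S"
      using Cons.prems(4,5) by (auto simp: h elim!: strict_linear_on_subset)
    show "sorted_wrt P (u @ v)" "sorted_wrt P' h'"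
      using Cons.prems(6,7) by (auto simp: h sorted_wrt_append)
  qed (use Cons.prems h sets in auto)
  then obtain d2 where "\<forall>i. i \<notin> set (u @ v) \<longrightarrow> d2 i = d1 i"
    "frame t R (u @ v) d1 = frame t R h' d2" "frame t S (u @ v) d1 = frame t S h' d2"
    by blast
  moreover have "{i \<in> set (u @ v). Q i a} = {i \<in> set h'. Q i a}" for Q
    using sets by blast
  ultimately show ?case
    using d1 sets h by (intro exI[of _ d2]) (simp del: set_append, auto)
qed auto

lemma transport_reorder:
  assumes t: "t \<noteq> 0" and h: "distinct h" "distinct h'" "set h = set h'"
    and "strict_linear_on (set h) R" "strict_linear_on (set h) S"
    and "sorted_wrt P h" "sorted_wrt P' h'"
    and "\<And>i j. i \<in> set h \<Longrightarrow> j \<in> set h \<Longrightarrow> P i j \<Longrightarrow> P' j i \<Longrightarrow> R i j = S i j \<and> R j i = S j i"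
  shows "transport t R S h k = transport t R S h' k"
proof -
  obtain d' where "frame t R h (unframe t R h k) = frame t R h' d'"
    "frame t S h (unframe t R h k) = frame t S h' d'"
    using frames_reorder[OF assms, of "unframe t R h k"] by blast
  then show ?thesis
    using t h by (simp add: transport_def frame_unframe) (metis unframe_frame)
qed

subsection \<open>An invariant functional\<close>

text \<open>The functional \<open>w\<close> of the overview, the powers of \<open>t\<close> being
  attached to the strands from left to right.\<close>

definition wsum :: "complex \<Rightarrow> ('l \<Rightarrow> 'l \<Rightarrow> bool) \<Rightarrow> 'l set \<Rightarrow> ('l \<Rightarrow> complex) \<Rightarrow> complex" where
  "wsum t R I k = (\<Sum>i\<in>I. t ^ card {l \<in> I. R l i} * k i)"

text \<open>The exponents are the ranks \<open>0, ..., n - 1\<close>, so this is a geometric series;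
  the factor \<open>1 - t\<close> avoids a division and keeps \<open>t = 1\<close> included.\<close>

lemma sum_initial_segment_ranks:
  assumes "finite I" "strict_linear_on I R"
  shows "(1 - t) * (\<Sum>i\<in>I. t ^ card {l \<in> I. R l i}) = 1 - (t :: complex) ^ card I"
  using assms
proof (induction "card I" arbitrary: I)
  case (Suc n)
  then have "I \<noteq> {}" by auto
  have "\<exists>m\<in>I. \<forall>i\<in>I. i \<noteq> m \<longrightarrow> R i m"
    using \<open>finite I\<close> \<open>I \<noteq> {}\<close> Suc.prems(2)
  proof (induction I rule: finite_ne_induct)
    case (insert a F)
    have "strict_linear_on F R" using insert.prems by (rule strict_linear_on_subset) auto
    from insert.IH[OF this] obtain m where m: "m \<in> F" "\<forall>i\<in>F. i \<noteq> m \<longrightarrow> R i m" by blast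
    show ?case
    proof (cases "R a m")
      case False
      then have ma: "R m a"
        using strict_linear_on_total[OF insert.prems, of a m] m(1) insert.hyps by blast
      have "R i a" if "i \<in> F" for i
      proof (cases "i = m")
        case False
        with m that have "R i m" by blast
        from strict_linear_on_trans[OF insert.prems this ma] m that show ?thesis by blast
      qed (use ma in simp)
      then show ?thesis by (intro bexI[of _ a]) auto
    qed (use m in blast)
  qed auto
  then obtain m where m: "m \<in> I" "\<And>i. i \<in> I \<Longrightarrow> i \<noteq> m \<Longrightarrow> R i m" by auto
  define J where "J = I - {m}"
  have I: "I = insert m J" "m \<notin> J" "finite J" using m Suc.prems by (auto simp: J_def)
  have cJ: "card J = n" using I Suc.hyps(2) by auto
  have "strict_linear_on J R" using Suc.prems(2) by (auto simp: J_def elim: strict_linear_on_subset)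
  then have IH: "(1 - t) * (\<Sum>i\<in>J. t ^ card {l \<in> J. R l i}) = 1 - t ^ card J"
    using Suc.hyps(1)[of J] cJ I by auto
  have "\<not> R m i" if "i \<in> J" for i
  proof
    assume "R m i"
    moreover have "i \<in> I" "R i m" using that m(2)[of i] I(2) by (auto simp: J_def)
    ultimately have "R m m" using strict_linear_on_trans[OF Suc.prems(2), of m i m] m(1) by blast
    with strict_linear_on_irrefl[OF Suc.prems(2) m(1)] show False ..
  qed
  then have "{l \<in> I. R l i} = {l \<in> J. R l i}" if "i \<in> J" for i
    using that by (auto simp: J_def)
  then have "(\<Sum>i\<in>J. t ^ card {l \<in> I. R l i}) = (\<Sum>i\<in>J. t ^ card {l \<in> J. R l i})"
    by (intro sum.cong refl) simp
  moreover have "{l \<in> I. R l m} = J"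
    using strict_linear_on_irrefl[OF Suc.prems(2) m(1)] m(2) by (auto simp: J_def)
  ultimately have "(\<Sum>i\<in>I. t ^ card {l \<in> I. R l i}) = t ^ card J + (\<Sum>i\<in>J. t ^ card {l \<in> J. R l i})"
    using sum.insert[OF I(3,2), of "\<lambda>i. t ^ card {l \<in> I. R l i}"] I(1) by simp
  then have "(1 - t) * (\<Sum>i\<in>I. t ^ card {l \<in> I. R l i}) = (1 - t) * t ^ card J + (1 - t ^ card J)"
    by (simp only: distrib_left IH)
  then show ?case using card_insert_disjoint[OF I(3,2)] I(1) by (simp add: algebra_simps)
qed auto

primrec hsum :: "complex \<Rightarrow> 'l list \<Rightarrow> ('l \<Rightarrow> complex) \<Rightarrow> complex" where
  "hsum t [] d = 0"
| "hsum t (a # h) d = d a + t * hsum t h d"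

text \<open>In normalized colours the functional becomes \<open>hsum\<close>, which weights by
  height and does not mention \<open>R\<close>. This is the source of its invariance under
  \<open>transport\<close>.\<close>

lemma wsum_frame:
  assumes "distinct h" "strict_linear_on (set h) R"
  shows "wsum t R (set h) (frame t R h d) = hsum t h d"
  using assms
proof (induction h)
  case (Cons a h)
  define k where "k = frame t R h d"
  define A where "A = {i \<in> set h. R i a}"
  define B where "B = {i \<in> set h. \<not> R i a}"
  define pos where "pos i = card {l \<in> set h. R l i}" for i
  have lin: "strict_linear_on (set h) R" "strict_linear_on A R"
    using Cons.prems by (auto simp: A_def elim!: strict_linear_on_subset)
  then have IH: "wsum t R (set h) k = hsum t h d"
    using Cons by (simp add: k_def)
  have AB: "set h = A \<union> B" "A \<inter> B = {}" "finite A" "finite B" "a \<notin> A" "a \<notin> B"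
    using Cons.prems(1) by (auto simp: A_def B_def)
  have ka: "k a = d a" using Cons.prems(1) by (simp add: k_def frame_outside)
  have RB: "R a i" if "i \<in> B" for i
    using that Cons.prems unfolding B_def strict_linear_on_def by (metis (mono_tags, lifting) distinct.simps(2) list.set_intros mem_Collect_eq)
  have nA: "\<not> R a i" if "i \<in> A" for i
    using that Cons.prems unfolding A_def strict_linear_on_def by (metis (mono_tags, lifting) list.set_intros mem_Collect_eq)
  have pB: "card {l \<in> set (a # h). R l i} = Suc (pos i)" if "i \<in> B" for i
  proof -
    have "{l \<in> set (a # h). R l i} = insert a {l \<in> set h. R l i}" using RB[OF that] by auto
    then show ?thesis using Cons.prems(1) by (simp add: pos_def)
  qed
  have pA: "card {l \<in> set (a # h). R l i} = pos i" if "i \<in> A" for i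
    using nA[OF that] by (auto simp: pos_def intro!: arg_cong[where f = card])
  have pa: "card {l \<in> set (a # h). R l a} = card A"
    using Cons.prems(2) unfolding A_def strict_linear_on_def by (auto intro!: arg_cong[where f = card])
  have posA: "pos i = card {l \<in> A. R l i}" if "i \<in> A" for i
  proof -
    have "R l a" if "l \<in> set h" "R l i" for l
      using that \<open>i \<in> A\<close> Cons.prems(2) unfolding A_def strict_linear_on_def
      by (metis (mono_tags, lifting) list.set_intros mem_Collect_eq)
    then show ?thesis by (auto simp: pos_def A_def intro!: arg_cong[where f = card])
  qed
  have sumA: "(1 - t) * (\<Sum>i\<in>A. t ^ pos i) = 1 - t ^ card A"
    using sum_initial_segment_ranks[OF AB(3) lin(2), of t] posA by (simp cong: sum.cong)
  have "wsum t R (set (a # h)) (frame t R (a # h) d)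
      = (\<Sum>i\<in>insert a (A \<union> B). t ^ card {l \<in> set (a # h). R l i} * slide t A a k i)"
    using AB(1) by (simp add: wsum_def k_def A_def)
  also have "\<dots> = t ^ card A * k a + (\<Sum>i\<in>A. t ^ pos i * (t * k i + (1 - t) * k a))
      + (\<Sum>i\<in>B. t ^ Suc (pos i) * k i)"
  proof -
    have "(\<Sum>i\<in>A. t ^ card {l \<in> set (a # h). R l i} * slide t A a k i)
      = (\<Sum>i\<in>A. t ^ pos i * (t * k i + (1 - t) * k a))"
      by (intro sum.cong refl) (simp only: pA slide_def if_True)
    moreover have "(\<Sum>i\<in>B. t ^ card {l \<in> set (a # h). R l i} * slide t A a k i)
      = (\<Sum>i\<in>B. t ^ Suc (pos i) * k i)"
      using AB(2) by (intro sum.cong refl) (simp only: pB slide_def, auto)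
    moreover have "slide t A a k a = k a" using AB by (simp add: slide_def)
    ultimately show ?thesis
      using AB pa by (simp add: sum.union_disjoint)
  qed
  \<comment> \<open>The colour of \<open>a\<close> leaks into the points to its left. By the
    geometric series the leaked amounts add up to \<open>(1 - t ^ card A) * k a\<close> and complete
    \<open>t ^ card A * k a\<close> to \<open>k a\<close>, the first summand of
    \<open>hsum\<close>.\<close>
  also have "(\<Sum>i\<in>A. t ^ pos i * (t * k i + (1 - t) * k a))
      = t * (\<Sum>i\<in>A. t ^ pos i * k i) + ((1 - t) * (\<Sum>i\<in>A. t ^ pos i)) * k a"
    by (simp add: sum_distrib_left sum_distrib_right sum.distrib algebra_simps sum_subtractf)
  also have "(\<Sum>i\<in>B. t ^ Suc (pos i) * k i) = t * (\<Sum>i\<in>B. t ^ pos i * k i)"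
    by (simp add: sum_distrib_left algebra_simps)
  also have "t ^ card A * k a + (t * (\<Sum>i\<in>A. t ^ pos i * k i) + ((1 - t) * (\<Sum>i\<in>A. t ^ pos i)) * k a)
      + t * (\<Sum>i\<in>B. t ^ pos i * k i) = k a + t * wsum t R (set h) k"
    unfolding sumA using AB by (simp add: wsum_def pos_def sum.union_disjoint algebra_simps)
  finally show ?case using IH ka by simp
qed (simp add: wsum_def)

lemma wsum_transport:
  assumes "t \<noteq> 0" "distinct h" "strict_linear_on (set h) R" "strict_linear_on (set h) S"
  shows "wsum t S (set h) (transport t R S h k) = wsum t R (set h) k"
  using wsum_frame[OF assms(2,3), of t "unframe t R h k"] wsum_frame[OF assms(2,4), of t "unframe t R h k"]
  by (simp add: transport_def frame_unframe assms(1,2))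

lemma wsum_1:
  assumes "finite I" "strict_linear_on I R"
  shows "(1 - t) * wsum t R I (\<lambda>_. 1) = 1 - t ^ card I"
  using sum_initial_segment_ranks[OF assms] by (simp add: wsum_def)

subsection \<open>Rigidity of families of operators of finite order\<close>

text \<open>Colourings are functions on the whole type, but only the entries indexed by
  \<open>I\<close> matter, so operators are compared with matrices on \<open>I\<close> alone. Using
  the angle \<theta> instead of \<open>cis \<theta>\<close> makes the parameter space the connected
  real line.\<close>

definition matrix_rep ::
    "'l set \<Rightarrow> (real \<Rightarrow> ('l \<Rightarrow> complex) \<Rightarrow> 'l \<Rightarrow> complex) \<Rightarrow> (real \<Rightarrow> 'l \<Rightarrow> 'l \<Rightarrow> complex) \<Rightarrow> bool" where
  "matrix_rep I L a \<longleftrightarrow> (\<forall>i\<in>I. \<forall>j\<in>I. continuous_on UNIV (\<lambda>\<theta>. a \<theta> i j)) \<and>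
     (\<forall>\<theta> k. \<forall>i\<in>I. L \<theta> k i = (\<Sum>j\<in>I. a \<theta> i j * k j))"

definition matrix_family :: "'l set \<Rightarrow> (real \<Rightarrow> ('l \<Rightarrow> complex) \<Rightarrow> 'l \<Rightarrow> complex) \<Rightarrow> bool" where
  "matrix_family I L \<longleftrightarrow> (\<exists>a. matrix_rep I L a)"

lemma matrix_rep_continuous:
  "matrix_rep I L a \<Longrightarrow> i \<in> I \<Longrightarrow> j \<in> I \<Longrightarrow> continuous_on UNIV (\<lambda>\<theta>. a \<theta> i j)"
  by (simp add: matrix_rep_def)

lemma matrix_rep_eq: "matrix_rep I L a \<Longrightarrow> i \<in> I \<Longrightarrow> L \<theta> k i = (\<Sum>j\<in>I. a \<theta> i j * k j)"
  by (simp add: matrix_rep_def)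

lemma matrix_familyI:
  assumes "\<And>i j. i \<in> I \<Longrightarrow> j \<in> I \<Longrightarrow> continuous_on UNIV (\<lambda>\<theta>. a \<theta> i j)"
    "\<And>\<theta> k i. i \<in> I \<Longrightarrow> L \<theta> k i = (\<Sum>j\<in>I. a \<theta> i j * k j)"
  shows "matrix_family I L"
  unfolding matrix_family_def matrix_rep_def by (rule exI[of _ a]) (simp add: assms(1) assms(2))

lemma matrix_family_id:
  assumes "finite I"
  shows "matrix_family I (\<lambda>\<theta> k. k)"
  by (rule matrix_familyI[where a = "\<lambda>\<theta> i j. if i = j then 1 else 0"])
     (use assms in \<open>auto simp: if_distrib[of "\<lambda>x. x * _"] cong: if_cong\<close>)

lemma matrix_family_compose:
  assumes "finite I" "matrix_family I L" "matrix_family I L'"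
  shows "matrix_family I (\<lambda>\<theta> k. L \<theta> (L' \<theta> k))"
proof -
  obtain a where a: "matrix_rep I L a"
    using assms(2) unfolding matrix_family_def by blast
  obtain b where b: "matrix_rep I L' b"
    using assms(3) unfolding matrix_family_def by blast
  show ?thesis
  proof (rule matrix_familyI[where a = "\<lambda>\<theta> i j. \<Sum>l\<in>I. a \<theta> i l * b \<theta> l j"])
    show "continuous_on UNIV (\<lambda>\<theta>. \<Sum>l\<in>I. a \<theta> i l * b \<theta> l j)" if "i \<in> I" "j \<in> I" for i j
      using that by (intro continuous_on_sum continuous_on_mult matrix_rep_continuous[OF a] matrix_rep_continuous[OF b])
  next
    fix \<theta> k i assume i: "i \<in> I"
    have "L \<theta> (L' \<theta> k) i = (\<Sum>l\<in>I. \<Sum>j\<in>I. a \<theta> i l * b \<theta> l j * k j)"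
      using i by (simp add: matrix_rep_eq[OF a] matrix_rep_eq[OF b] sum_distrib_left mult.assoc)
    also have "\<dots> = (\<Sum>j\<in>I. \<Sum>l\<in>I. a \<theta> i l * b \<theta> l j * k j)" by (rule sum.swap)
    finally show "L \<theta> (L' \<theta> k) i = (\<Sum>j\<in>I. (\<Sum>l\<in>I. a \<theta> i l * b \<theta> l j) * k j)"
      by (simp add: sum_distrib_right)
  qed
qed

lemma matrix_family_funpow:
  assumes "finite I" "matrix_family I L"
  shows "matrix_family I (\<lambda>\<theta>. L \<theta> ^^ n)"
proof (induction n)
  case 0
  then show ?case using matrix_family_id[OF assms(1)] by (simp add: id_def)
next
  case (Suc n)
  then show ?case using matrix_family_compose[OF assms Suc] by (simp add: o_def)
qed

lemma matrix_family_sum: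
  fixes m :: nat
  assumes "\<And>n. n < m \<Longrightarrow> matrix_family I (L n)"
  shows "matrix_family I (\<lambda>\<theta> k i. \<Sum>n<m. L n \<theta> k i)"
proof -
  have "\<forall>n\<in>{..<m}. \<exists>a. matrix_rep I (L n) a"
    using assms by (simp add: matrix_family_def)
  then obtain a where a: "\<And>n. n \<in> {..<m} \<Longrightarrow> matrix_rep I (L n) (a n)"
    by (meson bchoice)
  show ?thesis
  proof (rule matrix_familyI[where a = "\<lambda>\<theta> i j. \<Sum>n<m. a n \<theta> i j"])
    show "continuous_on UNIV (\<lambda>\<theta>. \<Sum>n<m. a n \<theta> i j)" if "i \<in> I" "j \<in> I" for i j
      using that by (intro continuous_on_sum matrix_rep_continuous[OF a])
  next
    fix \<theta> k i assume i: "i \<in> I"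
    have "(\<Sum>n<m. L n \<theta> k i) = (\<Sum>n<m. \<Sum>j\<in>I. a n \<theta> i j * k j)"
      by (intro sum.cong refl matrix_rep_eq[OF a] i)
    also have "\<dots> = (\<Sum>j\<in>I. \<Sum>n<m. a n \<theta> i j * k j)" by (rule sum.swap)
    finally show "(\<Sum>n<m. L n \<theta> k i) = (\<Sum>j\<in>I. (\<Sum>n<m. a n \<theta> i j) * k j)"
      by (simp add: sum_distrib_right)
  qed
qed

lemma matrix_family_slide:
  assumes "finite I" "a \<in> I" "continuous_on UNIV \<tau>"
  shows "matrix_family I (\<lambda>\<theta>. slide (\<tau> \<theta>) U a)"
proof (rule matrix_familyI)
  let ?m = "\<lambda>\<theta> i j. if i \<in> U then (if j = i then \<tau> \<theta> else 0) + (if j = a then 1 - \<tau> \<theta> else 0)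
    else if j = i then 1 else 0"
  show "slide (\<tau> \<theta>) U a k i = (\<Sum>j\<in>I. ?m \<theta> i j * k j)" if "i \<in> I" for \<theta> k i
    using assms that
    by (auto simp: slide_def distrib_right sum.distrib if_distrib[of "\<lambda>x. x * _"] cong: if_cong)
  show "continuous_on UNIV (\<lambda>\<theta>. ?m \<theta> i j)" for i j
    using assms(3) by (cases "i \<in> U"; cases "j = i"; cases "j = a") (simp_all add: continuous_on_diff)
qed

lemma matrix_family_permute:
  assumes "finite I" "\<pi> \<in> I \<rightarrow> I"
  shows "matrix_family I (\<lambda>\<theta> k. k \<circ> \<pi>)"
  by (rule matrix_familyI[where a = "\<lambda>\<theta> i j. if j = \<pi> i then 1 else 0"])
     (use assms in \<open>auto simp: if_distrib[of "\<lambda>x. x * _"] Pi_iff cong: if_cong\<close>)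

lemma matrix_family_frame:
  assumes "finite I" "set h \<subseteq> I"
  shows "matrix_family I (\<lambda>\<theta>. frame (cis \<theta>) R h)"
  using assms(2)
proof (induction h)
  case (Cons a h)
  have "matrix_family I (\<lambda>\<theta>. slide (cis \<theta>) {i \<in> set h. R i a} a)"
    using Cons.prems by (intro matrix_family_slide[OF assms(1)] continuous_on_cis continuous_on_id) auto
  moreover have "matrix_family I (\<lambda>\<theta>. frame (cis \<theta>) R h)"
    using Cons by auto
  ultimately show ?case
    using matrix_family_compose[OF assms(1)] by fastforce
next
  case Nil
  have "(\<lambda>\<theta>. frame (cis \<theta>) R []) = (\<lambda>\<theta> k. k)" by (simp add: fun_eq_iff)
  then show ?case using matrix_family_id[OF assms(1)] by simp
qed

lemma matrix_family_unframe:
  assumes "finite I" "set h \<subseteq> I"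
  shows "matrix_family I (\<lambda>\<theta>. unframe (cis \<theta>) R h)"
  using assms(2)
proof (induction h)
  case (Cons a h)
  have "continuous_on UNIV (\<lambda>\<theta>. 1 / cis \<theta>)"
    by (intro continuous_on_divide continuous_on_const continuous_on_cis continuous_on_id) auto
  then have "matrix_family I (\<lambda>\<theta>. slide (1 / cis \<theta>) {i \<in> set h. R i a} a)"
    using Cons.prems by (intro matrix_family_slide[OF assms(1)]) auto
  moreover have "matrix_family I (\<lambda>\<theta>. unframe (cis \<theta>) R h)"
    using Cons by auto
  ultimately show ?case
    using matrix_family_compose[OF assms(1)] by fastforce
next
  case Nil
  have "(\<lambda>\<theta>. unframe (cis \<theta>) R []) = (\<lambda>\<theta> k. k)" by (simp add: fun_eq_iff)
  then show ?case using matrix_family_id[OF assms(1)] by simp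
qed

lemma matrix_family_transport:
  assumes "finite I" "set h \<subseteq> I"
  shows "matrix_family I (\<lambda>\<theta>. transport (cis \<theta>) R S h)"
  using matrix_family_compose[OF assms(1) matrix_family_frame[OF assms, of S] matrix_family_unframe[OF assms, of R]]
  by (simp add: transport_def[abs_def])

text \<open>Up to the factor \<open>m\<close> the averages are a continuous family of projections
  onto the invariants, whose rank cannot jump. In place of ranks, the set of good parameters is
  shown to be clopen: closed by continuity, and open because, for \<theta> near a good \<theta>0, an
  invariant vector of \<open>L \<theta>\<close> that is annihilated by the average at \<theta>0
  vanishes.\<close>

lemma invariants_constant:
  fixes L :: "real \<Rightarrow> ('l \<Rightarrow> complex) \<Rightarrow> 'l \<Rightarrow> complex"
  assumes I: "finite I" "I \<noteq> {}" and L: "matrix_family I L" and m: "0 < m"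
    and fix_const: "\<And>\<theta> c i. i \<in> I \<Longrightarrow> L \<theta> (\<lambda>_. c) i = c"
    and order: "\<And>\<theta> k i. i \<in> I \<Longrightarrow> (L \<theta> ^^ m) k i = k i"
    and start: "\<And>k i j. i \<in> I \<Longrightarrow> j \<in> I \<Longrightarrow>
      (\<Sum>n<m. (L 0 ^^ n) k i) = (\<Sum>n<m. (L 0 ^^ n) k j)"
  shows "i \<in> I \<Longrightarrow> j \<in> I \<Longrightarrow> (\<Sum>n<m. (L \<theta> ^^ n) k i) = (\<Sum>n<m. (L \<theta> ^^ n) k j)"
proof -
  define avg where "avg \<theta> k i = (\<Sum>n<m. (L \<theta> ^^ n) k i)" for \<theta> k i
  define good where "good = {\<theta>. \<forall>k. \<forall>i\<in>I. \<forall>j\<in>I. avg \<theta> k i = avg \<theta> k j}"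
  have "matrix_family I avg"
    unfolding avg_def by (intro matrix_family_sum matrix_family_funpow I(1) L)
  then obtain A where A: "matrix_rep I avg A"
    unfolding matrix_family_def by blast
  note A_eq = matrix_rep_eq[OF A] and A_cont = matrix_rep_continuous[OF A]
  obtain b where b: "matrix_rep I L b"
    using L unfolding matrix_family_def by blast
  note b_eq = matrix_rep_eq[OF b]
  have L_avg: "L \<theta> (avg \<theta> k) i = avg \<theta> k i" if "i \<in> I" for \<theta> k i
  proof -
    have "L \<theta> (avg \<theta> k) i = (\<Sum>n<m. (\<Sum>j\<in>I. b \<theta> i j * (L \<theta> ^^ n) k j))"
      using that by (simp add: b_eq avg_def sum_distrib_left) (rule sum.swap)
    also have "\<dots> = (\<Sum>n<m. (L \<theta> ^^ Suc n) k i)"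
      using that by (simp add: b_eq)
    also have "\<dots> + (L \<theta> ^^ 0) k i = (\<Sum>n<Suc m. (L \<theta> ^^ n) k i)"
      by (simp only: sum.lessThan_Suc_shift add.commute)
    also have "\<dots> = avg \<theta> k i + (L \<theta> ^^ m) k i"
      by (simp add: avg_def)
    finally show ?thesis using order[OF that, of \<theta> k] by simp
  qed
  have avg_fixed: "avg \<theta> y i = of_nat m * y i" if y: "\<And>i. i \<in> I \<Longrightarrow> L \<theta> y i = y i" and "i \<in> I" for \<theta> y i
  proof -
    have "\<forall>i\<in>I. (L \<theta> ^^ n) y i = y i" for n
    proof (induction n)
      case (Suc n)
      have "L \<theta> ((L \<theta> ^^ n) y) i = L \<theta> y i" if "i \<in> I" for i
        using that Suc by (simp add: b_eq)
      with y show ?case by simp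
    qed auto
    with that show ?thesis by (simp add: avg_def)
  qed
  have "closed good"
  proof -
    have "closed {\<theta>. avg \<theta> k i = avg \<theta> k j}" if "i \<in> I" "j \<in> I" for k i j
      using that by (intro closed_Collect_eq) (simp_all add: A_eq continuous_on_sum continuous_on_mult A_cont)
    then have "closed (\<Inter>k. \<Inter>i\<in>I. \<Inter>j\<in>I. {\<theta>. avg \<theta> k i = avg \<theta> k j})"
      by (intro closed_INT ballI)
    also have "(\<Inter>k. \<Inter>i\<in>I. \<Inter>j\<in>I. {\<theta>. avg \<theta> k i = avg \<theta> k j}) = good"
      by (auto simp: good_def)
    finally show ?thesis .
  qed
  moreover have "open good"
    unfolding open_dist
  proof
    fix \<theta>0 assume \<theta>0: "\<theta>0 \<in> good"
    \<comment> \<open>Entries below \<open>1 / card I\<close> make the difference of the two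
      averaging matrices a strict contraction in the maximum norm.\<close>
    have "\<forall>\<^sub>F \<theta> in nhds \<theta>0. \<forall>i\<in>I. \<forall>j\<in>I. dist (A \<theta> i j) (A \<theta>0 i j) < 1 / real (card I)"
    proof (intro eventually_ball_finite I(1) ballI)
      fix i j assume "i \<in> I" "j \<in> I"
      then have "isCont (\<lambda>\<theta>. A \<theta> i j) \<theta>0"
        using A_cont[of i j] by (simp add: continuous_on_eq_continuous_at)
      then have "((\<lambda>\<theta>. A \<theta> i j) \<longlongrightarrow> A \<theta>0 i j) (nhds \<theta>0)"
        by (simp add: isCont_def tendsto_nhds_iff)
      then show "\<forall>\<^sub>F \<theta> in nhds \<theta>0. dist (A \<theta> i j) (A \<theta>0 i j) < 1 / real (card I)"
        by (rule tendstoD) (use I in \<open>simp add: card_gt_0_iff\<close>)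
    qed
    then obtain \<epsilon> where \<epsilon>: "\<epsilon> > 0"
      "\<And>\<theta> i j. dist \<theta> \<theta>0 < \<epsilon> \<Longrightarrow> i \<in> I \<Longrightarrow> j \<in> I \<Longrightarrow> dist (A \<theta> i j) (A \<theta>0 i j) < 1 / real (card I)"
      unfolding eventually_nhds_metric by blast
    have "\<theta> \<in> good" if near: "dist \<theta> \<theta>0 < \<epsilon>" for \<theta>
      unfolding good_def
    proof (intro CollectI allI)
      fix k
      define x where "x = avg \<theta> k"
      obtain i0 where i0: "i0 \<in> I" using I by auto
      \<comment> \<open>Chosen so that \<open>avg \<theta>0\<close> annihilates
        \<open>y = x - c\<close>. Constants are invariant, so \<open>y\<close> is invariant under
        \<open>L \<theta>\<close> just as \<open>x\<close> is.\<close>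
      define c where "c = avg \<theta>0 x i0 / of_nat m"
      define y where "y i = x i - c" for i
      have mc: "avg \<theta>0 x i = of_nat m * c" if "i \<in> I" for i
      proof -
        have "avg \<theta>0 x i = avg \<theta>0 x i0" using \<theta>0 that i0 unfolding good_def by blast
        with m show ?thesis by (simp add: c_def)
      qed
      have avg_diff: "avg \<theta>' y i = avg \<theta>' x i - of_nat m * c" if "i \<in> I" for \<theta>' i
      proof -
        have "avg \<theta>' (\<lambda>_. c) i = of_nat m * c"
          by (rule avg_fixed[OF fix_const that])
        with that show ?thesis
          by (simp add: A_eq y_def right_diff_distrib sum_subtractf)
      qed
      have y0: "avg \<theta>0 y i = 0" if "i \<in> I" for i
        using avg_diff[OF that, of \<theta>0] mc[OF that] by simp
      have y1: "avg \<theta> y i = of_nat m * y i" if "i \<in> I" for i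
        using avg_diff[OF that, of \<theta>] avg_fixed[of \<theta> x, OF _ that] L_avg
        by (simp add: y_def x_def right_diff_distrib)
      define M where "M = Max ((\<lambda>i. norm (y i)) ` I)"
      have M: "norm (y i) \<le> M" if "i \<in> I" for i
        using that I by (simp add: M_def)
      have "M \<in> (\<lambda>i. norm (y i)) ` I"
        unfolding M_def using I by (intro Max_in) auto
      then obtain l where l: "l \<in> I" "norm (y l) = M" by auto
      have "M = 0"
      proof (rule ccontr)
        assume "M \<noteq> 0"
        then have "M > 0" using l(2) by (metis norm_ge_zero order_le_less)
        \<comment> \<open>Now \<open>m y = (avg \<theta> - avg \<theta>0) y\<close>, so the largest
          entry would satisfy \<open>M \<le> m M < M\<close>.\<close>
        have "M \<le> norm (of_nat m * y l)"
        proof -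
          have "1 * M \<le> real m * M" using m \<open>M > 0\<close> by (intro mult_right_mono) auto
          then show ?thesis using l(2) by (simp add: norm_mult)
        qed
        also have "of_nat m * y l = (\<Sum>j\<in>I. (A \<theta> l j - A \<theta>0 l j) * y j)"
          using y0[OF l(1)] y1[OF l(1)] l(1) by (simp add: A_eq left_diff_distrib sum_subtractf)
        also have "norm \<dots> \<le> (\<Sum>j\<in>I. norm ((A \<theta> l j - A \<theta>0 l j) * y j))"
          by (rule norm_sum)
        also have "\<dots> < (\<Sum>j\<in>I. 1 / real (card I) * M)"
        proof (rule sum_strict_mono[OF I])
          fix j assume j: "j \<in> I"
          have "norm (A \<theta> l j - A \<theta>0 l j) < 1 / real (card I)"
            using \<epsilon>(2)[OF near l(1) j] by (simp add: dist_norm)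
          then show "norm ((A \<theta> l j - A \<theta>0 l j) * y j) < 1 / real (card I) * M"
            unfolding norm_mult using M[OF j] \<open>M > 0\<close>
            by (smt (verit, best) mult_left_mono mult_strict_right_mono norm_ge_zero)
        qed
        also have "\<dots> = M" using I by (simp add: card_gt_0_iff)
        finally show False by simp
      qed
      then have "y i = 0" if "i \<in> I" for i using M[OF that] by simp
      then have "x i = c" if "i \<in> I" for i using that by (simp add: y_def)
      then show "\<forall>i\<in>I. \<forall>j\<in>I. avg \<theta> k i = avg \<theta> k j" by (simp add: x_def)
    qed
    with \<epsilon>(1) show "\<exists>e>0. \<forall>y. dist y \<theta>0 < e \<longrightarrow> y \<in> good" by blast
  qed
  moreover have "0 \<in> good" unfolding good_def avg_def using start by blast
  ultimately have "good = UNIV" using clopen[of good] by auto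
  then show "(\<Sum>n<m. (L \<theta> ^^ n) k i) = (\<Sum>n<m. (L \<theta> ^^ n) k j)" if "i \<in> I" "j \<in> I"
    using that by (auto simp: good_def avg_def)
qed

subsection \<open>Parallel transport along moving points of the plane\<close>

text \<open>Lexicographic, so that distinct points are always comparable and vertically aligned
  points need no perturbation.\<close>

definition left_of :: "('l \<Rightarrow> complex) \<Rightarrow> 'l \<Rightarrow> 'l \<Rightarrow> bool" where
  "left_of r i j \<longleftrightarrow> Re (r i) < Re (r j) \<or> Re (r i) = Re (r j) \<and> Im (r i) < Im (r j)"

text \<open>Points of equal height are ordered by an arbitrary choice;
  \<open>step_height_list\<close> shows that this is immaterial for small moves.\<close>

definition height_list :: "'l set \<Rightarrow> ('l \<Rightarrow> complex) \<Rightarrow> 'l list" where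
  "height_list I r = sort_key (\<lambda>i. Im (r i)) (SOME xs. distinct xs \<and> set xs = I)"

definition step :: "complex \<Rightarrow> 'l set \<Rightarrow> ('l \<Rightarrow> complex) \<Rightarrow> ('l \<Rightarrow> complex) \<Rightarrow> ('l \<Rightarrow> complex) \<Rightarrow> 'l \<Rightarrow> complex" where
  "step t I r s = transport t (left_of r) (left_of s) (height_list I r)"

primrec steps :: "complex \<Rightarrow> 'l set \<Rightarrow> (nat \<Rightarrow> 'l \<Rightarrow> complex) \<Rightarrow> nat \<Rightarrow> ('l \<Rightarrow> complex) \<Rightarrow> 'l \<Rightarrow> complex" where
  "steps t I c 0 k = k"
| "steps t I c (Suc n) k = step t I (c n) (c (Suc n)) (steps t I c n k)"

lemma height_list:
  assumes "finite I"
  shows "distinct (height_list I r)" "set (height_list I r) = I"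
    "sorted_wrt (\<lambda>i j. Im (r i) \<le> Im (r j)) (height_list I r)"
proof -
  have "distinct (SOME xs. distinct xs \<and> set xs = I) \<and> set (SOME xs. distinct xs \<and> set xs = I) = I"
    by (rule someI_ex) (use finite_distinct_list[OF assms] in blast)
  then show "distinct (height_list I r)" "set (height_list I r) = I"
    by (simp_all add: height_list_def)
  have "sorted (map (\<lambda>i. Im (r i)) (height_list I r))"
    by (simp add: height_list_def)
  then show "sorted_wrt (\<lambda>i j. Im (r i) \<le> Im (r j)) (height_list I r)"
    by (simp add: sorted_wrt_map)
qed

lemma strict_linear_on_left_of:
  assumes "inj_on r I"
  shows "strict_linear_on I (left_of r)"
  unfolding strict_linear_on_def
proof (intro conjI ballI impI)
  show "left_of r i j \<or> left_of r j i" if "i \<in> I" "j \<in> I" "i \<noteq> j" for i j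
  proof -
    have "r i \<noteq> r j" using assms that by (auto dest: inj_onD)
    then show ?thesis unfolding left_of_def complex_eq_iff by linarith
  qed
qed (auto simp: left_of_def)

definition separated :: "real \<Rightarrow> 'l set \<Rightarrow> ('l \<Rightarrow> complex) \<Rightarrow> bool" where
  "separated \<delta> I r \<longleftrightarrow> (\<forall>i\<in>I. \<forall>j\<in>I. i \<noteq> j \<longrightarrow> \<delta> < norm (r i - r j))"

definition close :: "real \<Rightarrow> 'l set \<Rightarrow> ('l \<Rightarrow> complex) \<Rightarrow> ('l \<Rightarrow> complex) \<Rightarrow> bool" where
  "close \<epsilon> I r s \<longleftrightarrow> (\<forall>i\<in>I. norm (r i - s i) \<le> \<epsilon>)"

lemma close_refl: "0 \<le> \<epsilon> \<Longrightarrow> close \<epsilon> I r r"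
  by (simp add: close_def)

lemma close_sym: "close \<epsilon> I r s \<Longrightarrow> close \<epsilon> I s r"
  by (simp add: close_def norm_minus_commute)

lemma separated_inj_on: "separated \<delta> I r \<Longrightarrow> 0 \<le> \<delta> \<Longrightarrow> inj_on r I"
  by (rule inj_onI) (force simp: separated_def)

text \<open>
  Two points which exchange their horizontal order in a small move are far apart vertically, so
  that nearby configurations agree on which of them is lower.
\<close>

lemma step_height_list:
  assumes I: "finite I" and \<epsilon>: "0 \<le> \<epsilon>" and t: "t \<noteq> 0"
    and sep: "separated (4 * \<epsilon>) I r" "separated (4 * \<epsilon>) I s"
    and rs: "close \<epsilon> I r s" and rp: "close \<epsilon> I r p"
    and h: "distinct h" "set h = I" "sorted_wrt (\<lambda>i j. Im (p i) \<le> Im (p j)) h"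
  shows "step t I r s = transport t (left_of r) (left_of s) h"
proof
  fix k
  have "transport t (left_of r) (left_of s) (height_list I r) k = transport t (left_of r) (left_of s) h k"
  proof (rule transport_reorder[OF t])
    show "strict_linear_on (set (height_list I r)) (left_of r)" "strict_linear_on (set (height_list I r)) (left_of s)"
      using separated_inj_on[OF sep(1)] separated_inj_on[OF sep(2)] \<epsilon>
      by (simp_all add: strict_linear_on_left_of height_list[OF I])
  next
    fix i j
    assume ij: "i \<in> set (height_list I r)" "j \<in> set (height_list I r)" and le: "Im (r i) \<le> Im (r j)" "Im (p j) \<le> Im (p i)"
    then have mem: "i \<in> I" "j \<in> I" by (simp_all add: height_list[OF I])
    have n: "norm (r i - s i) \<le> \<epsilon>" "norm (r j - s j) \<le> \<epsilon>" "norm (r i - p i) \<le> \<epsilon>" "norm (r j - p j) \<le> \<epsilon>"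
      using rs rp mem by (auto simp: close_def)
    have im: "\<bar>Im (r i) - Im (p i)\<bar> \<le> \<epsilon>" "\<bar>Im (r j) - Im (p j)\<bar> \<le> \<epsilon>"
      using n(3,4) abs_Im_le_cmod[of "r i - p i"] abs_Im_le_cmod[of "r j - p j"] by auto
    have re: "\<bar>Re (r i) - Re (s i)\<bar> \<le> \<epsilon>" "\<bar>Re (r j) - Re (s j)\<bar> \<le> \<epsilon>"
      using n(1,2) abs_Re_le_cmod[of "r i - s i"] abs_Re_le_cmod[of "r j - s j"] by auto
    show "left_of r i j = left_of s i j \<and> left_of r j i = left_of s j i"
    proof (cases "i = j")
      case False
      \<comment> \<open>Origin of the constant 4: conflicting heights leave a vertical distance of
        at most \<open>2 * \<epsilon>\<close>, hence a horizontal distance above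
        \<open>2 * \<epsilon>\<close>, which two displacements of at most \<epsilon> cannot
        reverse.\<close>
      have "4 * \<epsilon> < norm (r i - r j)" using sep(1) mem False by (simp add: separated_def)
      also have "\<dots> \<le> \<bar>Re (r i) - Re (r j)\<bar> + \<bar>Im (r i) - Im (r j)\<bar>"
        using cmod_le[of "r i - r j"] by simp
      finally have "2 * \<epsilon> < \<bar>Re (r i) - Re (r j)\<bar>" using im le by linarith
      with re show ?thesis unfolding left_of_def by linarith
    qed (simp add: left_of_def)
  qed (use h height_list[OF I] in auto)
  then show "step t I r s k = transport t (left_of r) (left_of s) h k"
    by (simp add: step_def)
qed

text \<open>All four steps may be computed with the heights of \<open>r\<close>; both sides are then
  the single transport from \<open>left_of r\<close> to \<open>left_of s'\<close>.\<close>

lemma step_square: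
  assumes I: "finite I" and \<epsilon>: "0 \<le> \<epsilon>" and t: "t \<noteq> 0"
    and sep: "separated (4 * \<epsilon>) I r" "separated (4 * \<epsilon>) I s" "separated (4 * \<epsilon>) I r'" "separated (4 * \<epsilon>) I s'"
    and close: "close \<epsilon> I r s" "close \<epsilon> I r r'" "close \<epsilon> I s s'" "close \<epsilon> I r' s'"
  shows "step t I s s' (step t I r s k) = step t I r' s' (step t I r r' k)"
proof -
  let ?h = "height_list I r"
  note eq = step_height_list[OF I \<epsilon> t _ _ _ _ height_list(1,2,3)[OF I, of r]]
  have "step t I r s = transport t (left_of r) (left_of s) ?h" "step t I r r' = transport t (left_of r) (left_of r') ?h"
    by (simp_all add: step_def)
  moreover have "step t I s s' = transport t (left_of s) (left_of s') ?h"
    using sep close by (intro eq) (auto intro: close_sym)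
  moreover have "step t I r' s' = transport t (left_of r') (left_of s') ?h"
    using sep close by (intro eq) (auto intro: close_sym)
  ultimately show ?thesis
    using transport_trans[OF t height_list(1)[OF I]] by metis
qed

lemma step_refl: "finite I \<Longrightarrow> t \<noteq> 0 \<Longrightarrow> step t I r r k = k"
  by (simp add: step_def transport_refl height_list)

text \<open>Discrete homotopy invariance: a ladder of squares between two neighbouring discrete
  paths.\<close>

lemma steps_homotopy:
  assumes I: "finite I" and \<epsilon>: "0 \<le> \<epsilon>" and t: "t \<noteq> 0"
    and sep: "\<And>a. a \<le> n \<Longrightarrow> separated (4 * \<epsilon>) I (c a)" "\<And>a. a \<le> n \<Longrightarrow> separated (4 * \<epsilon>) I (c' a)"
    and close: "\<And>a. a < n \<Longrightarrow> close \<epsilon> I (c a) (c (Suc a))" "\<And>a. a < n \<Longrightarrow> close \<epsilon> I (c' a) (c' (Suc a))"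
      "\<And>a. a \<le> n \<Longrightarrow> close \<epsilon> I (c a) (c' a)"
  shows "step t I (c n) (c' n) (steps t I c n k) = steps t I c' n (step t I (c 0) (c' 0) k)"
  using sep close
proof (induction n)
  case (Suc n)
  have "step t I (c (Suc n)) (c' (Suc n)) (step t I (c n) (c (Suc n)) (steps t I c n k))
      = step t I (c' n) (c' (Suc n)) (step t I (c n) (c' n) (steps t I c n k))"
    using Suc.prems by (intro step_square[OF I \<epsilon> t]) auto
  with Suc show ?case by simp
qed simp

lemma steps_const:
  assumes "finite I" "t \<noteq> 0" "\<And>a. a \<le> n \<Longrightarrow> c a = c 0"
  shows "steps t I c n k = k"
  using assms(3)
proof (induction n)
  case (Suc n)
  have eq: "c n = c 0" "c (Suc n) = c 0" by (rule Suc.prems; simp)+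
  have "steps t I c n k = k" by (rule Suc.IH, rule Suc.prems) simp
  with assms(1,2) show ?case by (simp add: eq step_refl)
qed simp

lemma steps_add: "steps t I c (m + n) k = steps t I (\<lambda>a. c (m + a)) n (steps t I c m k)"
  by (induction n) auto

section \<open>Relabelling the strands\<close>

lemma slide_comp_permute:
  assumes "inj \<pi>"
  shows "slide t {i \<in> set h. R (\<pi> i) (\<pi> a)} a (d \<circ> \<pi>)
    = slide t {i \<in> set (map \<pi> h). R i (\<pi> a)} (\<pi> a) d \<circ> \<pi>"
proof
  fix i
  have "i \<in> {i \<in> set h. R (\<pi> i) (\<pi> a)} \<longleftrightarrow> \<pi> i \<in> {i \<in> set (map \<pi> h). R i (\<pi> a)}"
    using inj_image_mem_iff[OF assms, of i "set h"] by auto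
  then show "slide t {i \<in> set h. R (\<pi> i) (\<pi> a)} a (d \<circ> \<pi>) i
      = (slide t {i \<in> set (map \<pi> h). R i (\<pi> a)} (\<pi> a) d \<circ> \<pi>) i"
    by (simp only: slide_def comp_apply)
qed

lemma frame_comp_permute:
  assumes "inj \<pi>"
  shows "frame t (\<lambda>i j. R (\<pi> i) (\<pi> j)) h (d \<circ> \<pi>) = frame t R (map \<pi> h) d \<circ> \<pi>"
proof (induction h)
  case (Cons a h)
  then show ?case
    by (simp only: frame.simps list.map slide_comp_permute[OF assms])
qed simp

lemma unframe_comp_permute:
  assumes "inj \<pi>"
  shows "unframe t (\<lambda>i j. R (\<pi> i) (\<pi> j)) h (d \<circ> \<pi>) = unframe t R (map \<pi> h) d \<circ> \<pi>"
proof (induction h arbitrary: d)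
  case (Cons a h)
  then show ?case
    by (simp only: unframe.simps list.map slide_comp_permute[OF assms])
qed simp

text \<open>The height lists of \<open>r \<circ> \<pi>\<close> and \<open>r\<close> need not
  correspond under \<pi>, because ties are broken arbitrarily. Separation and closeness are assumed
  so that either list may be used.\<close>

lemma step_comp_permute:
  assumes I: "finite I" and \<epsilon>: "0 \<le> \<epsilon>" and t: "t \<noteq> 0"
    and sep: "separated (4 * \<epsilon>) I r" "separated (4 * \<epsilon>) I s" and close: "close \<epsilon> I r s"
    and \<pi>: "\<pi> permutes I"
  shows "step t I (r \<circ> \<pi>) (s \<circ> \<pi>) (k \<circ> \<pi>) = step t I r s k \<circ> \<pi>"
proof -
  define h where "h = height_list I (r \<circ> \<pi>)"
  have h: "distinct h" "set h = I" "sorted_wrt (\<lambda>i j. Im (r (\<pi> i)) \<le> Im (r (\<pi> j))) h"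
    using height_list[OF I, of "r \<circ> \<pi>"] by (simp_all add: h_def)
  have inj: "inj \<pi>" using \<pi> by (rule permutes_inj)
  have lr: "left_of (r \<circ> \<pi>) = (\<lambda>i j. left_of r (\<pi> i) (\<pi> j))" for r
    by (simp add: left_of_def fun_eq_iff)
  have "step t I (r \<circ> \<pi>) (s \<circ> \<pi>) (k \<circ> \<pi>) = transport t (left_of r) (left_of s) (map \<pi> h) k \<circ> \<pi>"
    unfolding step_def transport_def h_def[symmetric] unfolding lr
    by (simp only: frame_comp_permute[OF inj] unframe_comp_permute[OF inj])
  moreover have "step t I r s = transport t (left_of r) (left_of s) (map \<pi> h)"
    using h permutes_image[OF \<pi>] inj
    by (intro step_height_list[OF I \<epsilon> t sep close close_refl[OF \<epsilon>]])
       (auto simp: distinct_map sorted_wrt_map intro: inj_on_subset)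
  ultimately show ?thesis by simp
qed

lemma steps_comp_permute:
  assumes I: "finite I" and \<epsilon>: "0 \<le> \<epsilon>" and t: "t \<noteq> 0"
    and sep: "\<And>a. a \<le> n \<Longrightarrow> separated (4 * \<epsilon>) I (c a)" and close: "\<And>a. a < n \<Longrightarrow> close \<epsilon> I (c a) (c (Suc a))"
    and \<pi>: "\<pi> permutes I"
  shows "steps t I (\<lambda>a. c a \<circ> \<pi>) n (k \<circ> \<pi>) = steps t I c n k \<circ> \<pi>"
  using sep close
proof (induction n)
  case (Suc n)
  then have "steps t I (\<lambda>a. c a \<circ> \<pi>) n (k \<circ> \<pi>) = steps t I c n k \<circ> \<pi>"
    by (intro Suc.IH) auto
  moreover have "separated (4 * \<epsilon>) I (c n)" "separated (4 * \<epsilon>) I (c (Suc n))" "close \<epsilon> I (c n) (c (Suc n))"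
    using Suc.prems by auto
  ultimately show ?case
    by (simp only: steps.simps step_comp_permute[OF I \<epsilon> t _ _ _ \<pi>])
qed simp

section \<open>The transport along a discrete path as a matrix family\<close>

lemma matrix_family_steps:
  assumes "finite I"
  shows "matrix_family I (\<lambda>\<theta>. steps (cis \<theta>) I c n)"
proof (induction n)
  case 0
  have "(\<lambda>\<theta>. steps (cis \<theta>) I c 0) = (\<lambda>\<theta> k. k)" by (simp add: fun_eq_iff)
  then show ?case using matrix_family_id[OF assms] by simp
next
  case (Suc n)
  have "matrix_family I (\<lambda>\<theta>. step (cis \<theta>) I (c n) (c (Suc n)))"
    unfolding step_def using height_list[OF assms] by (intro matrix_family_transport[OF assms]) simp
  from matrix_family_compose[OF assms this Suc] show ?case by simp
qed

lemma steps_fixed_const: "t \<noteq> 0 \<Longrightarrow> steps t I c n (\<lambda>_. z) = (\<lambda>_. z)"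
  by (induction n) (simp_all add: step_def transport_const)

lemma steps_1: "steps 1 I c n k = k"
  by (induction n) (simp_all add: step_def transport_1)

lemma wsum_steps:
  assumes "finite I" "t \<noteq> 0" "0 \<le> \<delta>" "\<And>a. a \<le> n \<Longrightarrow> separated \<delta> I (c a)"
  shows "wsum t (left_of (c n)) I (steps t I c n k) = wsum t (left_of (c 0)) I k"
  using assms(4)
proof (induction n)
  case (Suc n)
  have lin: "strict_linear_on I (left_of (c a))" if "a \<le> Suc n" for a
    using Suc.prems[OF that] assms(3) by (intro strict_linear_on_left_of separated_inj_on)
  have "wsum t (left_of (c (Suc n))) I (step t I (c n) (c (Suc n)) (steps t I c n k))
      = wsum t (left_of (c n)) I (steps t I c n k)"
    using wsum_transport[OF assms(2) height_list(1)[OF assms(1)], of "c n" "left_of (c n)" "left_of (c (Suc n))"]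
      lin[of n] lin[of "Suc n"] by (simp add: step_def height_list(2)[OF assms(1)])
  with Suc show ?case by simp
qed simp

text \<open>
  The sum of the iterates of the transport around the loop projects onto the constant colourings,
  and \<^const>\<open>wsum\<close> is preserved by the transport; but at a nontrivial root of unity of
  order \<open>card I\<close> it kills the constant colourings.
\<close>

theorem no_torsion_cycle:
  fixes c :: "nat \<Rightarrow> nat \<Rightarrow> 'l \<Rightarrow> complex"
  assumes I: "finite I" "2 \<le> card I" and \<epsilon>: "0 \<le> \<epsilon>" and m: "0 < m"
    and sep: "\<And>a b. a \<le> m * M \<Longrightarrow> b \<le> N \<Longrightarrow> separated (4 * \<epsilon>) I (c a b)"
    and close: "\<And>a b. a < m * M \<Longrightarrow> b \<le> N \<Longrightarrow> close \<epsilon> I (c a b) (c (Suc a) b)"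
      "\<And>a b. a \<le> m * M \<Longrightarrow> b < N \<Longrightarrow> close \<epsilon> I (c a b) (c a (Suc b))"
    and const: "\<And>b. b \<le> N \<Longrightarrow> c 0 b = c 0 0" "\<And>b. b \<le> N \<Longrightarrow> c (m * M) b = c 0 0"
      "\<And>a. a \<le> m * M \<Longrightarrow> c a N = c 0 0"
    and \<pi>: "\<pi> permutes I" and cycle: "\<And>i j. i \<in> I \<Longrightarrow> j \<in> I \<Longrightarrow> \<exists>n. (\<pi> ^^ n) i = j"
    and period: "\<And>a. a + M \<le> m * M \<Longrightarrow> c (a + M) 0 = c a 0 \<circ> \<pi>"
    and order: "\<pi> ^^ m = id"
  shows False
proof -
  have I0: "I \<noteq> {}" using I by auto
  have bij: "bij \<pi>" using \<pi> by (rule permutes_bij)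
  define c0 where "c0 a = c a 0" for a
  \<comment> \<open>One period ends at \<open>c0 0 \<circ> \<pi>\<close>. Undoing the relabelling
    turns the transport into an endomorphism of the colourings of the initial configuration, the
    Burau matrix of the loop.\<close>
  define L where "L \<theta> k = steps (cis \<theta>) I c0 M k \<circ> inv_into UNIV \<pi>" for \<theta> k
  have "M \<le> m * M" using m by simp
  \<comment> \<open>The index \<open>b\<close> runs through the stages of the null-homotopy. Both
    ends of each stage stay at the initial configuration, so stage 0 has the same transport as the
    constant stage \<open>N\<close>.\<close>
  have trivial: "steps t I c0 (m * M) k = k" if t: "t \<noteq> 0" for t k
  proof -
    have "steps t I (\<lambda>a. c a b) (m * M) k = steps t I c0 (m * M) k" if "b \<le> N" for b
      using that
    proof (induction b)
      case (Suc b)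
      have "step t I (c (m * M) b) (c (m * M) (Suc b)) (steps t I (\<lambda>a. c a b) (m * M) k)
          = steps t I (\<lambda>a. c a (Suc b)) (m * M) (step t I (c 0 b) (c 0 (Suc b)) k)"
        using Suc.prems by (intro steps_homotopy[OF I(1) \<epsilon> t]) (auto intro!: sep close)
      moreover have "c (m * M) b = c (m * M) (Suc b)" "c 0 b = c 0 (Suc b)"
        using const(1,2)[of b] const(1,2)[of "Suc b"] Suc.prems by auto
      ultimately show ?case using Suc by (simp add: step_refl[OF I(1) t])
    next
      case 0
      have "c0 = (\<lambda>a. c a 0)" by (simp add: c0_def fun_eq_iff)
      then show ?case by simp
    qed
    from this[of N] show ?thesis
      using steps_const[OF I(1) t, of "m * M" "\<lambda>a. c a N" k] const(3) by simp
  qed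
  have period_funpow: "c0 (j * M + a) = c0 a \<circ> (\<pi> ^^ j)" if "j * M + a \<le> m * M" for j a
    using that
  proof (induction j)
    case (Suc j)
    have "c0 (Suc j * M + a) = c0 (j * M + a) \<circ> \<pi>"
      using period[of "j * M + a"] Suc.prems by (simp add: c0_def algebra_simps)
    also have "c0 (j * M + a) = c0 a \<circ> (\<pi> ^^ j)" using Suc.prems by (intro Suc.IH) simp
    finally show ?case by (simp only: comp_assoc funpow_Suc_right)
  qed simp
  \<comment> \<open>Equivariance pulls the relabelling \<open>\<pi> ^^ j\<close> out of the next
    period, so that the transport along \<open>m\<close> periods becomes the power
    \<open>L \<theta> ^^ m\<close>.\<close>
  have L_pow: "steps (cis \<theta>) I c0 (j * M) k = (L \<theta> ^^ j) k \<circ> (\<pi> ^^ j)" if "j \<le> m" for \<theta> j k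
    using that
  proof (induction j)
    case (Suc j)
    have le: "j * M + a \<le> m * M" if "a \<le> M" for a
    proof -
      have "Suc j * M \<le> m * M" using Suc.prems by (intro mult_right_mono) auto
      with that show ?thesis by simp
    qed
    have cong: "steps t I c' n k = steps t I c'' n k" if "\<And>a. a \<le> n \<Longrightarrow> c' a = c'' a" for t c' c'' n k
      using that by (induction n) auto
    have "steps (cis \<theta>) I c0 (Suc j * M) k
        = steps (cis \<theta>) I (\<lambda>a. c0 (j * M + a)) M (steps (cis \<theta>) I c0 (j * M) k)"
      using steps_add[of "cis \<theta>" I c0 "j * M" M k] by (simp only: mult_Suc add.commute[of M])
    also have "\<dots> = steps (cis \<theta>) I (\<lambda>a. c0 a \<circ> (\<pi> ^^ j)) M ((L \<theta> ^^ j) k \<circ> (\<pi> ^^ j))"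
    proof -
      have "j \<le> m" using Suc.prems by simp
      then show ?thesis
        using le by (simp only: Suc.IH) (intro cong period_funpow)
    qed
    also have "\<dots> = steps (cis \<theta>) I c0 M ((L \<theta> ^^ j) k) \<circ> (\<pi> ^^ j)"
    proof (rule steps_comp_permute[OF I(1) \<epsilon>])
      show "\<pi> ^^ j permutes I"
        by (induction j) (simp_all only: funpow.simps permutes_id permutes_compose \<pi>)
      show "separated (4 * \<epsilon>) I (c0 a)" if "a \<le> M" for a
        unfolding c0_def using order_trans[OF that \<open>M \<le> m * M\<close>] by (intro sep) auto
      show "close \<epsilon> I (c0 a) (c0 (Suc a))" if "a < M" for a
        unfolding c0_def using order_less_le_trans[OF that \<open>M \<le> m * M\<close>] by (intro close) auto
    qed simp
    also have "steps (cis \<theta>) I c0 M ((L \<theta> ^^ j) k) = (L \<theta> ^^ Suc j) k \<circ> \<pi>"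
    proof -
      have "inv_into UNIV \<pi> \<circ> \<pi> = id" using bij by (simp add: bij_is_inj)
      then show ?thesis
        by (simp only: funpow.simps comp_apply L_def comp_assoc comp_id)
    qed
    finally show ?case by (simp only: comp_assoc funpow.simps)
  qed simp
  have L_order: "(L \<theta> ^^ m) k = k" for \<theta> k
    using L_pow[of m \<theta> k] trivial[of "cis \<theta>" k] order by simp
  have c0M: "c0 M = c0 0 \<circ> \<pi>" using period_funpow[of 1 0] \<open>M \<le> m * M\<close> by simp
  have lr: "left_of (r \<circ> \<pi>) = (\<lambda>i j. left_of r (\<pi> i) (\<pi> j))" for r
    by (simp add: left_of_def fun_eq_iff)
  have wsum_permute: "wsum t (left_of r) I (k \<circ> inv_into UNIV \<pi>) = wsum t (left_of (r \<circ> \<pi>)) I k" for t r k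
  proof -
    have "wsum t (left_of r) I (k \<circ> inv_into UNIV \<pi>)
        = (\<Sum>i\<in>I. t ^ card {l \<in> I. left_of r l (\<pi> i)} * (k \<circ> inv_into UNIV \<pi>) (\<pi> i))"
      unfolding wsum_def by (rule sum.permute[OF \<pi>, unfolded o_def])
    also have "\<dots> = (\<Sum>i\<in>I. t ^ card {l \<in> I. left_of (r \<circ> \<pi>) l i} * k i)"
    proof (rule sum.cong[OF refl])
      fix i assume "i \<in> I"
      have "{l \<in> I. left_of r l (\<pi> i)} = \<pi> ` {l \<in> I. left_of r (\<pi> l) (\<pi> i)}"
        using permutes_image[OF \<pi>] by auto
      then have "card {l \<in> I. left_of r l (\<pi> i)} = card {l \<in> I. left_of (r \<circ> \<pi>) l i}"
        using card_image[OF inj_on_subset[OF permutes_inj[OF \<pi>] subset_UNIV]] by (simp add: lr)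
      then show "t ^ card {l \<in> I. left_of r l (\<pi> i)} * (k \<circ> inv_into UNIV \<pi>) (\<pi> i)
          = t ^ card {l \<in> I. left_of (r \<circ> \<pi>) l i} * k i"
        using permutes_inverses(2)[OF \<pi>] by simp
    qed
    finally show ?thesis by (simp add: wsum_def)
  qed
  have sep0: "separated (4 * \<epsilon>) I (c0 a)" if "a \<le> M" for a
    using order_trans[OF that \<open>M \<le> m * M\<close>] sep[of a 0] by (simp add: c0_def)
  have wsum_L: "wsum (cis \<theta>) (left_of (c0 0)) I (L \<theta> k) = wsum (cis \<theta>) (left_of (c0 0)) I k" for \<theta> k
  proof -
    have "wsum (cis \<theta>) (left_of (c0 0)) I (L \<theta> k) = wsum (cis \<theta>) (left_of (c0 M)) I (steps (cis \<theta>) I c0 M k)"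
      by (simp add: L_def wsum_permute c0M)
    also have "\<dots> = wsum (cis \<theta>) (left_of (c0 0)) I k"
      using \<epsilon> sep0 by (intro wsum_steps[where \<delta> = "4 * \<epsilon>"] I(1)) auto
    finally show ?thesis .
  qed
  have averaged: "(\<Sum>n<m. (L \<theta> ^^ n) k i) = (\<Sum>n<m. (L \<theta> ^^ n) k j)" if ij: "i \<in> I" "j \<in> I" for \<theta> k i j
  proof (rule invariants_constant[OF I(1) I0 _ m _ _ _ ij])
    have "inv_into UNIV \<pi> \<in> I \<rightarrow> I" using permutes_inv[OF \<pi>] permutes_in_image by fastforce
    from matrix_family_compose[OF I(1) matrix_family_permute[OF I(1) this] matrix_family_steps[OF I(1)]]
    show "matrix_family I L" unfolding L_def[abs_def] .
  next
    show "L \<theta> (\<lambda>_. z) i = z" for \<theta> z i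
      by (simp add: L_def steps_fixed_const)
  next
    fix k i j assume ij: "i \<in> I" "j \<in> I"
    \<comment> \<open>At \<theta> = 0 the operator merely permutes the colours, so the averages are
      constant along the cycle, hence on all of \<open>I\<close>.\<close>
    have L0: "(L 0 ^^ n) k = k \<circ> (inv_into UNIV \<pi> ^^ n)" for n k
      by (induction n arbitrary: k) (simp_all add: L_def steps_1 funpow_swap1 fun_eq_iff)
    define f where "f i = (\<Sum>n<m. (L 0 ^^ n) k i)" for i
    have "f (inv_into UNIV \<pi> i) = f i" for i
    proof -
      have "f (inv_into UNIV \<pi> i) + k i = (\<Sum>n<Suc m. k ((inv_into UNIV \<pi> ^^ n) i))"
        unfolding sum.lessThan_Suc_shift by (simp add: f_def L0 funpow_swap1)
      also have "\<dots> = f i + (L 0 ^^ m) k i" by (simp add: f_def L0)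
      finally show ?thesis using L_order by simp
    qed
    then have "f (\<pi> i) = f i" for i using bij by (metis bij_is_inj inv_f_f)
    then have "f ((\<pi> ^^ n) i) = f i" for n by (induction n) auto
    with cycle[OF ij] show "(\<Sum>n<m. (L 0 ^^ n) k i) = (\<Sum>n<m. (L 0 ^^ n) k j)"
      unfolding f_def by metis
  qed (simp add: L_order)
  \<comment> \<open>The angle of a primitive root of unity of order \<open>card I\<close>. As
    \<open>card I\<close> is at least 2, it lies between 0 (excluded) and \<open>pi\<close>, where
    the cosine is below 1.\<close>
  define \<theta> where "\<theta> = 2 * pi / real (card I)"
  define t where "t = cis \<theta>"
  have tn: "t ^ card I = 1"
  proof -
    have "real (card I) * \<theta> = 2 * pi" using I(2) by (simp add: \<theta>_def)
    then show ?thesis by (simp only: t_def Complex.DeMoivre cis_2pi)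
  qed
  have t1: "t \<noteq> 1"
  proof
    assume "t = 1"
    then have "cos \<theta> = 1" by (simp add: t_def complex_eq_iff)
    moreover have "cos \<theta> < cos 0" using I unfolding \<theta>_def
      by (intro cos_monotone_0_pi) (auto simp: field_simps)
    ultimately show False by simp
  qed
  define w where "w = wsum t (left_of (c0 0)) I"
  have lin: "strict_linear_on I (left_of (c0 0))"
    using separated_inj_on[OF sep0[of 0]] \<epsilon> by (simp add: strict_linear_on_left_of)
  have w1: "w (\<lambda>_. 1) = 0"
    using wsum_1[OF I(1) lin, of t] t1 tn by (simp add: w_def)
  have w0: "w k = 0" for k
  proof -
    obtain i0 where i0: "i0 \<in> I" using I0 by auto
    define z where "z = (\<Sum>n<m. (L \<theta> ^^ n) k i0)"
    have "w ((L \<theta> ^^ n) k) = w k" for n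
      using wsum_L by (induction n) (simp_all add: w_def t_def)
    then have "of_nat m * w k = (\<Sum>n<m. w ((L \<theta> ^^ n) k))" by simp
    also have "\<dots> = w (\<lambda>i. \<Sum>n<m. (L \<theta> ^^ n) k i)"
      unfolding w_def wsum_def by (simp add: sum_distrib_left) (rule sum.swap)
    also have "\<dots> = w (\<lambda>i. z)"
      unfolding w_def wsum_def z_def by (intro sum.cong refl arg_cong[where f = "\<lambda>x. _ * x"] averaged i0)
    also have "\<dots> = z * w (\<lambda>_. 1)"
      unfolding w_def wsum_def by (simp add: sum_distrib_left mult.commute)
    finally show ?thesis using w1 m by simp
  qed
  obtain i0 where i0: "i0 \<in> I" using I0 by auto
  \<comment> \<open>On the indicator of a single strand \<open>w\<close> is a power of
    \<open>t\<close>, so \<open>w\<close> cannot vanish identically.\<close>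
  have "w (\<lambda>i. if i = i0 then 1 else 0) = t ^ card {l \<in> I. left_of (c0 0) l i0}"
    unfolding w_def wsum_def using I(1) i0 by (simp add: if_distrib[of "\<lambda>x. _ * x"] cong: if_cong)
  with w0 have "t ^ card {l \<in> I. left_of (c0 0) l i0} = 0" by simp
  then show False by (simp add: t_def)
qed

section \<open>Continuous families of finite subsets of the plane\<close>

text \<open>Only lower semicontinuity of the fibres is demanded, which is what is easy to verify for
  roots; constant cardinality excludes further points.\<close>

definition root_family :: "nat \<Rightarrow> ('a::topological_space \<Rightarrow> complex set) \<Rightarrow> bool" where
  "root_family n Z \<longleftrightarrow> (\<forall>x. finite (Z x) \<and> card (Z x) = n) \<and>
     (\<forall>x. \<forall>z\<in>Z x. \<forall>\<epsilon>>0. \<forall>\<^sub>F y in nhds x. \<exists>w\<in>Z y. dist w z < \<epsilon>)"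

text \<open>A lift of \<open>H\<close> to the covering of all pairs \<open>(x, z)\<close> with
  \<open>z \<in> Z x\<close>, recorded by its second component.\<close>

definition section_along :: "('a \<Rightarrow> complex set) \<Rightarrow> 'd::topological_space set \<Rightarrow> ('d \<Rightarrow> 'a) \<Rightarrow> ('d \<Rightarrow> complex) \<Rightarrow> bool" where
  "section_along Z D H g \<longleftrightarrow> continuous_on D g \<and> (\<forall>d\<in>D. g d \<in> Z (H d))"

lemma finite_positive_lower_bound:
  assumes "finite P" "\<And>p. p \<in> P \<Longrightarrow> 0 < (f p :: real)"
  shows "\<exists>\<delta>>0. \<forall>p\<in>P. \<delta> \<le> f p"
  using assms by (intro exI[of _ "Min (insert 1 (f ` P))"]) auto

lemma section_along_subset: "section_along Z D H g \<Longrightarrow> D' \<subseteq> D \<Longrightarrow> section_along Z D' H g"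
  unfolding section_along_def by (meson continuous_on_subset subsetD)

lemma section_along_compose:
  assumes "section_along Z D H g" "continuous_on D' \<phi>" "\<phi> ` D' \<subseteq> D"
  shows "section_along Z D' (\<lambda>d. H (\<phi> d)) (\<lambda>d. g (\<phi> d))"
  using assms unfolding section_along_def
  by (auto intro: continuous_on_compose2[of D g D' \<phi>])

lemma section_along_cong:
  "section_along Z D H g \<Longrightarrow> (\<And>d. d \<in> D \<Longrightarrow> H d = H' d) \<Longrightarrow> section_along Z D H' g"
  by (simp add: section_along_def)

definition trivializes ::
    "('a::topological_space \<Rightarrow> complex set) \<Rightarrow> 'a \<Rightarrow> 'a set \<Rightarrow> real \<Rightarrow> (complex \<Rightarrow> 'a \<Rightarrow> complex) \<Rightarrow> bool" where
  "trivializes Z x0 T \<epsilon> \<rho> \<longleftrightarrow> open T \<and> x0 \<in> T \<and> 0 < \<epsilon> \<and>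
    (\<forall>z\<in>Z x0. continuous_on T (\<rho> z)) \<and>
    (\<forall>y\<in>T. \<forall>z\<in>Z x0. Z y \<inter> ball z \<epsilon> = {\<rho> z y}) \<and>
    (\<forall>y\<in>T. \<forall>w\<in>Z y. \<exists>z\<in>Z x0. w \<in> ball z \<epsilon>) \<and>
    (\<forall>z\<in>Z x0. \<forall>z'\<in>Z x0. z \<noteq> z' \<longrightarrow> ball z \<epsilon> \<inter> ball z' \<epsilon> = {})"

text \<open>
  Near \<open>x\<^sub>0\<close> every one of the \<open>n\<close> disjoint balls contains a point of the fibre, hence, by
  counting, exactly one.
\<close>

lemma trivialization_exists:
  fixes Z :: "'a::topological_space \<Rightarrow> complex set"
  assumes Z: "root_family n Z"
  shows "\<exists>T \<epsilon> \<rho>. trivializes Z x0 T \<epsilon> \<rho>"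
proof -
  have fin: "finite (Z y)" "card (Z y) = n" for y using Z by (auto simp: root_family_def)
  have near: "\<forall>\<^sub>F y in nhds x. \<exists>w\<in>Z y. dist w z < \<epsilon>" if "z \<in> Z x" "0 < \<epsilon>" for x z \<epsilon>
    using Z that unfolding root_family_def by blast
  have "\<exists>\<delta>>0. \<forall>p\<in>Z x0 \<times> Z x0 - Id. \<delta> \<le> dist (fst p) (snd p)"
    using fin by (intro finite_positive_lower_bound) auto
  then obtain \<delta> where \<delta>: "0 < \<delta>" "\<And>z z'. z \<in> Z x0 \<Longrightarrow> z' \<in> Z x0 \<Longrightarrow> z \<noteq> z' \<Longrightarrow> \<delta> \<le> dist z z'"
    by force
  define \<epsilon> where "\<epsilon> = \<delta> / 2"
  have \<epsilon>: "0 < \<epsilon>" using \<delta> by (simp add: \<epsilon>_def)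
  have disj: "z = z'" if "z \<in> Z x0" "z' \<in> Z x0" "u \<in> ball z \<epsilon>" "u \<in> ball z' \<epsilon>" for z z' u
  proof (rule ccontr)
    assume "z \<noteq> z'"
    with \<delta>(2) that(1,2) have "\<delta> \<le> dist z z'" by blast
    also have "\<dots> \<le> dist z u + dist u z'" by (rule dist_triangle)
    also have "\<dots> < \<delta>" using that(3,4) by (simp add: \<epsilon>_def dist_commute)
    finally show False by simp
  qed
  have "\<forall>\<^sub>F y in nhds x0. \<forall>z\<in>Z x0. \<exists>w\<in>Z y. dist w z < \<epsilon>"
    using fin(1) near \<epsilon> by (intro eventually_ball_finite) auto
  then obtain T where T: "open T" "x0 \<in> T" "\<And>y z. y \<in> T \<Longrightarrow> z \<in> Z x0 \<Longrightarrow> \<exists>w\<in>Z y. dist w z < \<epsilon>"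
    unfolding eventually_nhds by blast
  have uniq: "\<exists>u. Z y \<inter> ball z \<epsilon> = {u}" and cover: "w \<in> Z y \<Longrightarrow> \<exists>z\<in>Z x0. w \<in> ball z \<epsilon>"
    if y: "y \<in> T" and z: "z \<in> Z x0" for y z w
  proof -
    obtain f where f: "\<And>z. z \<in> Z x0 \<Longrightarrow> f z \<in> Z y" "\<And>z. z \<in> Z x0 \<Longrightarrow> f z \<in> ball z \<epsilon>"
      using T(3)[OF y] by (metis dist_commute mem_ball)
    have "inj_on f (Z x0)"
      by (rule inj_onI) (metis f(2) disj)
    then have "f ` Z x0 = Z y"
      using f(1) fin by (intro card_subset_eq) (auto simp: card_image)
    then have surj: "\<exists>z\<in>Z x0. w = f z" if "w \<in> Z y" for w using that by blast
    show "\<exists>z\<in>Z x0. w \<in> ball z \<epsilon>" if "w \<in> Z y" using surj[OF that] f(2) by blast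
    have "u = f z" if "u \<in> Z y" "u \<in> ball z \<epsilon>" for u
      using surj[OF that(1)] f(2) disj[OF z _ that(2)] by blast
    then have "Z y \<inter> ball z \<epsilon> = {f z}" using f[OF z] by blast
    then show "\<exists>u. Z y \<inter> ball z \<epsilon> = {u}" by blast
  qed
  define \<rho> where "\<rho> z y = (SOME u. Z y \<inter> ball z \<epsilon> = {u})" for z y
  have \<rho>: "Z y \<inter> ball z \<epsilon> = {\<rho> z y}" if "y \<in> T" "z \<in> Z x0" for y z
    unfolding \<rho>_def by (rule someI_ex) (rule uniq[OF that])
  have "continuous_on T (\<rho> z)" if z: "z \<in> Z x0" for z
    unfolding continuous_on_def
  proof
      fix y1 assume y1: "y1 \<in> T"
      have r: "\<rho> z y1 \<in> Z y1" "dist z (\<rho> z y1) < \<epsilon>" using \<rho>[OF y1 z] by auto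
      have "(\<rho> z \<longlongrightarrow> \<rho> z y1) (nhds y1)"
      proof (rule tendstoI)
        fix \<eta> :: real assume \<eta>: "0 < \<eta>"
        \<comment> \<open>The second bound keeps the nearby root inside
          \<open>ball z \<epsilon>\<close>, where it can only be \<open>\<rho> z y\<close>.\<close>
        define \<eta>' where "\<eta>' = min \<eta> (\<epsilon> - dist z (\<rho> z y1))"
        have "\<forall>\<^sub>F y in nhds y1. \<exists>w\<in>Z y. dist w (\<rho> z y1) < \<eta>'"
          using r \<eta> by (intro near) (auto simp: \<eta>'_def)
        moreover have "\<forall>\<^sub>F y in nhds y1. y \<in> T" using T(1) y1 by (rule eventually_nhds_in_open)
        ultimately show "\<forall>\<^sub>F y in nhds y1. dist (\<rho> z y) (\<rho> z y1) < \<eta>"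
        proof eventually_elim
          case (elim y)
          then obtain w where w: "w \<in> Z y" "dist w (\<rho> z y1) < \<eta>'" by blast
          have "dist z w \<le> dist z (\<rho> z y1) + dist (\<rho> z y1) w" by (rule dist_triangle)
          also have "\<dots> < \<epsilon>" using w(2) by (simp add: \<eta>'_def dist_commute)
          finally have "w \<in> Z y \<inter> ball z \<epsilon>" using w(1) by simp
          then have "w = \<rho> z y" using \<rho>[OF elim(2) z] by blast
          with w(2) show ?case by (simp add: \<eta>'_def)
        qed
      qed
      then show "(\<rho> z \<longlongrightarrow> \<rho> z y1) (at y1 within T)"
        by (rule tendsto_mono[rotated]) (simp add: at_within_def)
    qed
  moreover have "\<exists>z\<in>Z x0. w \<in> ball z \<epsilon>" if "y \<in> T" "w \<in> Z y" for y w
  proof -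
    have "Z x0 \<noteq> {}" using fin[of x0] fin[of y] that(2) by (metis card_eq_0_iff empty_iff)
    with cover that show ?thesis by blast
  qed
  moreover have "ball z \<epsilon> \<inter> ball z' \<epsilon> = {}" if "z \<in> Z x0" "z' \<in> Z x0" "z \<noteq> z'" for z z'
    using disj that by blast
  ultimately have "trivializes Z x0 T \<epsilon> \<rho>"
    unfolding trivializes_def using T(1,2) \<epsilon> \<rho> by blast
  then show ?thesis by blast
qed

text \<open>The set of agreement is clopen: it is closed by continuity, and open because a
  trivializing ball contains only one point of each nearby fibre.\<close>

lemma section_unique:
  fixes Z :: "'a::topological_space \<Rightarrow> complex set"
  assumes Z: "root_family n Z" and D: "connected D" and H: "continuous_on D H"
    and g: "section_along Z D H g" "section_along Z D H g'" and d: "d0 \<in> D" "g d0 = g' d0" and "d \<in> D"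
  shows "g d = g' d"
proof -
  define A where "A = {d \<in> D. g d = g' d}"
  have c: "continuous_on D g" "continuous_on D g'" using g by (auto simp: section_along_def)
  have "closedin (top_of_set D) (D \<inter> (\<lambda>d. g d - g' d) -` {0})"
    by (intro continuous_closedin_preimage continuous_on_diff c) auto
  also have "D \<inter> (\<lambda>d. g d - g' d) -` {0} = A" by (auto simp: A_def)
  finally have "closedin (top_of_set D) A" .
  moreover have "openin (top_of_set D) A"
  proof (subst openin_subopen, rule ballI)
    fix d1 assume d1: "d1 \<in> A"
    obtain T \<epsilon> \<rho> where triv: "trivializes Z (H d1) T \<epsilon> \<rho>"
      using trivialization_exists[OF Z] by blast
    then have T: "open T" "H d1 \<in> T" "0 < \<epsilon>"
      "\<And>y z. y \<in> T \<Longrightarrow> z \<in> Z (H d1) \<Longrightarrow> Z y \<inter> ball z \<epsilon> = {\<rho> z y}"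
      unfolding trivializes_def by blast+
    define U where "U = (D \<inter> H -` T) \<inter> ((D \<inter> g -` ball (g d1) \<epsilon>) \<inter> (D \<inter> g' -` ball (g d1) \<epsilon>))"
    have "openin (top_of_set D) U"
      unfolding U_def by (intro openin_Int continuous_openin_preimage_gen H c T) auto
    moreover have "d1 \<in> U" using d1 T by (auto simp: U_def A_def)
    moreover have "U \<subseteq> A"
    proof
      fix d assume d: "d \<in> U"
      have "g d1 \<in> Z (H d1)" using d1 g by (auto simp: A_def section_along_def)
      with d T(4)[of "H d" "g d1"] have eq: "Z (H d) \<inter> ball (g d1) \<epsilon> = {\<rho> (g d1) (H d)}" by (auto simp: U_def)
      have "g d \<in> Z (H d) \<inter> ball (g d1) \<epsilon>" "g' d \<in> Z (H d) \<inter> ball (g d1) \<epsilon>"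
        using d g by (auto simp: U_def section_along_def)
      with eq d show "d \<in> A" by (auto simp: A_def U_def)
    qed
    ultimately show "\<exists>T. openin (top_of_set D) T \<and> d1 \<in> T \<and> T \<subseteq> A" by blast
  qed
  moreover have "d0 \<in> A" using d by (auto simp: A_def)
  ultimately have "A = D" using D unfolding connected_clopen by blast
  with \<open>d \<in> D\<close> show ?thesis by (auto simp: A_def)
qed

text \<open>The pullback \<open>C\<close> of the root covering along \<open>H\<close> is a covering
  space of \<open>D\<close>. The identity of \<open>D\<close> lifts to it, because a convex set is
  simply connected and locally path-connected.\<close>

lemma section_exists:
  fixes Z :: "'a::topological_space \<Rightarrow> complex set" and D :: "'d::real_normed_vector set"
  assumes Z: "root_family n Z" and D: "convex D" and H: "continuous_on D H"
    and d0: "d0 \<in> D" "z0 \<in> Z (H d0)"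
  obtains g where "section_along Z D H g" "g d0 = z0"
proof -
  define C where "C = {(d, w). d \<in> D \<and> w \<in> Z (H d)}"
  have fin: "finite (Z y)" "card (Z y) = n" for y using Z by (auto simp: root_family_def)
  have ne: "Z y \<noteq> {}" for y
    using fin[of y] fin[of "H d0"] d0(2) by (metis card_eq_0_iff empty_iff)
  have "covering_space C fst D"
  proof
    show "continuous_on C fst" by (intro continuous_intros)
    show "fst ` C = D" using ne by (force simp: C_def image_iff)
  next
    fix d1 assume d1: "d1 \<in> D"
    obtain T \<epsilon> \<rho> where triv: "trivializes Z (H d1) T \<epsilon> \<rho>"
      using trivialization_exists[OF Z] by blast
    then have T: "open T" "H d1 \<in> T" "0 < \<epsilon>"
      "\<And>z. z \<in> Z (H d1) \<Longrightarrow> continuous_on T (\<rho> z)"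
      "\<And>y z. y \<in> T \<Longrightarrow> z \<in> Z (H d1) \<Longrightarrow> Z y \<inter> ball z \<epsilon> = {\<rho> z y}"
      "\<And>y w. y \<in> T \<Longrightarrow> w \<in> Z y \<Longrightarrow> \<exists>z\<in>Z (H d1). w \<in> ball z \<epsilon>"
      "\<And>z z'. z \<in> Z (H d1) \<Longrightarrow> z' \<in> Z (H d1) \<Longrightarrow> z \<noteq> z' \<Longrightarrow> ball z \<epsilon> \<inter> ball z' \<epsilon> = {}"
      unfolding trivializes_def by blast+
    define U where "U = D \<inter> H -` T"
    define s where "s z = (C \<inter> fst -` U) \<inter> (C \<inter> snd -` ball z \<epsilon>)" for z
    have U: "openin (top_of_set D) U"
      unfolding U_def by (intro continuous_openin_preimage_gen H T)
    have "\<exists>v. \<Union> v = C \<inter> fst -` U \<and> (\<forall>u\<in>v. openin (top_of_set C) u) \<and> pairwise disjnt v \<and>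
        (\<forall>u\<in>v. \<exists>q. homeomorphism u U fst q)"
    proof (intro exI[of _ "s ` Z (H d1)"] conjI ballI)
      show "\<Union> (s ` Z (H d1)) = C \<inter> fst -` U"
        using T(6) by (fastforce simp: s_def C_def U_def)
      show "pairwise disjnt (s ` Z (H d1))"
        using T(7) by (force simp: pairwise_def disjnt_def s_def)
    next
      fix u assume "u \<in> s ` Z (H d1)"
      then obtain z where z: "z \<in> Z (H d1)" "u = s z" by auto
      have "openin (top_of_set C) (C \<inter> fst -` U)"
        using U by (intro continuous_openin_preimage[of C fst D]) (auto intro!: continuous_intros simp: C_def)
      moreover have "openin (top_of_set C) (C \<inter> snd -` ball z \<epsilon>)"
        by (intro continuous_openin_preimage_gen continuous_intros) auto
      ultimately show "openin (top_of_set C) u" by (auto simp: z s_def)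
      have sz: "w = \<rho> z (H d)" if "(d, w) \<in> s z" for d w
      proof -
        have "w \<in> Z (H d) \<inter> ball z \<epsilon>" "H d \<in> T" using that by (auto simp: s_def U_def C_def)
        with T(5)[OF this(2) z(1)] show ?thesis by blast
      qed
      have \<rho>: "\<rho> z (H d) \<in> Z (H d)" "\<rho> z (H d) \<in> ball z \<epsilon>" if "d \<in> U" for d
      proof -
        have "H d \<in> T" using that by (simp add: U_def)
        from T(5)[OF this z(1)] show "\<rho> z (H d) \<in> Z (H d)" "\<rho> z (H d) \<in> ball z \<epsilon>" by blast+
      qed
      have "homeomorphism u U fst (\<lambda>d. (d, \<rho> z (H d)))"
        unfolding z(2)
      proof (rule homeomorphismI)
        show "continuous_on (s z) fst" by (intro continuous_intros)
        show "continuous_on U (\<lambda>d. (d, \<rho> z (H d)))"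
          using H by (intro continuous_intros continuous_on_compose2[OF T(4)[OF z(1)]])
            (auto simp: U_def elim: continuous_on_subset)
        show "fst ` s z \<subseteq> U" by (auto simp: s_def)
        show "(\<lambda>d. (d, \<rho> z (H d))) ` U \<subseteq> s z"
          using \<rho> by (auto simp: s_def C_def U_def)
        show "(fst x, \<rho> z (H (fst x))) = x" if "x \<in> s z" for x
          using sz that by (cases x) auto
      qed auto
      then show "\<exists>q. homeomorphism u U fst q" by blast
    qed
    with U show "\<exists>T. d1 \<in> T \<and> openin (top_of_set D) T \<and> (\<exists>v. \<Union> v = C \<inter> fst -` T \<and>
        (\<forall>u\<in>v. openin (top_of_set C) u) \<and> pairwise disjnt v \<and> (\<forall>u\<in>v. \<exists>q. homeomorphism u T fst q))"
      using d1 T(2) by (intro exI[of _ U]) (auto simp: U_def)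
  qed
  moreover have "(d0, z0) \<in> C" using d0 by (simp add: C_def)
  ultimately obtain G where G: "continuous_on D G" "G \<in> D \<rightarrow> C" "G d0 = (d0, z0)" "\<And>d. d \<in> D \<Longrightarrow> fst (G d) = d"
    using covering_space_lift_strong[of C fst D "(d0, z0)" d0 D "\<lambda>d. d"] d0(1) D
      convex_imp_simply_connected convex_imp_locally_path_connected by (metis (mono_tags, lifting) continuous_on_id funcsetI fst_conv)
  show ?thesis
  proof
    have "snd (G d) \<in> Z (H d)" if "d \<in> D" for d
      using G(2,4) that by (force simp: C_def Pi_iff)
    then show "section_along Z D H (\<lambda>d. snd (G d))"
      unfolding section_along_def using G(1) by (auto intro!: continuous_intros)
    show "snd (G d0) = z0" using G(3) by simp
  qed
qed

section \<open>Monodromy along torsion loops\<close>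

text \<open>Strands are labelled by their starting points. Compactness of the square gives uniform
  separation and uniform continuity, so a fine grid satisfies the hypotheses of
  \<open>no_torsion_cycle\<close>.\<close>

lemma torsion_loop_monodromy_cycles:
  fixes R :: "complex \<Rightarrow> real \<times> real \<Rightarrow> complex"
  assumes B: "finite B" "2 \<le> card B" and m: "0 < (m::nat)"
    and cont: "\<And>i. i \<in> B \<Longrightarrow> continuous_on ({0..1} \<times> {0..1}) (R i)"
    and inj: "\<And>i j d. i \<in> B \<Longrightarrow> j \<in> B \<Longrightarrow> d \<in> {0..1} \<times> {0..1} \<Longrightarrow> R i d = R j d \<Longrightarrow> i = j"
    and left: "\<And>i u. i \<in> B \<Longrightarrow> u \<in> {0..1} \<Longrightarrow> R i (u, 0) = i"
    and right: "\<And>i u. i \<in> B \<Longrightarrow> u \<in> {0..1} \<Longrightarrow> R i (u, 1) = i"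
    and top: "\<And>i s. i \<in> B \<Longrightarrow> s \<in> {0..1} \<Longrightarrow> R i (1, s) = i"
    and \<pi>: "\<pi> permutes B" and cycle: "\<And>i j. i \<in> B \<Longrightarrow> j \<in> B \<Longrightarrow> \<exists>n. (\<pi> ^^ n) i = j"
    and order: "\<pi> ^^ m = id"
    and period: "\<And>i s. i \<in> B \<Longrightarrow> 0 \<le> s \<Longrightarrow> s + 1 / real m \<le> 1 \<Longrightarrow> R i (0, s + 1 / real m) = R (\<pi> i) (0, s)"
  shows False
proof -
  define D where "D = {0..1::real} \<times> {0..1::real}"
  have D: "compact D" "D \<noteq> {}" by (auto simp: D_def compact_Times)
  have "\<exists>\<delta>>0. \<forall>d\<in>D. \<delta> \<le> norm (R (fst p) d - R (snd p) d)" if p: "p \<in> B \<times> B - Id" for p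
  proof -
    have "continuous_on D (\<lambda>d. norm (R (fst p) d - R (snd p) d))"
      using p cont by (auto simp: D_def intro!: continuous_intros)
    from continuous_attains_inf[OF D this]
    obtain d where d: "d \<in> D" "\<forall>y\<in>D. norm (R (fst p) d - R (snd p) d) \<le> norm (R (fst p) y - R (snd p) y)"
      by blast
    have "fst p \<in> B" "snd p \<in> B" "fst p \<noteq> snd p" using p by auto
    then have "R (fst p) d \<noteq> R (snd p) d" using inj d(1) unfolding D_def by blast
    with d(2) show ?thesis by (intro exI[of _ "norm (R (fst p) d - R (snd p) d)"]) auto
  qed
  then obtain f where f: "\<And>p. p \<in> B \<times> B - Id \<Longrightarrow> 0 < f p"
    "\<And>p d. p \<in> B \<times> B - Id \<Longrightarrow> d \<in> D \<Longrightarrow> f p \<le> norm (R (fst p) d - R (snd p) d)"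
    by metis
  obtain \<delta> where \<delta>: "0 < \<delta>" "\<And>p. p \<in> B \<times> B - Id \<Longrightarrow> \<delta> \<le> f p"
    using finite_positive_lower_bound[of "B \<times> B - Id" f] B(1) f(1) by blast
  \<comment> \<open>With 8 in place of 4 the separation by \<open>4 * \<epsilon>\<close> becomes
    strict.\<close>
  define \<epsilon> where "\<epsilon> = \<delta> / 8"
  have \<epsilon>: "0 < \<epsilon>" using \<delta> by (simp add: \<epsilon>_def)
  have sep: "4 * \<epsilon> < norm (R i d - R j d)" if "i \<in> B" "j \<in> B" "i \<noteq> j" "d \<in> D" for i j d
  proof -
    have "(i, j) \<in> B \<times> B - Id" using that by auto
    then have "\<delta> \<le> norm (R i d - R j d)" using \<delta>(2) f(2)[OF _ that(4)] by fastforce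
    then show ?thesis using \<delta>(1) by (simp add: \<epsilon>_def)
  qed
  have "\<exists>\<eta>>0. \<forall>d\<in>D. \<forall>d'\<in>D. dist d' d < \<eta> \<longrightarrow> dist (R i d') (R i d) < \<epsilon>" if "i \<in> B" for i
  proof -
    have "uniformly_continuous_on D (R i)"
      using cont[OF that] D(1) unfolding D_def by (rule compact_uniformly_continuous)
    with \<epsilon> show ?thesis unfolding uniformly_continuous_on_def by blast
  qed
  then obtain g where g: "\<And>i. i \<in> B \<Longrightarrow> 0 < g i"
    "\<And>i d d'. i \<in> B \<Longrightarrow> d \<in> D \<Longrightarrow> d' \<in> D \<Longrightarrow> dist d' d < g i \<Longrightarrow> dist (R i d') (R i d) < \<epsilon>"
    by metis
  obtain \<eta> where \<eta>: "0 < \<eta>" "\<And>i. i \<in> B \<Longrightarrow> \<eta> \<le> g i"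
    using finite_positive_lower_bound[of B g] B(1) g(1) by blast
  obtain M where M: "1 / real (Suc M) < \<eta>" using \<eta>(1) by (metis nat_approx_posE)
  define K where "K = Suc M"
  \<comment> \<open>A multiple of \<open>m\<close>, so that the period \<open>1 / m\<close> consists
    of exactly \<open>K\<close> grid steps.\<close>
  define N where "N = m * K"
  have N: "0 < N" using m by (simp add: N_def K_def)
  have N\<eta>: "1 / real N < \<eta>"
  proof -
    have "Suc M \<le> N" using m unfolding N_def K_def by (cases m) auto
    then have "real (Suc M) \<le> real N" by (simp only: of_nat_le_iff)
    then have "1 / real N \<le> 1 / real (Suc M)" by (intro divide_left_mono) auto
    with M show ?thesis by simp
  qed
  \<comment> \<open>\<open>a\<close> counts time and \<open>b\<close> the stage of the homotopy,
    which is the first coordinate of the square.\<close>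
  define pt where "pt a b = (real b / real N, real a / real N)" for a b
  have pt: "pt a b \<in> D" if "a \<le> N" "b \<le> N" for a b
    using that N by (simp add: pt_def D_def)
  \<comment> \<open>The value 0 off \<open>B\<close> makes coinciding configurations equal as
    functions on the whole type.\<close>
  define c where "c a b i = (if i \<in> B then R i (pt a b) else 0)" for a b i
  have near: "norm (R i (pt a b) - R i (pt a' b')) \<le> \<epsilon>"
    if "i \<in> B" "a \<le> N" "b \<le> N" "a' \<le> N" "b' \<le> N" "dist (pt a b) (pt a' b') \<le> 1 / real N" for i a b a' b'
    using g(2)[OF that(1) pt pt, of a' b' a b] that N\<eta> \<eta>(2)[OF that(1)] by (force simp: dist_norm)
  show False
  proof (rule no_torsion_cycle[OF B _ m, of \<epsilon> K N c \<pi>])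
    show "0 \<le> \<epsilon>" using \<epsilon> by simp
    show "separated (4 * \<epsilon>) B (c a b)" if "a \<le> m * K" "b \<le> N" for a b
      using that sep pt by (simp add: separated_def c_def N_def)
    show "close \<epsilon> B (c a b) (c (Suc a) b)" if "a < m * K" "b \<le> N" for a b
    proof -
      have "dist (pt a b) (pt (Suc a) b) \<le> 1 / real N"
        by (simp add: pt_def dist_Pair_Pair dist_norm add_divide_distrib)
      with near that show ?thesis by (simp add: close_def c_def N_def)
    qed
    show "close \<epsilon> B (c a b) (c a (Suc b))" if "a \<le> m * K" "b < N" for a b
    proof -
      have "dist (pt a b) (pt a (Suc b)) \<le> 1 / real N"
        by (simp add: pt_def dist_Pair_Pair dist_norm add_divide_distrib)
      with near that show ?thesis by (simp add: close_def c_def N_def)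
    qed
    have c00: "c 0 0 = (\<lambda>i. if i \<in> B then i else 0)"
      using left[of _ 0] by (auto simp: c_def pt_def fun_eq_iff)
    show "c 0 b = c 0 0" if "b \<le> N" for b
      unfolding c00 using that N left by (auto simp: c_def pt_def fun_eq_iff)
    show "c (m * K) b = c 0 0" if "b \<le> N" for b
      unfolding c00 using that N right by (auto simp: c_def pt_def fun_eq_iff simp flip: N_def)
    show "c a N = c 0 0" if "a \<le> m * K" for a
      unfolding c00 using that N top by (auto simp: c_def pt_def fun_eq_iff simp flip: N_def)
    show "c (a + K) 0 = c a 0 \<circ> \<pi>" if "a + K \<le> m * K" for a
    proof
      fix i
      have eq: "real (a + K) / real N = real a / real N + 1 / real m"
      proof -
        have "real K \<noteq> 0" by (simp add: K_def)
        then have "real K / real N = 1 / real m" by (simp add: N_def)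
        then show ?thesis by (simp add: add_divide_distrib)
      qed
      have "real (a + K) / real N \<le> 1" using that N by (simp add: N_def del: of_nat_add of_nat_mult)
      then have "real a / real N + 1 / real m \<le> 1" by (simp only: eq)
      from period[OF _ _ this] have "R i (0, real (a + K) / real N) = R (\<pi> i) (0, real a / real N)" if "i \<in> B"
        using that by (simp only: eq) simp
      moreover have "\<pi> i \<in> B \<longleftrightarrow> i \<in> B" using \<pi> by (rule permutes_in_image)
      ultimately show "c (a + K) 0 i = (c a 0 \<circ> \<pi>) i" by (simp add: c_def pt_def)
    qed
  qed (use \<pi> cycle order in auto)
qed

text \<open>Lifting the null-homotopy of the \<open>m\<close>-fold loop moves the fibre over
  \<open>x\<close> across a square, constantly on three sides. On the fourth side a time shift by
  \<open>1 / m\<close> acts as the monodromy \<sigma>, and an orbit of \<sigma> with more than one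
  point is a cycle of the kind just excluded.\<close>

lemma torsion_loop_monodromy:
  fixes Z :: "'a::topological_space \<Rightarrow> complex set"
  assumes Z: "root_family n Z" and m: "0 < m"
    and \<gamma>: "path \<gamma>" "\<gamma> 0 = x" "\<gamma> 1 = x"
    and hom: "homotopic_paths UNIV (\<lambda>s. \<gamma> (frac (real m * s))) (\<lambda>_. x)"
    and r: "section_along Z {0..1} \<gamma> r"
  shows "r 1 = r 0"
proof -
  define D where "D = {0..1::real} \<times> {0..1::real}"
  obtain h where h: "continuous_on D h"
    "\<And>s. s \<in> {0..1} \<Longrightarrow> h (0, s) = \<gamma> (frac (real m * s))" "\<And>s. s \<in> {0..1} \<Longrightarrow> h (1, s) = x"
    "\<And>u. u \<in> {0..1} \<Longrightarrow> h (u, 0) = x" "\<And>u. u \<in> {0..1} \<Longrightarrow> h (u, 1) = x"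
  proof -
    have "frac (real m) = 0" by (simp add: frac_eq_0_iff)
    with hom \<gamma>(2) that show ?thesis
      unfolding homotopic_paths D_def pathstart_def pathfinish_def by auto
  qed
  have conv: "convex D" unfolding D_def by (intro convex_Times) auto
  have x: "h (0, 0) = x" using h(4)[of 0] by simp
  have "\<exists>g. section_along Z D h g \<and> g (0, 0) = i" if "i \<in> Z x" for i
    using section_exists[OF Z conv h(1), of "(0, 0)" i] that x by (auto simp: D_def)
  then obtain R where R: "\<And>i. i \<in> Z x \<Longrightarrow> section_along Z D h (R i)" "\<And>i. i \<in> Z x \<Longrightarrow> R i (0, 0) = i"
    by metis
  have sub: "section_along Z S (\<lambda>s. h (\<phi> s)) (\<lambda>s. R i (\<phi> s))"
    if "i \<in> Z x" "continuous_on S \<phi>" "\<phi> ` S \<subseteq> D" for i \<phi> and S :: "real set"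
    using section_along_compose[OF R(1)[OF that(1)] that(2,3)] .
  \<comment> \<open>While the base point rests at \<open>x\<close>, uniqueness compares the lift
    with a constant one.\<close>
  have const: "R i (\<phi> s) = R i (\<phi> s0)"
    if "i \<in> Z x" "continuous_on {0..1} \<phi>" "\<phi> ` {0..1} \<subseteq> D" "\<And>s. s \<in> {0..1} \<Longrightarrow> h (\<phi> s) = x"
      "s \<in> {0..1}" "s0 \<in> {0..1}" for i s s0 and \<phi> :: "real \<Rightarrow> real \<times> real"
  proof -
    have s: "section_along Z {0..1} (\<lambda>_. x) (\<lambda>s. R i (\<phi> s))"
      by (rule section_along_cong[OF sub[OF that(1-3)] that(4)])
    then have "R i (\<phi> s0) \<in> Z x" using that(6) by (auto simp: section_along_def)
    then have "section_along Z {0..1::real} (\<lambda>_. x) (\<lambda>_. R i (\<phi> s0))"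
      by (simp add: section_along_def)
    from section_unique[OF Z _ _ s this that(6) _ that(5)] show ?thesis by simp
  qed
  have left: "R i (u, 0) = i" if "i \<in> Z x" "u \<in> {0..1}" for i u
  proof -
    have "R i (u, 0) = R i (0, 0)"
      by (rule const[OF that(1), of "\<lambda>u. (u, 0)"]) (use h(4) that(2) in \<open>auto simp: D_def intro!: continuous_intros\<close>)
    with R(2) that(1) show ?thesis by simp
  qed
  have top: "R i (1, s) = i" if "i \<in> Z x" "s \<in> {0..1}" for i s
  proof -
    have "R i (1, s) = R i (1, 0)"
      by (rule const[OF that(1), of "\<lambda>s. (1, s)"]) (use h(3) that(2) in \<open>auto simp: D_def intro!: continuous_intros\<close>)
    with left that(1) show ?thesis by simp
  qed
  have right: "R i (u, 1) = i" if "i \<in> Z x" "u \<in> {0..1}" for i u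
  proof -
    have "R i (u, 1) = R i (1, 1)"
      by (rule const[OF that(1), of "\<lambda>u. (u, 1)"]) (use h(5) that(2) in \<open>auto simp: D_def intro!: continuous_intros\<close>)
    with top that(1) show ?thesis by simp
  qed
  have inj: "i = j" if "i \<in> Z x" "j \<in> Z x" "d \<in> D" "R i d = R j d" for i j d
  proof -
    have "R i (0, 0) = R j (0, 0)"
      by (rule section_unique[OF Z convex_connected[OF conv] h(1) R(1)[OF that(1)] R(1)[OF that(2)] that(3,4)])
        (simp add: D_def)
    with R(2) that show ?thesis by simp
  qed
  define a where "a i s = R i (0, s)" for i s
  define \<sigma> where "\<sigma> i = a i (1 / real m)" for i
  have m1: "1 / real m \<in> {0..1}" using m by auto
  have base: "section_along Z {0..1} (\<lambda>s. \<gamma> (frac (real m * s))) (a i)" if "i \<in> Z x" for i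
    unfolding a_def by (rule section_along_cong[OF sub[OF that, of "{0..1}" "\<lambda>s. (0, s)"]])
      (auto simp: D_def h(2) intro!: continuous_intros)
  have U: "continuous_on {0..1} (\<lambda>s. \<gamma> (frac (real m * s)))"
    using homotopic_paths_imp_path[OF hom] by (simp add: path_def)
  have \<sigma>: "\<sigma> i \<in> Z x" if "i \<in> Z x" for i
  proof -
    have "a i (1 / real m) \<in> Z (\<gamma> (frac (real m * (1 / real m))))"
      using base[OF that] m1 unfolding section_along_def by blast
    with m \<gamma>(2) show ?thesis by (simp add: \<sigma>_def)
  qed
  have shift: "a i (s + 1 / real m) = a (\<sigma> i) s" if i: "i \<in> Z x" and s: "0 \<le> s" "s + 1 / real m \<le> 1" for i s
  proof -
    let ?S = "{0..1 - 1 / real m}"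
    have "section_along Z ?S (\<lambda>s. \<gamma> (frac (real m * (s + 1 / real m)))) (\<lambda>s. a i (s + 1 / real m))"
      by (rule section_along_compose[OF base[OF i]]) (auto intro!: continuous_intros)
    then have 1: "section_along Z ?S (\<lambda>s. \<gamma> (frac (real m * s))) (\<lambda>s. a i (s + 1 / real m))"
      by (rule section_along_cong) (use m in \<open>simp add: distrib_left frac_1_eq\<close>)
    have 2: "section_along Z ?S (\<lambda>s. \<gamma> (frac (real m * s))) (a (\<sigma> i))"
      by (rule section_along_subset[OF base[OF \<sigma>[OF i]]]) auto
    show ?thesis
    proof (rule section_unique[OF Z _ _ 1 2])
      show "continuous_on ?S (\<lambda>s. \<gamma> (frac (real m * s)))"
        by (rule continuous_on_subset[OF U]) auto
      show "0 \<in> ?S" using m1 by auto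
      show "a i (0 + 1 / real m) = a (\<sigma> i) 0"
        using R(2)[OF \<sigma>[OF i]] by (simp add: \<sigma>_def a_def)
    qed (use s in auto)
  qed
  have iterate: "(\<sigma> ^^ k) i \<in> Z x \<and> a i (real k / real m) = (\<sigma> ^^ k) i" if "k \<le> m" "i \<in> Z x" for k i
    using that
  proof (induction k arbitrary: i)
    case 0
    then show ?case using R(2) by (simp add: a_def)
  next
    case (Suc k)
    have "real k / real m + 1 / real m = real (Suc k) / real m" by (simp add: add_divide_distrib)
    moreover have "real (Suc k) / real m \<le> 1" using Suc.prems m by (simp del: of_nat_Suc)
    ultimately have "a i (real (Suc k) / real m) = a (\<sigma> i) (real k / real m)"
      using shift[OF Suc.prems(2), of "real k / real m"] by simp
    with Suc.IH[of "\<sigma> i"] \<sigma> Suc.prems show ?case by (simp add: funpow_swap1)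
  qed
  have order: "(\<sigma> ^^ m) i = i" if "i \<in> Z x" for i
    using iterate[OF order_refl that] m right[OF that, of 0] by (simp add: a_def)
  have fixed: "\<sigma> i0 = i0" if i0: "i0 \<in> Z x" for i0
  proof (rule ccontr)
    assume ne: "\<sigma> i0 \<noteq> i0"
    define B where "B = {(\<sigma> ^^ k) i0 | k. True}"
    have OZ: "i \<in> Z x" if "i \<in> B" for i
    proof -
      have "(\<sigma> ^^ k) i0 \<in> Z x" for k by (induction k) (auto simp: i0 \<sigma>)
      with that show ?thesis by (auto simp: B_def)
    qed
    have \<sigma>B: "\<sigma> i \<in> B" if "i \<in> B" for i
    proof -
      obtain k where "i = (\<sigma> ^^ k) i0" using \<open>i \<in> B\<close> by (auto simp: B_def)
      then have "\<sigma> i = (\<sigma> ^^ Suc k) i0" by simp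
      then show ?thesis unfolding B_def by blast
    qed
    have fin: "finite B"
      using Z OZ by (meson finite_subset root_family_def subsetI)
    have "{i0, \<sigma> i0} \<subseteq> B"
      by (auto simp: B_def intro: exI[of _ 0] exI[of _ 1])
    from card_mono[OF fin this] have card: "2 \<le> card B" using ne by simp
    \<comment> \<open>Extending \<sigma> by the identity off its orbit gives a permutation of the
      whole type.\<close>
    define \<pi> where "\<pi> i = (if i \<in> B then \<sigma> i else i)" for i
    have "inj_on \<sigma> B"
    proof (rule inj_onI)
      fix i j assume ij: "i \<in> B" "j \<in> B" "\<sigma> i = \<sigma> j"
      then show "i = j"
        using inj[of i j "(0, 1 / real m)"] OZ m1 by (auto simp: \<sigma>_def a_def D_def)
    qed
    then have "bij_betw \<sigma> B B"
      using \<sigma>B fin by (simp add: bij_betw_def endo_inj_surj image_subsetI)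
    then have \<pi>: "\<pi> permutes B"
      by (intro bij_imp_permutes) (auto simp: \<pi>_def cong: bij_betw_cong)
    have \<pi>_pow: "(\<pi> ^^ k) i = (\<sigma> ^^ k) i \<and> (\<sigma> ^^ k) i \<in> B" if "i \<in> B" for k i
      using that \<sigma>B by (induction k) (auto simp: \<pi>_def)
    show False
    proof (rule torsion_loop_monodromy_cycles[OF fin card m, of R \<pi>])
      show "continuous_on ({0..1} \<times> {0..1}) (R i)" if "i \<in> B" for i
        using R(1)[OF OZ[OF that]] by (simp add: section_along_def D_def)
      show "\<exists>n. (\<pi> ^^ n) i = j" if "i \<in> B" "j \<in> B" for i j
      proof -
        obtain k l where kl: "i = (\<sigma> ^^ k) i0" "j = (\<sigma> ^^ l) i0" using \<open>i \<in> B\<close> \<open>j \<in> B\<close> by (auto simp: B_def)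
        have "((\<sigma> ^^ m) ^^ k) i0 = i0" by (induction k) (simp_all add: order i0)
        then have "(\<sigma> ^^ (m * k)) i0 = i0" by (simp only: funpow_mult mult.commute)
        \<comment> \<open>As \<open>\<sigma> ^^ (m * k)\<close> fixes \<open>i0\<close>, the power
          \<open>m * k - k\<close> undoes \<open>\<sigma> ^^ k\<close>; the subtraction is exact
          because \<open>m\<close> is positive.\<close>
        moreover have "(\<sigma> ^^ (l + (m * k - k))) i = (\<sigma> ^^ (l + (m * k - k + k))) i0"
          unfolding kl by (simp only: funpow_add comp_apply add.assoc)
        moreover have "m * k - k + k = m * k" using m by simp
        ultimately have "(\<sigma> ^^ (l + (m * k - k))) i = j"
          unfolding kl(2) by (simp add: funpow_add)
        with \<pi>_pow[OF that(1)] show ?thesis by metis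
      qed
      show "\<pi> ^^ m = id"
      proof
        fix i
        have "(\<pi> ^^ m) i = i" if "i \<notin> B" using that by (induction m) (auto simp: \<pi>_def)
        then show "(\<pi> ^^ m) i = id i" using \<pi>_pow order OZ by (cases "i \<in> B") auto
      qed
      show "R i (0, s + 1 / real m) = R (\<pi> i) (0, s)" if "i \<in> B" "0 \<le> s" "s + 1 / real m \<le> 1" for i s
        using shift[OF OZ[OF that(1)] that(2,3)] that(1) by (simp add: a_def \<pi>_def)
    qed (use left right top inj OZ \<pi> in \<open>auto simp: D_def\<close>)
  qed
  have r0: "r 0 \<in> Z x" using r \<gamma>(2) by (force simp: section_along_def)
  \<comment> \<open>The first \<open>m\<close>-th part of the iterated loop, slowed down, is
    \<gamma> itself. At \<open>s = 1\<close> the value of \<open>frac\<close> drops to 0, which is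
    harmless for a closed loop.\<close>
  have "section_along Z {0..1} (\<lambda>s. \<gamma> (frac (real m * (s / real m)))) (\<lambda>s. a (r 0) (s / real m))"
    using m by (intro section_along_compose[OF base[OF r0]]) (auto intro!: continuous_intros simp: field_simps)
  then have "section_along Z {0..1} \<gamma> (\<lambda>s. a (r 0) (s / real m))"
  proof (rule section_along_cong)
    fix s :: real assume s: "s \<in> {0..1}"
    show "\<gamma> (frac (real m * (s / real m))) = \<gamma> s"
    proof (cases "s = 1")
      case False
      then have "frac s = s" using s by (simp add: frac_eq)
      with m show ?thesis by simp
    qed (use m \<gamma> in simp)
  qed
  from section_unique[OF Z _ _ r this, of 0 1] \<gamma>(1) have "r 1 = a (r 0) (1 / real m)"
    using R(2)[OF r0] by (simp add: path_def a_def)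
  then show ?thesis using fixed[OF r0] by (simp add: \<sigma>_def)
qed

section \<open>Iterated loops and powers in the fundamental group\<close>

lemma continuous_on_periodic_extension:
  fixes \<gamma> :: "real \<Rightarrow> 'a::topological_space"
  assumes "path \<gamma>" "\<gamma> 0 = \<gamma> 1"
  shows "continuous_on {0..real n} (\<lambda>s. \<gamma> (frac s))"
proof (induction n)
  case (Suc n)
  have "continuous_on {real n..real n + 1} (\<lambda>s. \<gamma> (s - real n))"
    using assms(1) unfolding path_def
    by (rule continuous_on_compose2) (auto intro!: continuous_intros)
  \<comment> \<open>At integers \<open>frac\<close> is discontinuous; the jump from 1 to 0 is
    absorbed by \<open>\<gamma> 0 = \<gamma> 1\<close>.\<close>
  moreover have "\<gamma> (s - real n) = \<gamma> (frac s)" if "s \<in> {real n..real n + 1}" for s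
  proof (cases "s = real n + 1")
    case True
    then have "frac s = 0" "s - real n = 1" by simp_all
    then show ?thesis by (simp only: assms(2))
  next
    case False
    then have "frac s = s - real n"
      using that by (simp add: frac_unique_iff)
    then show ?thesis by simp
  qed
  ultimately have "continuous_on {real n..real n + 1} (\<lambda>s. \<gamma> (frac s))"
    by (rule continuous_on_eq)
  with Suc have "continuous_on ({0..real n} \<union> {real n..real n + 1}) (\<lambda>s. \<gamma> (frac s))"
    by (intro continuous_on_closed_Un) auto
  moreover have "{0..real n} \<union> {real n..real n + 1} = {0..real (Suc n)}" by auto
  ultimately show ?case by simp
qed simp

lemma path_iterate:
  fixes \<gamma> :: "real \<Rightarrow> 'a::topological_space"
  assumes "path \<gamma>" "\<gamma> 0 = \<gamma> 1"
  shows "path (\<lambda>s. \<gamma> (frac (real n * s)))"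
  unfolding path_def
  by (rule continuous_on_compose2[OF continuous_on_periodic_extension[OF assms, of n]])
    (auto intro!: continuous_intros simp: mult_left_le)

lemma homotopic_paths_iterate_Suc:
  fixes \<gamma> :: "real \<Rightarrow> 'a::topological_space"
  assumes \<gamma>: "path \<gamma>" "\<gamma> 0 = \<gamma> 1"
  shows "homotopic_paths UNIV ((\<lambda>s. \<gamma> (frac (real n * s))) +++ \<gamma>) (\<lambda>s. \<gamma> (frac (real (Suc n) * s)))"
proof (rule homotopic_paths_sym, rule homotopic_paths_reparametrize)
  \<comment> \<open>The left half of \<open>+++\<close> has to cover \<open>n\<close> of the
    \<open>n + 1\<close> turns, the right half the last one.\<close>
  let ?f = "\<lambda>s. if s \<le> 1 / 2 then 2 * real n * s / real (Suc n) else (real n + 2 * s - 1) / real (Suc n)"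
  show "path (\<lambda>s. \<gamma> (frac (real (Suc n) * s)))" using \<gamma> by (rule path_iterate)
  show "continuous_on {0..1} ?f"
    by (intro continuous_on_cases_1 continuous_intros) auto
  show "?f \<in> {0..1} \<rightarrow> {0..1}"
  proof
    fix s :: real assume s: "s \<in> {0..1}"
    have "2 * real n * s \<le> real n" if "s \<le> 1 / 2" using mult_left_mono[OF that, of "2 * real n"] by simp
    with s show "?f s \<in> {0..1}" by (auto simp: field_simps)
  qed
  fix t :: real assume t: "t \<in> {0..1}"
  show "((\<lambda>s. \<gamma> (frac (real n * s))) +++ \<gamma>) t = \<gamma> (frac (real (Suc n) * ?f t))"
  proof (cases "t \<le> 1 / 2")
    case True
    have "real (Suc n) * ?f t = real n * (2 * t)" using True by (simp add: field_simps del: of_nat_Suc)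
    then show ?thesis unfolding \<open>real (Suc n) * ?f t = real n * (2 * t)\<close> using True by (simp add: joinpaths_def)
  next
    case False
    have eq: "real (Suc n) * ?f t = real n + 2 * t - 1" using False by (simp del: of_nat_Suc)
    have "\<gamma> (frac (real n + 2 * t - 1)) = \<gamma> (2 * t - 1)"
    proof (cases "t = 1")
      case True
      then have "frac (real n + 2 * t - 1) = 0" "2 * t - 1 = 1" by simp_all
      then show ?thesis by (simp only: \<gamma>(2))
    next
      case f: False
      have "frac (real n + 2 * t - 1) = 2 * t - 1"
        using t f False by (simp add: frac_unique_iff)
      then show ?thesis by simp
    qed
    then show ?thesis unfolding eq using False by (simp add: joinpaths_def)
  qed
qed auto

text \<open>Repeated \<open>+++\<close> produces factors running at different speeds. The
  representative \<open>\<gamma> (frac (n s))\<close> has the exact period \<open>1 / n\<close> on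
  which the monodromy argument relies.\<close>

lemma fundamental_group_pow:
  fixes \<gamma> :: "real \<Rightarrow> 'a::topological_space"
  assumes \<gamma>: "path \<gamma>" "\<gamma> 0 = x" "\<gamma> 1 = x"
  shows "{r. homotopic_paths UNIV \<gamma> r} [^]\<^bsub>fundamental_group UNIV x\<^esub> (n::nat)
    = {r. homotopic_paths UNIV (\<lambda>s. \<gamma> (frac (real n * s))) r}"
proof (induction n)
  case 0
  then show ?case using \<gamma>(2) by (simp add: nat_pow_def fundamental_group_def)
next
  case (Suc n)
  let ?U = "\<lambda>n s. \<gamma> (frac (real n * s))"
  have loop: "\<gamma> 0 = \<gamma> 1" using \<gamma> by simp
  have ends: "pathfinish (?U n) = pathstart \<gamma>"
  proof -
    have "frac (real n) = 0" by simp
    then show ?thesis by (simp only: pathfinish_def pathstart_def mult_1_right)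
  qed
  have "{r. homotopic_paths UNIV \<gamma> r} [^]\<^bsub>fundamental_group UNIV x\<^esub> Suc n
      = {r. \<exists>p\<in>{r. homotopic_paths UNIV (?U n) r}. \<exists>q\<in>{r. homotopic_paths UNIV \<gamma> r}. homotopic_paths UNIV (p +++ q) r}"
    using Suc by (simp add: nat_pow_def fundamental_group_def)
  also have "\<dots> = {r. homotopic_paths UNIV (?U n +++ \<gamma>) r}"
  proof (rule subset_antisym; rule subsetI)
    fix r assume "r \<in> {r. \<exists>p\<in>{r. homotopic_paths UNIV (?U n) r}. \<exists>q\<in>{r. homotopic_paths UNIV \<gamma> r}. homotopic_paths UNIV (p +++ q) r}"
    then show "r \<in> {r. homotopic_paths UNIV (?U n +++ \<gamma>) r}"
      using ends by (blast intro: homotopic_paths_join homotopic_paths_trans)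
  next
    fix r assume "r \<in> {r. homotopic_paths UNIV (?U n +++ \<gamma>) r}"
    moreover have "homotopic_paths UNIV (?U n) (?U n)" "homotopic_paths UNIV \<gamma> \<gamma>"
      using path_iterate[OF \<gamma>(1) loop] \<gamma>(1) by simp_all
    ultimately show "r \<in> {r. \<exists>p\<in>{r. homotopic_paths UNIV (?U n) r}. \<exists>q\<in>{r. homotopic_paths UNIV \<gamma> r}. homotopic_paths UNIV (p +++ q) r}"
      by blast
  qed
  also have "\<dots> = {r. homotopic_paths UNIV (?U (Suc n)) r}"
    using homotopic_paths_iterate_Suc[OF \<gamma>(1) loop, of n] homotopic_paths_sym homotopic_paths_trans by blast
  finally show ?case .
qed

lemma torsion_loop_homotopy:
  fixes \<gamma> :: "real \<Rightarrow> 'a::topological_space"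
  assumes tors: "torsion_group (fundamental_group UNIV x)" and \<gamma>: "path \<gamma>" "\<gamma> 0 = x" "\<gamma> 1 = x"
  obtains m where "0 < (m::nat)" "homotopic_paths UNIV (\<lambda>s. \<gamma> (frac (real m * s))) (\<lambda>_. x)"
proof -
  let ?C = "{r. homotopic_paths UNIV \<gamma> r}"
  have "\<gamma> \<in> loops_at UNIV x"
    using \<gamma> by (simp add: loops_at_def pathstart_def pathfinish_def)
  then have "{(p, q). homotopic_paths UNIV p q} `` {\<gamma>} \<in> carrier (fundamental_group UNIV x)"
    by (simp only: fundamental_group_def partial_object.simps quotientI)
  moreover have "{(p, q). homotopic_paths UNIV p q} `` {\<gamma>} = ?C" by auto
  ultimately have "?C \<in> carrier (fundamental_group UNIV x)" by (simp only:)
  then obtain m :: nat where m: "m > 0" "?C [^]\<^bsub>fundamental_group UNIV x\<^esub> m = \<one>\<^bsub>fundamental_group UNIV x\<^esub>"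
    using tors unfolding torsion_group_def by blast
  have "\<gamma> 0 = \<gamma> 1" using \<gamma> by simp
  then have "homotopic_paths UNIV (\<lambda>s. \<gamma> (frac (real m * s))) (\<lambda>s. \<gamma> (frac (real m * s)))"
    using path_iterate[OF \<gamma>(1)] by simp
  then have "(\<lambda>s. \<gamma> (frac (real m * s))) \<in> \<one>\<^bsub>fundamental_group UNIV x\<^esub>"
    using m(2) unfolding fundamental_group_pow[OF \<gamma>] by blast
  then have "homotopic_paths UNIV (\<lambda>_. x) (\<lambda>s. \<gamma> (frac (real m * s)))"
    by (simp add: fundamental_group_def)
  with m(1) that homotopic_paths_sym show ?thesis by blast
qed

subsection \<open>Global sections\<close>

definition trivial_monodromy :: "('a::topological_space \<Rightarrow> complex set) \<Rightarrow> 'a \<Rightarrow> bool" where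
  "trivial_monodromy Z x \<longleftrightarrow> (\<forall>\<gamma> r. path \<gamma> \<longrightarrow> \<gamma> 0 = x \<longrightarrow> \<gamma> 1 = x \<longrightarrow>
     section_along Z {0..1} \<gamma> r \<longrightarrow> r 1 = r 0)"

text \<open>Lift the loop that follows \<gamma> and returns along \<gamma>'. The lift closes up, so
  its first half is \<open>r\<close> and its second half, read backwards, is \<open>r'\<close>; they
  meet in the middle.\<close>

lemma section_endpoint_unique:
  fixes Z :: "'a::topological_space \<Rightarrow> complex set"
  assumes Z: "root_family n Z"
    and mono: "trivial_monodromy Z x"
    and \<gamma>: "path \<gamma>" "\<gamma> 0 = x" "\<gamma> 1 = y" "section_along Z {0..1} \<gamma> r"
    and \<gamma>': "path \<gamma>'" "\<gamma>' 0 = x" "\<gamma>' 1 = y" "section_along Z {0..1} \<gamma>' r'"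
    and "r 0 = r' 0"
  shows "r 1 = r' 1"
proof -
  define L where "L = \<gamma> +++ reversepath \<gamma>'"
  have L: "path L" "L 0 = x" "L 1 = x"
  proof -
    show "path L"
      unfolding L_def using \<gamma>(1,3) \<gamma>'(1,3)
      by (intro path_join_imp) (simp_all add: pathfinish_def pathstart_def reversepath_def path_reversepath[unfolded reversepath_def])
    show "L 0 = x" "L 1 = x"
      using \<gamma>(2) \<gamma>'(2) by (simp_all add: L_def joinpaths_def reversepath_def)
  qed
  have "r 0 \<in> Z (L 0)" using \<gamma> L by (auto simp: section_along_def)
  then obtain s where s: "section_along Z {0..1} L s" "s 0 = r 0"
    using section_exists[OF Z, of "{0..1}" L 0 "r 0"] L(1) by (auto simp: path_def)
  have s1: "s 1 = r 0" using mono L s unfolding trivial_monodromy_def by metis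
  have "section_along Z {0..1} (\<lambda>t. L (t / 2)) (\<lambda>t. s (t / 2))"
    by (rule section_along_compose[OF s(1)]) (auto intro!: continuous_intros)
  then have "section_along Z {0..1} \<gamma> (\<lambda>t. s (t / 2))"
    by (rule section_along_cong) (auto simp: L_def joinpaths_def)
  from section_unique[OF Z _ _ this \<gamma>(4), of 0 1] have 1: "s (1 / 2) = r 1"
    using \<gamma>(1) s(2) by (simp add: path_def)
  have "section_along Z {0..1} (\<lambda>t. L (1 - t / 2)) (\<lambda>t. s (1 - t / 2))"
    by (rule section_along_compose[OF s(1)]) (auto intro!: continuous_intros)
  then have "section_along Z {0..1} \<gamma>' (\<lambda>t. s (1 - t / 2))"
  proof (rule section_along_cong)
    fix t :: real assume "t \<in> {0..1}"
    then show "L (1 - t / 2) = \<gamma>' t"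
      using \<gamma>(3) \<gamma>'(3) by (cases "t = 1") (auto simp: L_def joinpaths_def reversepath_def)
  qed
  from section_unique[OF Z _ _ this \<gamma>'(4), of 0 1] have "s (1 / 2) = r' 1"
    using \<gamma>'(1) s1 \<open>r 0 = r' 0\<close> by (simp add: path_def)
  with 1 show ?thesis by simp
qed

lemma section_along_join:
  assumes "section_along Z {0..1} \<gamma> r" "section_along Z {0..1} \<delta> s" "r 1 = s 0"
  shows "section_along Z {0..1} (\<gamma> +++ \<delta>) (r +++ s)"
  unfolding section_along_def
proof
  show "continuous_on {0..1} (r +++ s)"
    using path_join_imp[of r s] assms
    by (simp add: section_along_def path_def[symmetric] pathstart_def pathfinish_def)
  show "\<forall>d\<in>{0..1}. (r +++ s) d \<in> Z ((\<gamma> +++ \<delta>) d)"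
    using assms(1,2) by (auto simp: section_along_def joinpaths_def)
qed

text \<open>Each root over \<open>x\<close> is continued along paths to every other point; trivial
  monodromy makes the result independent of the path.\<close>

lemma global_sections:
  fixes Z :: "'a::topological_space \<Rightarrow> complex set"
  assumes Z: "root_family n Z" and conn: "path_connected (UNIV :: 'a set)"
    and loc: "locally path_connected (UNIV :: 'a set)"
    and mono: "trivial_monodromy Z x"
  shows "\<exists>G. \<forall>i\<in>Z x. continuous_on UNIV (G i) \<and> (\<forall>y. G i y \<in> Z y) \<and> G i x = i"
proof -
  define ends where "ends i y w \<longleftrightarrow> (\<exists>\<gamma> r. path \<gamma> \<and> \<gamma> 0 = x \<and> \<gamma> 1 = y \<and> section_along Z {0..1} \<gamma> r \<and> r 0 = i \<and> w = r 1)" for i y w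
  define G where "G i y = (SOME w. ends i y w)" for i y
  have ends_ex: "\<exists>w. ends i y w" if "i \<in> Z x" for i y
  proof -
    obtain \<gamma> where \<gamma>: "path \<gamma>" "\<gamma> 0 = x" "\<gamma> 1 = y"
      using conn unfolding path_connected_def pathstart_def pathfinish_def by blast
    obtain r where "section_along Z {0..1} \<gamma> r" "r 0 = i"
      using section_exists[OF Z, of "{0..1}" \<gamma> 0 i] \<gamma> \<open>i \<in> Z x\<close> by (auto simp: path_def)
    with \<gamma> show ?thesis unfolding ends_def by blast
  qed
  have ends_unique: "w = w'" if "ends i y w" "ends i y w'" for i y w w'
  proof -
    obtain \<gamma> r where "path \<gamma>" "\<gamma> 0 = x" "\<gamma> 1 = y" "section_along Z {0..1} \<gamma> r" "r 0 = i" "w = r 1"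
      using \<open>ends i y w\<close> unfolding ends_def by blast
    moreover obtain \<gamma>' r' where "path \<gamma>'" "\<gamma>' 0 = x" "\<gamma>' 1 = y" "section_along Z {0..1} \<gamma>' r'" "r' 0 = i" "w' = r' 1"
      using \<open>ends i y w'\<close> unfolding ends_def by blast
    ultimately show ?thesis
      using section_endpoint_unique[OF Z mono, of \<gamma> y r \<gamma>' r'] by simp
  qed
  have G: "ends i y (G i y)" if "i \<in> Z x" for i y
    unfolding G_def by (rule someI_ex[OF ends_ex[OF that]])
  have G_eq: "G i y = w" if "i \<in> Z x" "ends i y w" for i y w
    using G[OF that(1)] that(2) ends_unique by blast
  show ?thesis
  proof (intro exI[of _ G] ballI conjI allI)
    show mem: "G i y \<in> Z y" if "i \<in> Z x" for i y
      using G[OF that, of y] by (auto simp: ends_def section_along_def)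
    show "G i x = i" if "i \<in> Z x" for i
    proof (rule G_eq[OF that])
      have "section_along Z {0..1} (\<lambda>_::real. x) (\<lambda>_. i)" using that by (simp add: section_along_def)
      then show "ends i x i" unfolding ends_def by (intro exI[of _ "\<lambda>_. x"] exI[of _ "\<lambda>_. i"]) (simp add: path_def)
    qed
    fix i assume i: "i \<in> Z x"
    show "continuous_on UNIV (G i)"
      unfolding continuous_on_def
    proof
      fix y0 :: 'a
      obtain T \<epsilon> \<rho> where triv: "trivializes Z y0 T \<epsilon> \<rho>"
        using trivialization_exists[OF Z] by blast
      define z where "z = G i y0"
      have z: "z \<in> Z y0" unfolding z_def using mem[OF i] .
      have T: "open T" "y0 \<in> T" "0 < \<epsilon>" "continuous_on T (\<rho> z)" "\<And>y. y \<in> T \<Longrightarrow> Z y \<inter> ball z \<epsilon> = {\<rho> z y}"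
        using triv z unfolding trivializes_def by blast+
      have \<rho>0: "\<rho> z y0 = z" using T(5)[OF T(2)] T(3) z by (metis IntI centre_in_ball singletonD)
      have "openin (top_of_set UNIV) T" using T(1) by simp
      with loc T(2) obtain u v where uv: "open u" "path_connected v" "y0 \<in> u" "u \<subseteq> v" "v \<subseteq> T"
        unfolding locally_def by (metis open_openin subtopology_UNIV)
      \<comment> \<open>Appending a path inside the trivializing set continues the lift by the local
        section \<open>\<rho> z\<close>, so \<open>G i\<close> agrees with it near \<open>y0\<close>
        and inherits its continuity.\<close>
      have near: "\<rho> z y = G i y" if y: "y \<in> u" for y
      proof -
        obtain \<delta> where \<delta>: "path \<delta>" "path_image \<delta> \<subseteq> v" "\<delta> 0 = y0" "\<delta> 1 = y"
          using uv y unfolding path_connected_def pathstart_def pathfinish_def by blast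
        have \<delta>T: "\<delta> t \<in> T" if "t \<in> {0..1}" for t
          using \<delta>(2) uv(5) that unfolding path_image_def by blast
        have sec: "section_along Z {0..1} \<delta> (\<lambda>t. \<rho> z (\<delta> t))"
          unfolding section_along_def
        proof
          show "continuous_on {0..1} (\<lambda>t. \<rho> z (\<delta> t))"
            using \<delta>(1) \<delta>T by (intro continuous_on_compose2[OF T(4)]) (auto simp: path_def)
          show "\<forall>t\<in>{0..1}. \<rho> z (\<delta> t) \<in> Z (\<delta> t)" using T(5)[OF \<delta>T] by blast
        qed
        obtain \<gamma> r where \<gamma>: "path \<gamma>" "\<gamma> 0 = x" "\<gamma> 1 = y0" "section_along Z {0..1} \<gamma> r" "r 0 = i" "z = r 1"
          using G[OF i, of y0] unfolding ends_def z_def by blast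
        have "section_along Z {0..1} (\<gamma> +++ \<delta>) (r +++ (\<lambda>t. \<rho> z (\<delta> t)))"
          using \<gamma>(6) \<rho>0 \<delta>(3) by (intro section_along_join \<gamma>(4) sec) simp
        moreover have "path (\<gamma> +++ \<delta>)" using \<gamma> \<delta> by (intro path_join_imp) (auto simp: pathstart_def pathfinish_def)
        ultimately have "ends i y (\<rho> z y)"
          unfolding ends_def using \<gamma> \<delta>
          by (intro exI[of _ "\<gamma> +++ \<delta>"] exI[of _ "r +++ (\<lambda>t. \<rho> z (\<delta> t))"]) (simp add: joinpaths_def)
        then show ?thesis using G_eq[OF i] by simp
      qed
      have "(\<rho> z \<longlongrightarrow> \<rho> z y0) (at y0)"
        using T(4) T(2) at_within_open[OF T(2,1)] unfolding continuous_on_def by fastforce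
      moreover have "\<forall>\<^sub>F y in at y0. \<rho> z y = G i y"
        using uv(1,3) near unfolding eventually_at_topological by blast
      ultimately have "(G i \<longlongrightarrow> \<rho> z y0) (at y0)"
        by (rule Lim_transform_eventually)
      then show "(G i \<longlongrightarrow> G i y0) (at y0)"
        using near[OF uv(3)] by simp
    qed
  qed
qed

section \<open>Splitting over the base\<close>

lemma poly_specialize_pCons:
  "poly (specialize (pCons a f) x) z = a x + z * poly (specialize f x) z"
  by (simp add: specialize_def map_poly_pCons zero_fun_def)

lemma poly_pullback: "poly (pullback p f) r y = poly (specialize f (p y)) (r y)"
proof (induction f)
  case (pCons a f)
  have "pullback p (pCons a f) = pCons (a \<circ> p) (pullback p f)"
    unfolding pullback_def by (rule map_poly_pCons) (simp add: fun_eq_iff zero_fun_def)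
  with pCons show ?case
    by (simp add: poly_specialize_pCons plus_fun_def times_fun_def)
qed (simp add: pullback_def specialize_def zero_fun_def)

lemma coeff_specialize: "coeff (specialize f x) i = coeff f i x"
  by (simp add: specialize_def coeff_map_poly zero_fun_def)

lemma specialize_monic:
  assumes "lead_coeff f = 1"
  shows "degree (specialize f x) = degree f" "lead_coeff (specialize f x) = 1"
proof -
  have "coeff (specialize f x) (degree f) = 1"
    using assms by (simp add: coeff_specialize one_fun_def)
  moreover have "degree (specialize f x) \<le> degree f"
    by (rule degree_le) (simp add: coeff_specialize coeff_eq_0)
  ultimately show "degree (specialize f x) = degree f"
    by (metis le_antisym le_degree zero_neq_one)
  then show "lead_coeff (specialize f x) = 1"
    using \<open>coeff (specialize f x) (degree f) = 1\<close> by simp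
qed

text \<open>The modulus of a monic polynomial at \<open>z\<close> is the product of the distances
  from \<open>z\<close> to its roots. Hence a small value forces a near root, with a bound depending
  only on the degree.\<close>

lemma norm_poly_ge_dist_roots:
  fixes p :: "complex poly"
  assumes "lead_coeff p = 1" "0 \<le> \<epsilon>" "\<And>w. poly p w = 0 \<Longrightarrow> \<epsilon> \<le> dist w z"
  shows "\<epsilon> ^ degree p \<le> norm (poly p z)"
proof -
  obtain root where root: "smult (lead_coeff p) (\<Prod>i<degree p. [:- root i, 1:]) = p"
    by (rule complex_poly_decompose')
  have eval: "poly p w = (\<Prod>i<degree p. w - root i)" for w
  proof -
    have "poly p w = poly (smult (lead_coeff p) (\<Prod>i<degree p. [:- root i, 1:])) w"
      by (simp only: root)
    then show ?thesis by (simp add: assms(1) poly_prod)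
  qed
  have "(\<Prod>i<degree p. \<epsilon>) \<le> (\<Prod>i<degree p. norm (z - root i))"
  proof (rule prod_mono)
    fix i assume "i \<in> {..<degree p}"
    then have "poly p (root i) = 0" by (auto simp: eval)
    with assms(2) assms(3)[of "root i"] show "0 \<le> \<epsilon> \<and> \<epsilon> \<le> norm (z - root i)"
      by (simp add: dist_norm norm_minus_commute)
  qed
  then show ?thesis by (simp add: eval prod_norm)
qed

text \<open>If \<open>z\<close> is a root at \<open>x\<close>, the value at \<open>z\<close> of the
  specialization at \<open>y\<close> tends to 0 as \<open>y\<close> approaches \<open>x\<close>;
  once it is below \<open>\<epsilon> ^ degree f\<close>, some root lies within \<epsilon> of
  \<open>z\<close>.\<close>

lemma root_family_weierstrass:
  fixes f :: "('a::topological_space \<Rightarrow> complex) poly"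
  assumes f: "f \<in> weierstrass_polys"
  shows "root_family (degree f) (\<lambda>x. {z. poly (specialize f x) z = 0})"
  unfolding root_family_def
proof (intro conjI allI ballI impI)
  have lead: "lead_coeff f = 1" using f by (simp add: weierstrass_polys_def)
  note monic = specialize_monic[OF lead]
  fix x
  show "card {z. poly (specialize f x) z = 0} = degree f"
    using f by (simp add: weierstrass_polys_def)
  have "specialize f x \<noteq> 0" using monic(2)[of x] by auto
  then show "finite {z. poly (specialize f x) z = 0}" by (rule poly_roots_finite)
  fix z and \<epsilon> :: real assume z: "z \<in> {z. poly (specialize f x) z = 0}" and \<epsilon>: "0 < \<epsilon>"
  have eval: "poly (specialize f y) z = (\<Sum>i\<le>degree f. coeff f i y * z ^ i)" for y
    by (simp add: poly_altdef monic coeff_specialize)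
  have "continuous_on UNIV (coeff f i)" for i
    using f by (simp add: weierstrass_polys_def continuous_functions_def)
  then have "continuous_on UNIV (\<lambda>y. poly (specialize f y) z)"
    unfolding eval by (intro continuous_intros)
  then have "((\<lambda>y. poly (specialize f y) z) \<longlongrightarrow> poly (specialize f x) z) (at x)"
    by (simp add: continuous_on_def)
  then have "((\<lambda>y. poly (specialize f y) z) \<longlongrightarrow> 0) (nhds x)"
    using z by (simp add: tendsto_nhds_iff)
  then have "\<forall>\<^sub>F y in nhds x. dist (poly (specialize f y) z) 0 < \<epsilon> ^ degree f"
    by (rule tendstoD) (use \<epsilon> in simp)
  then show "\<forall>\<^sub>F y in nhds x. \<exists>w\<in>{z. poly (specialize f y) z = 0}. dist w z < \<epsilon>"
  proof eventually_elim
    case (elim y)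
    show ?case
    proof (rule ccontr)
      assume "\<not> ?thesis"
      then have "\<epsilon> \<le> dist w z" if "poly (specialize f y) w = 0" for w using that by force
      from norm_poly_ge_dist_roots[OF monic(2)[of y] _ this] \<epsilon> elim show False
        by (simp add: monic(1))
    qed
  qed
qed

section \<open>Triviality of the splitting coverings\<close>

lemma homeomorphic_map_imp_covering_map:
  assumes "homeomorphic_map Y X p"
  shows "covering_map Y p X"
  unfolding covering_map_def
proof (intro conjI ballI)
  show "continuous_map Y X p" "p ` topspace Y = topspace X"
    using assms by (auto simp: homeomorphic_imp_continuous_map homeomorphic_imp_surjective_map)
  fix x assume "x \<in> topspace X"
  then show "\<exists>T. x \<in> T \<and> openin X T \<and> (\<exists>\<V>. \<Union> \<V> = {y \<in> topspace Y. p y \<in> T} \<and> (\<forall>U\<in>\<V>. openin Y U) \<and>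
      pairwise disjnt \<V> \<and> (\<forall>U\<in>\<V>. homeomorphic_map (subtopology Y U) (subtopology X T) p))"
    using assms homeomorphic_imp_surjective_map[OF assms]
    by (intro exI[of _ "topspace X"] conjI exI[of _ "{topspace Y}"]) auto
qed

text \<open>Transition maps are normalized to be extensional, whereas \<open>dominates\<close>
  supplies a map with arbitrary values off the total space.\<close>

lemma covering_map_cong:
  assumes "covering_map Y \<phi> Z" "\<And>y. y \<in> topspace Y \<Longrightarrow> \<phi> y = \<psi> y"
  shows "covering_map Y \<psi> Z"
  unfolding covering_map_def
proof (intro conjI ballI)
  have \<phi>: "continuous_map Y Z \<phi>" "\<phi> ` topspace Y = topspace Z"
    using assms(1) by (simp_all add: covering_map_def)
  show "continuous_map Y Z \<psi>"
    by (rule continuous_map_eq[OF \<phi>(1) assms(2)])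
  have "\<phi> ` topspace Y = \<psi> ` topspace Y" by (rule image_cong[OF refl assms(2)])
  with \<phi>(2) show "\<psi> ` topspace Y = topspace Z" by simp
  fix x assume "x \<in> topspace Z"
  then obtain T \<V> where TV: "x \<in> T" "openin Z T" "\<Union> \<V> = {y \<in> topspace Y. \<phi> y \<in> T}" "\<forall>U\<in>\<V>. openin Y U"
    "pairwise disjnt \<V>" "\<forall>U\<in>\<V>. homeomorphic_map (subtopology Y U) (subtopology Z T) \<phi>"
    using assms(1) unfolding covering_map_def by meson
  have "{y \<in> topspace Y. \<phi> y \<in> T} = {y \<in> topspace Y. \<psi> y \<in> T}" using assms(2) by auto
  moreover have "\<forall>U\<in>\<V>. homeomorphic_map (subtopology Y U) (subtopology Z T) \<psi>"
  proof
    fix U assume "U \<in> \<V>"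
    then have "homeomorphic_map (subtopology Y U) (subtopology Z T) \<phi>" using TV(6) by blast
    then show "homeomorphic_map (subtopology Y U) (subtopology Z T) \<psi>"
      by (rule homeomorphic_map_eq) (simp add: assms(2))
  qed
  ultimately show "\<exists>T. x \<in> T \<and> openin Z T \<and> (\<exists>\<V>. \<Union> \<V> = {y \<in> topspace Y. \<psi> y \<in> T} \<and> (\<forall>U\<in>\<V>. openin Y U) \<and>
      pairwise disjnt \<V> \<and> (\<forall>U\<in>\<V>. homeomorphic_map (subtopology Y U) (subtopology Z T) \<psi>))"
    using TV(1-5) by (intro exI[of _ T] conjI exI[of _ \<V>]) auto
qed

text \<open>
  Minimality of a splitting covering is only tested against coverings whose points are functions
  \<open>real \<Rightarrow> 'a\<close>; the base itself is among them as the set of constant functions.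
\<close>

lemma splitting_covering_injective:
  fixes f :: "('a::topological_space \<Rightarrow> complex) poly" and q :: "'e \<Rightarrow> 'a"
  assumes f: "f \<in> weierstrass_polys" and conn: "path_connected (UNIV :: 'a set)"
    and loc: "locally path_connected (UNIV :: 'a set)"
    and tors: "torsion_group (fundamental_group (UNIV :: 'a set) x)"
    and E: "splitting_covering f E q"
  shows "inj_on q (topspace E)"
proof -
  define Z where "Z y = {z. poly (specialize f y) z = 0}" for y
  have Z: "root_family (degree f) Z"
    using root_family_weierstrass[OF f] by (simp add: Z_def[abs_def])
  have "trivial_monodromy Z x"
    unfolding trivial_monodromy_def
  proof (intro allI impI)
    fix \<gamma> r assume \<gamma>: "path \<gamma>" "\<gamma> 0 = x" "\<gamma> 1 = x" and r: "section_along Z {0..1} \<gamma> r"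
    obtain m where "0 < (m::nat)" "homotopic_paths UNIV (\<lambda>s. \<gamma> (frac (real m * s))) (\<lambda>_. x)"
      using torsion_loop_homotopy[OF tors \<gamma>] by blast
    then show "r 1 = r 0" using torsion_loop_monodromy[OF Z _ \<gamma> _ r] by blast
  qed
  from global_sections[OF Z conn loc this]
  obtain G where G: "\<And>i. i \<in> Z x \<Longrightarrow> continuous_on UNIV (G i)" "\<And>i y. i \<in> Z x \<Longrightarrow> G i y \<in> Z y"
    "\<And>i. i \<in> Z x \<Longrightarrow> G i x = i"
    by blast
  define c where "c = (\<lambda>(y::'a) (_::real). y)"
  define Y where "Y = subtopology euclidean (range c)"
  \<comment> \<open>Evaluation at 0 is continuous for pointwise convergence, so on constant
    functions it is a homeomorphism with inverse \<open>c\<close>.\<close>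
  define p where "p = (\<lambda>g::real \<Rightarrow> 'a. g 0)"
  have top: "topspace Y = range c" by (simp add: Y_def)
  have pc: "p (c y) = y" for y by (simp add: p_def c_def)
  have cont_p: "continuous_map Y euclidean p"
    unfolding Y_def p_def by (intro continuous_map_from_subtopology) simp
  have "continuous_on UNIV c"
    unfolding c_def by (intro continuous_on_coordinatewise_then_product continuous_on_id)
  then have "continuous_map euclidean Y c"
    by (simp add: Y_def continuous_map_in_subtopology)
  then have maps: "homeomorphic_maps Y euclidean p c"
    using cont_p by (auto simp: homeomorphic_maps_def top pc)
  then have "homeomorphic_map Y euclidean p" by (rule homeomorphic_maps_imp_map)
  then have "covering_map Y p euclidean" by (rule homeomorphic_map_imp_covering_map)
  moreover have "path_connected_space Y"
  proof -
    have "path_connected_space (euclidean :: 'a topology)"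
      using conn by (simp flip: path_connectedin_topspace)
    then show ?thesis
      using maps homeomorphic_path_connected_space homeomorphic_space_def by blast
  qed
  ultimately have cov: "path_connected_covering Y p"
    by (simp add: path_connected_covering_def)
  \<comment> \<open>The global sections take the distinct values \<open>G i x = i\<close> over
    \<open>x\<close>, so they remain distinct as functions; restriction makes them
    extensional.\<close>
  have "splits_in f Y p"
    unfolding splits_in_def
  proof (intro exI[of _ "(\<lambda>i. restrict (G i \<circ> p) (topspace Y)) ` Z x"] conjI ballI)
    have fin: "finite (Z x)" "card (Z x) = degree f" using Z by (auto simp: root_family_def)
    show "finite ((\<lambda>i. restrict (G i \<circ> p) (topspace Y)) ` Z x)" using fin by simp
    have "inj_on (\<lambda>i. restrict (G i \<circ> p) (topspace Y)) (Z x)"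
    proof (rule inj_onI)
      fix i j assume ij: "i \<in> Z x" "j \<in> Z x" "restrict (G i \<circ> p) (topspace Y) = restrict (G j \<circ> p) (topspace Y)"
      from fun_cong[OF ij(3), of "c x"] have "G i x = G j x" by (simp add: top pc)
      with G(3) ij show "i = j" by simp
    qed
    then show "card ((\<lambda>i. restrict (G i \<circ> p) (topspace Y)) ` Z x) = degree f"
      using fin by (simp add: card_image)
    show "(\<lambda>i. restrict (G i \<circ> p) (topspace Y)) ` Z x \<subseteq> continuous_functions Y"
    proof
      fix r assume "r \<in> (\<lambda>i. restrict (G i \<circ> p) (topspace Y)) ` Z x"
      then obtain i where i: "i \<in> Z x" "r = restrict (G i \<circ> p) (topspace Y)" by blast
      have "continuous_map Y euclidean (G i \<circ> p)"
        using G(1)[OF i(1)] by (intro continuous_map_compose[OF cont_p]) simp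
      then have "continuous_map Y euclidean r"
        by (rule continuous_map_eq) (simp add: i)
      then show "r \<in> continuous_functions Y" by (simp add: continuous_functions_def i)
    qed
  next
    fix r y assume "r \<in> (\<lambda>i. restrict (G i \<circ> p) (topspace Y)) ` Z x" "y \<in> topspace Y"
    then show "poly (pullback p f) r y = 0"
      using G(2) by (auto simp: poly_pullback Z_def)
  qed
  with E cov obtain \<phi> where \<phi>: "covering_map_over Y p E q \<phi>"
    unfolding splitting_covering_def by blast
  show ?thesis
  proof (rule inj_onI)
    fix a b assume ab: "a \<in> topspace E" "b \<in> topspace E" "q a = q b"
    have "\<phi> ` topspace Y = topspace E"
      using \<phi> by (simp add: covering_map_over_def covering_map_def)
    with ab(1,2) obtain u v where uv: "a = \<phi> (c u)" "b = \<phi> (c v)"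
      unfolding top by blast
    \<comment> \<open>Since \<open>\<phi> \<circ> c\<close> is onto and \<open>q\<close> undoes it,
      \<open>q\<close> is injective.\<close>
    have "q (\<phi> (c y)) = y" for y
      using \<phi> by (simp add: covering_map_over_def top pc)
    with uv ab(3) show "a = b" by simp
  qed
qed

section \<open>The absolute Galois group\<close>

text \<open>On a one-element carrier all group axioms reduce to the second assumption, so the deck
  groups need not first be shown to be groups.\<close>

lemma trivial_groupI:
  assumes "carrier G = {\<one>\<^bsub>G\<^esub>}" "\<one>\<^bsub>G\<^esub> \<otimes>\<^bsub>G\<^esub> \<one>\<^bsub>G\<^esub> = \<one>\<^bsub>G\<^esub>"
  shows "trivial_group G"
  unfolding trivial_group_def by (auto intro!: groupI simp: assms)

text \<open>A deck transformation preserves fibres, and here every fibre has at most one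
  point.\<close>

lemma carrier_deck_group_injective:
  assumes "inj_on p (topspace Y)"
  shows "carrier (deck_group Y p) = {\<lambda>y\<in>topspace Y. y}"
proof (rule subset_antisym; rule subsetI)
  fix \<sigma> assume "\<sigma> \<in> carrier (deck_group Y p)"
  then have \<sigma>: "\<sigma> \<in> Bij (topspace Y)" "\<And>y. y \<in> topspace Y \<Longrightarrow> p (\<sigma> y) = p y"
    by (auto simp: deck_group_def)
  have "\<sigma> y = (\<lambda>y\<in>topspace Y. y) y" for y
  proof (cases "y \<in> topspace Y")
    case True
    have "\<sigma> y \<in> topspace Y" using Bij_imp_funcset[OF \<sigma>(1)] True by blast
    with assms \<sigma>(2)[OF True] True show ?thesis by (simp add: inj_onD)
  next
    case False
    then show ?thesis using Bij_imp_extensional[OF \<sigma>(1)] by (simp add: extensional_def)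
  qed
  then show "\<sigma> \<in> {\<lambda>y\<in>topspace Y. y}" by blast
next
  fix \<sigma> assume "\<sigma> \<in> {\<lambda>y\<in>topspace Y. y}"
  then have \<sigma>: "\<sigma> = (\<lambda>y\<in>topspace Y. y)" by simp
  have "homeomorphic_map Y Y \<sigma>"
    by (rule homeomorphic_map_eq[of Y Y id]) (simp_all add: \<sigma>)
  then show "\<sigma> \<in> carrier (deck_group Y p)"
    by (simp add: deck_group_def \<sigma> id_Bij)
qed

lemma one_deck_group: "\<one>\<^bsub>deck_group Y p\<^esub> = (\<lambda>y\<in>topspace Y. y)"
  by (simp add: deck_group_def BijGroup_def)

lemma mult_one_deck_group: "\<one>\<^bsub>deck_group Y p\<^esub> \<otimes>\<^bsub>deck_group Y p\<^esub> \<one>\<^bsub>deck_group Y p\<^esub> = \<one>\<^bsub>deck_group Y p\<^esub>"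
  using id_Bij[of "topspace Y"] by (simp add: deck_group_def BijGroup_def)

text \<open>Injectivity of \<open>q g\<close> leaves one possible value at each point for a map over
  the base, so the definite description is well defined. Membership in the total space is recorded
  because the neutral deck transformation is the identity only there.\<close>

lemma transition_map_in_topspace:
  assumes inj: "inj_on (q f) (topspace (E f))" "inj_on (q g) (topspace (E g))"
    and e: "e f \<in> topspace (E f)" "e g \<in> topspace (E g)" "q f (e f) = q g (e g)"
    and dom: "dominates E q f g" and y: "y \<in> topspace (E f)"
  shows "transition_map E q e f g y \<in> topspace (E g)"
proof -
  have in_top: "\<phi> y \<in> topspace (E g)" if "covering_map_over (E f) (q f) (E g) (q g) \<phi>" "y \<in> topspace (E f)" for \<phi> y
    using that by (auto simp: covering_map_over_def covering_map_def)
  obtain \<phi> where \<phi>: "covering_map_over (E f) (q f) (E g) (q g) \<phi>"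
    using dom by (auto simp: dominates_def)
  define \<psi> where "\<psi> = restrict \<phi> (topspace (E f))"
  have \<psi>: "covering_map_over (E f) (q f) (E g) (q g) \<psi>"
    using \<phi> unfolding covering_map_over_def \<psi>_def by (auto intro: covering_map_cong)
  have "transition_map E q e f g = \<psi>"
    unfolding transition_map_def
  proof (rule the_equality)
    have "q g (\<psi> (e f)) = q g (e g)"
      using \<psi> e by (simp add: covering_map_over_def)
    then have "\<psi> (e f) = e g"
      using inj(2) in_top[OF \<psi> e(1)] e(2) by (auto dest: inj_onD)
    then show "\<psi> \<in> extensional (topspace (E f)) \<and> covering_map_over (E f) (q f) (E g) (q g) \<psi> \<and> \<psi> (e f) = e g"
      using \<psi> by (simp add: \<psi>_def)
  next
    fix \<eta> assume \<eta>: "\<eta> \<in> extensional (topspace (E f)) \<and> covering_map_over (E f) (q f) (E g) (q g) \<eta> \<and> \<eta> (e f) = e g"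
    show "\<eta> = \<psi>"
    proof (rule extensionalityI)
      fix y assume y: "y \<in> topspace (E f)"
      have "q g (\<eta> y) = q g (\<psi> y)" using \<eta> \<psi> y by (simp add: covering_map_over_def)
      with inj(2) in_top \<eta> \<psi> y show "\<eta> y = \<psi> y" by (blast dest: inj_onD)
    qed (use \<eta> in \<open>simp_all add: \<psi>_def\<close>)
  qed
  with in_top[OF \<psi> y] show ?thesis by simp
qed

lemma carrier_Pi_ST_injective:
  assumes inj: "\<And>f. f \<in> weierstrass_polys \<Longrightarrow> inj_on (q f) (topspace (E f))"
    and e: "\<And>f. f \<in> weierstrass_polys \<Longrightarrow> e f \<in> topspace (E f) \<and> q f (e f) = x"
  shows "carrier (Pi_ST E q e) = {\<one>\<^bsub>Pi_ST E q e\<^esub>}"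
proof -
  let ?u = "\<lambda>f\<in>weierstrass_polys. \<lambda>y\<in>topspace (E f). y"
  have "(\<Pi>\<^sub>E f\<in>weierstrass_polys. carrier (deck_group (E f) (q f))) = (\<Pi>\<^sub>E f\<in>weierstrass_polys. {?u f})"
    by (intro PiE_cong) (simp add: carrier_deck_group_injective inj)
  also have "\<dots> = {?u}" by (rule PiE_singleton) (rule restrict_extensional)
  finally have PiE: "(\<Pi>\<^sub>E f\<in>weierstrass_polys. carrier (deck_group (E f) (q f))) = {?u}" .
  \<comment> \<open>The product has a single element; its compatibility with the transition maps
    shows that the inverse limit is not empty.\<close>
  have "deck_res E q e f g (?u f) = ?u g"
    if fg: "f \<in> weierstrass_polys" "g \<in> weierstrass_polys" "dominates E q f g" for f g
  proof -
    have tm: "transition_map E q e f g y \<in> topspace (E g)" if "y \<in> topspace (E f)" for y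
      using fg e[OF fg(1)] e[OF fg(2)] that
      by (intro transition_map_in_topspace inj) auto
    show ?thesis
      unfolding deck_res_def
      by (rule the_equality) (use fg tm in \<open>auto simp: carrier_deck_group_injective inj\<close>)
  qed
  then have "carrier (Pi_ST E q e) = {?u}"
    unfolding Pi_ST_def by (auto simp: PiE)
  moreover have "\<one>\<^bsub>Pi_ST E q e\<^esub> = ?u"
    by (simp add: Pi_ST_def product_group_def one_deck_group)
  ultimately show ?thesis by simp
qed

lemma mult_one_Pi_ST: "\<one>\<^bsub>Pi_ST E q e\<^esub> \<otimes>\<^bsub>Pi_ST E q e\<^esub> \<one>\<^bsub>Pi_ST E q e\<^esub> = \<one>\<^bsub>Pi_ST E q e\<^esub>"
  by (auto simp: Pi_ST_def product_group_def mult_one_deck_group fun_eq_iff)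

section \<open>Cohomology of the trivial group\<close>

text \<open>Over a one-element group there is only one \<open>n\<close>-tuple, so these are all the
  cochains and each cochain group is a copy of the coefficients.\<close>

definition const_cochain :: "('g, 'b) monoid_scheme \<Rightarrow> nat \<Rightarrow> 'm \<Rightarrow> (nat \<Rightarrow> 'g) \<Rightarrow> 'm" where
  "const_cochain G n a = (\<lambda>s\<in>tuples G n. a)"

locale trivial_group_module =
  fixes G :: "('g, 'b) monoid_scheme" and T :: "'g topology" and A :: "('m, 'd) monoid_scheme"
    and act :: "'g \<Rightarrow> 'm \<Rightarrow> 'm"
  assumes carrier_G: "carrier G = {\<one>\<^bsub>G\<^esub>}" and mult_one: "\<one>\<^bsub>G\<^esub> \<otimes>\<^bsub>G\<^esub> \<one>\<^bsub>G\<^esub> = \<one>\<^bsub>G\<^esub>"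
    and top_T: "topspace T = carrier G" and comm: "comm_group A"
    and act_one: "\<And>a. a \<in> carrier A \<Longrightarrow> act \<one>\<^bsub>G\<^esub> a = a"
begin

interpretation A: comm_group A by (rule comm)

lemma tuples_eq: "tuples G n = {\<lambda>i\<in>{..<n}. \<one>\<^bsub>G\<^esub>}"
proof -
  have "tuples G n = (\<Pi>\<^sub>E i\<in>{..<n}. {(\<lambda>i\<in>{..<n}. \<one>\<^bsub>G\<^esub>) i})"
    unfolding tuples_def by (intro PiE_cong) (simp add: carrier_G)
  also have "\<dots> = {\<lambda>i\<in>{..<n}. \<one>\<^bsub>G\<^esub>}" by (rule PiE_singleton) (rule restrict_extensional)
  finally show ?thesis .
qed

lemma const_cochain_apply: "s \<in> tuples G n \<Longrightarrow> const_cochain G n a s = a"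
  by (simp add: const_cochain_def)

lemma const_cochain_eq_iff: "const_cochain G n a = const_cochain G n b \<longleftrightarrow> a = b"
proof
  assume "const_cochain G n a = const_cochain G n b"
  from fun_cong[OF this, of "\<lambda>i\<in>{..<n}. \<one>\<^bsub>G\<^esub>"] show "a = b"
    by (simp add: const_cochain_def tuples_eq)
qed simp

lemma carrier_cochains: "carrier (cochains G T A n) = const_cochain G n ` carrier A"
proof (rule subset_antisym; rule subsetI)
  fix c assume "c \<in> carrier (cochains G T A n)"
  then have c: "c \<in> (\<Pi>\<^sub>E s\<in>tuples G n. carrier A)" by (simp add: cochains_def)
  let ?s = "\<lambda>i\<in>{..<n}. \<one>\<^bsub>G\<^esub>"
  have "c ?s \<in> carrier A" using c by (rule PiE_mem) (simp add: tuples_eq)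
  moreover have "c = const_cochain G n (c ?s)"
  proof (rule extensionalityI)
    show "c \<in> extensional (tuples G n)" using c by (simp add: PiE_def)
  qed (simp_all add: const_cochain_def tuples_eq)
  ultimately show "c \<in> const_cochain G n ` carrier A" by blast
next
  fix c assume "c \<in> const_cochain G n ` carrier A"
  then obtain a where a: "a \<in> carrier A" "c = const_cochain G n a" by blast
  have top: "topspace (product_topology (\<lambda>_. T) {..<n}) = tuples G n"
    by (simp add: tuples_def top_T)
  have "continuous_map (product_topology (\<lambda>_. T) {..<n}) (discrete_topology (carrier A)) c"
    by (rule continuous_map_eq[where f = "\<lambda>_. a"])
      (use a in \<open>simp_all only: top const_cochain_apply continuous_map_const topspace_discrete_topology simp_thms\<close>)
  with a show "c \<in> carrier (cochains G T A n)"
    by (auto simp: cochains_def const_cochain_def)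
qed

lemma one_cochains: "\<one>\<^bsub>cochains G T A n\<^esub> = const_cochain G n \<one>\<^bsub>A\<^esub>"
  by (simp add: cochains_def product_group_def const_cochain_def)

lemma mult_cochains:
  "const_cochain G n a \<otimes>\<^bsub>cochains G T A n\<^esub> const_cochain G n b = const_cochain G n (a \<otimes>\<^bsub>A\<^esub> b)"
  by (auto simp: cochains_def product_group_def const_cochain_def fun_eq_iff)

lemma alternating_finprod:
  assumes a: "a \<in> carrier A"
  shows "finprod A (\<lambda>i. a [^]\<^bsub>A\<^esub> ((-1) ^ (i + 1) :: int)) {..<n} = (if even n then \<one>\<^bsub>A\<^esub> else inv\<^bsub>A\<^esub> a)"
proof (induction n)
  case (Suc n)
  have "finprod A (\<lambda>i. a [^]\<^bsub>A\<^esub> ((-1) ^ (i + 1) :: int)) {..<Suc n}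
      = a [^]\<^bsub>A\<^esub> ((-1) ^ (n + 1) :: int) \<otimes>\<^bsub>A\<^esub> finprod A (\<lambda>i. a [^]\<^bsub>A\<^esub> ((-1) ^ (i + 1) :: int)) {..<n}"
    unfolding lessThan_Suc using a by (intro A.finprod_insert) (auto simp: Pi_iff)
  with Suc a show ?case by (simp add: A.int_pow_neg A.int_pow_1)
qed simp

text \<open>The coboundary has \<open>n + 2\<close> terms, all equal to \<open>a\<close> up to
  alternating signs beginning with plus. They cancel in pairs for even \<open>n\<close> and leave
  one \<open>a\<close> for odd \<open>n\<close>.\<close>

lemma coboundary_const_cochain:
  assumes a: "a \<in> carrier A"
  shows "coboundary G A act n (const_cochain G n a) = const_cochain G (Suc n) (if even n then \<one>\<^bsub>A\<^esub> else a)"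
proof (rule extensionalityI)
  show "coboundary G A act n (const_cochain G n a) \<in> extensional (tuples G (Suc n))"
    by (simp add: coboundary_def)
  show "const_cochain G (Suc n) (if even n then \<one>\<^bsub>A\<^esub> else a) \<in> extensional (tuples G (Suc n))"
    by (simp add: const_cochain_def)
next
  fix s assume s: "s \<in> tuples G (Suc n)"
  then have s1: "s i = \<one>\<^bsub>G\<^esub>" if "i < Suc n" for i using that by (simp add: tuples_eq)
  have shift: "(\<lambda>j\<in>{..<n}. s (Suc j)) \<in> tuples G n"
    by (auto simp: tuples_eq s1 fun_eq_iff)
  have restr: "restrict s {..<n} \<in> tuples G n"
    by (auto simp: tuples_eq s1 fun_eq_iff)
  have contr: "contract G n i s \<in> tuples G n" if "i < n" for i
    using that by (auto simp: tuples_eq contract_def s1 mult_one fun_eq_iff)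
  have "finprod A (\<lambda>i. const_cochain G n a (contract G n i s) [^]\<^bsub>A\<^esub> ((-1) ^ (i + 1) :: int)) {..<n}
      = finprod A (\<lambda>i. a [^]\<^bsub>A\<^esub> ((-1) ^ (i + 1) :: int)) {..<n}"
    using a by (intro A.finprod_cong') (auto simp: const_cochain_apply contr)
  also have "\<dots> = (if even n then \<one>\<^bsub>A\<^esub> else inv\<^bsub>A\<^esub> a)" by (rule alternating_finprod[OF a])
  finally have "coboundary G A act n (const_cochain G n a) s
      = a \<otimes>\<^bsub>A\<^esub> (if even n then \<one>\<^bsub>A\<^esub> else inv\<^bsub>A\<^esub> a) \<otimes>\<^bsub>A\<^esub> a [^]\<^bsub>A\<^esub> ((-1) ^ (n + 1) :: int)"
    using s a by (simp only: coboundary_def restrict_apply' const_cochain_apply shift restr s1 act_one zero_less_Suc)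
  also have "\<dots> = (if even n then \<one>\<^bsub>A\<^esub> else a)"
    using a by (simp add: A.int_pow_neg A.int_pow_1)
  finally show "coboundary G A act n (const_cochain G n a) s
      = const_cochain G (Suc n) (if even n then \<one>\<^bsub>A\<^esub> else a) s"
    by (simp only: const_cochain_apply[OF s])
qed

lemma cocycles_eq: "cocycles G T A act n = const_cochain G n ` (if even n then carrier A else {\<one>\<^bsub>A\<^esub>})"
proof -
  have eq: "coboundary G A act n (const_cochain G n a) = const_cochain G (Suc n) \<one>\<^bsub>A\<^esub> \<longleftrightarrow>
      (if even n then \<one>\<^bsub>A\<^esub> else a) = \<one>\<^bsub>A\<^esub>" if "a \<in> carrier A" for a
    by (simp only: coboundary_const_cochain[OF that] const_cochain_eq_iff)
  have "cocycles G T A act n = {c \<in> const_cochain G n ` carrier A. coboundary G A act n c = const_cochain G (Suc n) \<one>\<^bsub>A\<^esub>}"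
    by (simp add: cocycles_def kernel_def carrier_cochains one_cochains)
  also have "\<dots> = const_cochain G n ` {a \<in> carrier A. (if even n then \<one>\<^bsub>A\<^esub> else a) = \<one>\<^bsub>A\<^esub>}"
    using eq by blast
  also have "{a \<in> carrier A. (if even n then \<one>\<^bsub>A\<^esub> else a) = \<one>\<^bsub>A\<^esub>} = (if even n then carrier A else {\<one>\<^bsub>A\<^esub>})"
    by auto
  finally show ?thesis .
qed

text \<open>The complex consists of copies of \<open>A\<close> whose differentials are alternately
  zero and the identity, beginning with zero; it is exact in positive degrees.\<close>

lemma coboundaries_Suc_eq_cocycles:
  "coboundaries G T A act (Suc m) = cocycles G T A act (Suc m)"
proof -
  have "coboundaries G T A act (Suc m) = (\<lambda>a. coboundary G A act m (const_cochain G m a)) ` carrier A"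
    by (simp add: coboundaries_def carrier_cochains image_image)
  also have "\<dots> = (\<lambda>a. const_cochain G (Suc m) (if even m then \<one>\<^bsub>A\<^esub> else a)) ` carrier A"
    by (intro image_cong refl coboundary_const_cochain)
  also have "\<dots> = const_cochain G (Suc m) ` (if even (Suc m) then carrier A else {\<one>\<^bsub>A\<^esub>})"
    using A.one_closed by auto
  finally show ?thesis by (simp only: cocycles_eq)
qed

text \<open>Cocycles and coboundaries are the same set \<open>K\<close>, a copy of a subgroup of
  \<open>A\<close>. Translations by elements of \<open>K\<close> map \<open>K\<close> onto itself,
  so \<open>K\<close> is the only coset.\<close>

lemma trivial_H_cont:
  assumes "0 < n"
  shows "trivial_group (H_cont G T A act n)"
proof (rule trivial_groupI)
  define B where "B = (if even n then carrier A else {\<one>\<^bsub>A\<^esub>})"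
  have B: "subgroup B A"
    unfolding B_def using A.subgroup_self A.triv_subgroup by simp
  define K where "K = const_cochain G n ` B"
  have H: "H_cont G T A act n = (cochains G T A n\<lparr>carrier := K\<rparr>) Mod K"
    using assms coboundaries_Suc_eq_cocycles[of "n - 1"]
    by (simp add: H_cont_def cocycles_eq K_def B_def)
  have B_translate: "(\<lambda>a. a \<otimes>\<^bsub>A\<^esub> b) ` B = B" if "b \<in> B" for b
  proof (rule subset_antisym; rule subsetI)
    fix c assume "c \<in> B"
    then have "c = (c \<otimes>\<^bsub>A\<^esub> inv\<^bsub>A\<^esub> b) \<otimes>\<^bsub>A\<^esub> b" "c \<otimes>\<^bsub>A\<^esub> inv\<^bsub>A\<^esub> b \<in> B"
      using that subgroup.mem_carrier[OF B] subgroup.m_closed[OF B] subgroup.m_inv_closed[OF B]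
      by (simp_all add: A.m_assoc)
    then show "c \<in> (\<lambda>a. a \<otimes>\<^bsub>A\<^esub> b) ` B" by blast
  qed (use that subgroup.m_closed[OF B] in auto)
  have coset: "(\<Union>h\<in>K. {h \<otimes>\<^bsub>cochains G T A n\<^esub> k}) = K" if "k \<in> K" for k
  proof -
    obtain b where b: "b \<in> B" "k = const_cochain G n b" using \<open>k \<in> K\<close> K_def by blast
    have "(\<Union>h\<in>K. {h \<otimes>\<^bsub>cochains G T A n\<^esub> k}) = const_cochain G n ` ((\<lambda>a. a \<otimes>\<^bsub>A\<^esub> b) ` B)"
      by (auto simp: K_def b(2) mult_cochains)
    then show ?thesis by (simp add: B_translate[OF b(1)] K_def)
  qed
  have "K \<noteq> {}" using subgroup.one_closed[OF B] by (auto simp: K_def)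
  then have "(\<lambda>k. \<Union>h\<in>K. {h \<otimes>\<^bsub>cochains G T A n\<^esub> k}) ` K = {K}"
    using coset by auto
  moreover have "carrier (H_cont G T A act n) = (\<lambda>k. \<Union>h\<in>K. {h \<otimes>\<^bsub>cochains G T A n\<^esub> k}) ` K"
    unfolding H by (simp add: carrier_FactGroup r_coset_def)
  moreover have "\<one>\<^bsub>H_cont G T A act n\<^esub> = K"
    unfolding H by (simp add: FactGroup_def)
  ultimately show "carrier (H_cont G T A act n) = {\<one>\<^bsub>H_cont G T A act n\<^esub>}" by simp
  have "(\<Union>h\<in>K. \<Union>k\<in>K. {h \<otimes>\<^bsub>cochains G T A n\<^esub> k}) = (\<Union>k\<in>K. \<Union>h\<in>K. {h \<otimes>\<^bsub>cochains G T A n\<^esub> k})"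
    by blast
  also have "\<dots> = K" using coset \<open>K \<noteq> {}\<close> by simp
  finally show "\<one>\<^bsub>H_cont G T A act n\<^esub> \<otimes>\<^bsub>H_cont G T A act n\<^esub> \<one>\<^bsub>H_cont G T A act n\<^esub> = \<one>\<^bsub>H_cont G T A act n\<^esub>"
    unfolding H by (simp add: FactGroup_def set_mult_def)
qed

end

theorem corollary4p8:
  fixes x :: "'a::t2_space"
    and E :: "('a \<Rightarrow> complex) poly \<Rightarrow> 'e topology"
    and q :: "('a \<Rightarrow> complex) poly \<Rightarrow> 'e \<Rightarrow> 'a"
    and e :: "('a \<Rightarrow> complex) poly \<Rightarrow> 'e"
  assumes "path_connected (UNIV :: 'a set)"
    and "locally path_connected (UNIV :: 'a set)"
    and "semilocally_simply_connected (UNIV :: 'a set)"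
    and "pointed_splitting_coverings x E q e"
    and "torsion_group (fundamental_group (UNIV :: 'a set) x)"
  shows "trivial_group (Pi_ST E q e) \<and>
    (\<forall>(A :: ('m, 'd) monoid_scheme) act n.
       discrete_module (Pi_ST E q e) (Pi_ST_topology E q e) A act \<longrightarrow> n > 0 \<longrightarrow>
       trivial_group (H_ST E q e A act n))"
proof (intro conjI allI impI)
  have split: "splitting_covering f (E f) (q f)" "e f \<in> topspace (E f) \<and> q f (e f) = x"
    if "f \<in> weierstrass_polys" for f
    using assms(4) that by (simp_all add: pointed_splitting_coverings_def)
  have carrier: "carrier (Pi_ST E q e) = {\<one>\<^bsub>Pi_ST E q e\<^esub>}"
    by (rule carrier_Pi_ST_injective)
      (use splitting_covering_injective[OF _ assms(1,2,5)] split in auto)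
  then show "trivial_group (Pi_ST E q e)"
    using mult_one_Pi_ST by (rule trivial_groupI)
  fix A :: "('m, 'd) monoid_scheme" and act and n :: nat
  assume A: "discrete_module (Pi_ST E q e) (Pi_ST_topology E q e) A act" and n: "0 < n"
  interpret trivial_group_module "Pi_ST E q e" "Pi_ST_topology E q e" A act
  proof (rule trivial_group_module.intro)
    show "topspace (Pi_ST_topology E q e) = carrier (Pi_ST E q e)"
      by (auto simp: Pi_ST_topology_def Pi_ST_def)
    have "group_action (Pi_ST E q e) (carrier A) act" using A by (simp add: discrete_module_def)
    from group_action.id_eq_one[OF this]
    show "act \<one>\<^bsub>Pi_ST E q e\<^esub> a = a" if "a \<in> carrier A" for a
      using that by (metis restrict_apply')
  qed (use A carrier mult_one_Pi_ST in \<open>auto simp: discrete_module_def\<close>)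
  show "trivial_group (H_ST E q e A act n)"
    unfolding H_ST_def using n by (rule trivial_H_cont)
qed

end
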